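(* Let $(\mathcal{A},\mathsf{H}_A,D_A)$ be an odd spectral triple on a separable unital $C^*$-algebra $A$ (with representation $\pi$) which satisfies the Lipschitz condition, and let $\alpha:\mathbb{Z}\to\mathrm{Aut}(A)$ be a metrically equicontinuous action of $\mathbb{Z}$ on the spectral quantum metric space $(A,L_{D_A})$. Let $\mathsf{H}=\mathsf{H}_A\otimes\ell^2(\mathbb{Z})$, regard $A\rtimes_\alpha\mathbb{Z}$ as a subalgebra of $\mathbb{B}(\mathsf{H})$ via $$\tilde\pi(a)(\xi\otimes\delta_n)=\pi(\alpha_{-n}(a))\xi\otimes\delta_n,\qquad \lambda_m(\xi\otimes\delta_n)=\xi\otimes\delta_{m+n},$$ acting diagonally on $\mathsf{H}\oplus\mathsf{H}$, and let $$D=\begin{bmatrix}0 & D_A\otimes 1-i\otimes M_\iota\\ D_A\otimes 1+i\otimes M_\iota & 0\end{bmatrix},$$ where $\iota:\mathbb{Z}\to\mathbb{Z}$ is the identity function and $M_\iota$ is the self-adjoint operator of multiplication by $\iota$ on $\ell^2(\mathbb{Z})$. Then the even spectral triple $(C_c(\mathbb{Z},\mathcal{A}),\mathsf{H}\oplus\mathsf{H},D)$ on $A\rtimes_\alpha\mathbb{Z}$ induces a Lip-metric on the state space of $A\rtimes_\alpha\mathbb{Z}$.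
   Context: An odd spectral triple $(\mathcal{A},\mathsf{H},D)$ on a separable unital $C^*$-algebra $A$ consists of a representation $\pi$ of $A$ on a separable Hilbert space $\mathsf{H}$, a dense $*$-subalgebra $\mathcal{A}\subset A$ and a densely defined self-adjoint operator $D$ on $\mathsf{H}$ such that $(1+D^2)^{-1/2}$ is compact and, for all $a\in\mathcal{A}$, $\pi(a)$ maps the domain of $D$ into itself and $[D,\pi(a)]$ extends to a bounded operator. An even spectral triple is the same data together with a decomposition $\mathsf{H}=\mathsf{H}_0\oplus\mathsf{H}_1$ with respect to which $\pi$ is diagonal and $D=\begin{bmatrix}0&D_0\\ D_0^*&0\end{bmatrix}$. Put $L_D(a)=\|[D,\pi(a)]\|$ for $a\in\mathcal{A}$. The triple induces the pseudometric $$d(\omega_1,\omega_2)=\sup\{|\omega_1(a)-\omega_2(a)|:a\in\mathcal{A},\ L_D(a)\le 1\}$$ on the state space $S(A)$. If $d$ is a metric inducing the weak-$*$ topology on $S(A)$, then $d$ is called a Lip-metric, the triple is said to satisfy the Lipschitz condition, and $(A,L_D)$ is called a spectral quantum metric space. Equivalently, the triple is non-degenerate ($\pi$ is faithful and, for $a\in\mathcal{A}$, $[D,\pi(a)]=0$ iff $a\in\mathbb{C}1$) and the image of $\{a\in\mathcal{A}:L_D(a)\le1\}$ in $A/\mathbb{C}1$ is totally bounded. An action $\alpha:\Gamma\to\mathrm{Aut}(A)$ of a discrete group is metrically equicontinuous on $(A,L)$, where $L$ is defined on a dense unital $*$-subalgebra $\mathcal{A}$, if it is smooth (each $\alpha_g$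 leaves $\mathcal{A}$ globally invariant) and $\sup_{g\in\Gamma}L(\alpha_g(a))<\infty$ for all $a\in\mathcal{A}$. $C_c(\mathbb{Z},\mathcal{A})$ is the dense $*$-subalgebra of $A\rtimes_\alpha\mathbb{Z}$ consisting of finite sums $\sum_{n}x_n\lambda_n$ with each $x_n\in\mathcal{A}$. *)

theory Defs
  imports "HOL-Analysis.Analysis"
begin

section \<open>Complex Hilbert spaces and unital C*-algebras\<close>

class complex_vector = real_vector +
  fixes scaleC :: "complex \<Rightarrow> 'a \<Rightarrow> 'a" (infixr "*\<^sub>C" 75)
  assumes scaleC_add_right: "c *\<^sub>C (x + y) = c *\<^sub>C x + c *\<^sub>C y"
    and scaleC_add_left: "(b + c) *\<^sub>C x = b *\<^sub>C x + c *\<^sub>C x"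
    and scaleC_scaleC: "b *\<^sub>C (c *\<^sub>C x) = (b * c) *\<^sub>C x"
    and scaleR_scaleC: "r *\<^sub>R x = complex_of_real r *\<^sub>C x"

text \<open>
  The complex inner product is linear in its first argument; the underlying real Hilbert space
  carries its real part, so that both induce the same norm.  Hilbert spaces are nonzero, because
  they carry unital representations of unital C*-algebras in which \<open>1 \<noteq> 0\<close>.
\<close>

class chilbert_space = complex_vector + real_inner + complete_space +
  fixes cinner :: "'a \<Rightarrow> 'a \<Rightarrow> complex"
  assumes cinner_add_left: "cinner (x + y) z = cinner x z + cinner y z"
    and cinner_scaleC_left: "cinner (c *\<^sub>C x) y = c * cinner x y"
    and cinner_commute: "cinner x y = cnj (cinner y x)"
    and inner_eq_Re_cinner: "inner x y = Re (cinner x y)"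
    and ex_nonzero: "\<exists>x. x \<noteq> 0"

class cstar_algebra = complex_vector + real_normed_algebra_1 + complete_space +
  fixes star :: "'a \<Rightarrow> 'a"
  assumes mult_scaleC_left: "(c *\<^sub>C x) * y = c *\<^sub>C (x * y)"
    and mult_scaleC_right: "x * (c *\<^sub>C y) = c *\<^sub>C (x * y)"
    and norm_scaleC: "norm (c *\<^sub>C x) = cmod c * norm x"
    and star_add: "star (x + y) = star x + star y"
    and star_scaleC: "star (c *\<^sub>C x) = cnj c *\<^sub>C star x"
    and star_mult: "star (x * y) = star y * star x"
    and star_star: "star (star x) = x"
    and norm_star_mult: "norm (star x * x) = (norm x)\<^sup>2"

instance chilbert_space \<subseteq> banach ..

instance cstar_algebra \<subseteq> banach ..

lemma scaleC_zero_right [simp]: "c *\<^sub>C (0::'a::complex_vector) = 0"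
  using scaleC_add_right[of c "0::'a" 0] by simp

lemma scaleC_zero_left [simp]: "0 *\<^sub>C (x::'a::complex_vector) = 0"
  using scaleC_add_left[of 0 0 x] by simp

lemma scaleC_one [simp]: "1 *\<^sub>C (x::'a::complex_vector) = x"
  using scaleR_scaleC[of 1 x] by simp

lemma scaleC_minus_right: "c *\<^sub>C (- x) = - (c *\<^sub>C (x::'a::complex_vector))"
  using scaleC_add_right[of c x "- x"] by (simp add: eq_neg_iff_add_eq_0 add.commute)

lemma scaleC_diff_right: "c *\<^sub>C (x - y) = c *\<^sub>C x - c *\<^sub>C (y::'a::complex_vector)"
  using scaleC_add_right[of c x "- y"] by (simp add: scaleC_minus_right)

lemma scaleC_scaleR_commute: "c *\<^sub>C (r *\<^sub>R x) = r *\<^sub>R (c *\<^sub>C (x::'a::complex_vector))"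
  by (simp add: scaleR_scaleC scaleC_scaleC mult.commute)

lemma cinner_add_right: "cinner x (y + z) = cinner x y + cinner x (z::'a::chilbert_space)"
  using cinner_commute[of x "y + z"] cinner_commute[of x y] cinner_commute[of x z]
  by (simp add: cinner_add_left)

lemma cinner_scaleC_right: "cinner x (c *\<^sub>C y) = cnj c * cinner x (y::'a::chilbert_space)"
  using cinner_commute[of x "c *\<^sub>C y"] cinner_commute[of x y]
  by (simp add: cinner_scaleC_left)

lemma cinner_self: "cinner x x = complex_of_real ((norm (x::'a::chilbert_space))\<^sup>2)"
proof (rule complex_eqI)
  show "Re (cinner x x) = Re (complex_of_real ((norm x)\<^sup>2))"
    by (simp add: inner_eq_Re_cinner[symmetric] power2_norm_eq_inner)
  have "Im (cinner x x) = Im (cnj (cinner x x))"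
    using cinner_commute[of x x] by simp
  then show "Im (cinner x x) = Im (complex_of_real ((norm x)\<^sup>2))"
    by simp
qed

lemma Im_cinner: "Im (cinner x y) = inner x (\<i> *\<^sub>C (y::'a::chilbert_space))"
  by (simp add: inner_eq_Re_cinner cinner_scaleC_right)

lemma cinner_eq_inner: "cinner x y = Complex (inner x y) (inner x (\<i> *\<^sub>C (y::'a::chilbert_space)))"
  by (simp add: complex_eq_iff Im_cinner inner_eq_Re_cinner)

lemma norm_scaleC_hilbert: "norm (c *\<^sub>C (x::'a::chilbert_space)) = cmod c * norm x"
proof -
  have "complex_of_real ((norm (c *\<^sub>C x))\<^sup>2) = complex_of_real ((cmod c * norm x)\<^sup>2)"
    by (simp add: cinner_self[symmetric] cinner_scaleC_left cinner_scaleC_right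
        power_mult_distrib complex_norm_square del: of_real_power)
  then have "(norm (c *\<^sub>C x))\<^sup>2 = (cmod c * norm x)\<^sup>2"
    using of_real_eq_iff by blast
  then show ?thesis
    by (simp add: power2_eq_iff_nonneg)
qed

lemma bounded_linear_scaleC_hilbert: "bounded_linear (\<lambda>x::'a::chilbert_space. c *\<^sub>C x)"
  by (rule bounded_linear_intro[where K="cmod c"])
    (simp_all add: scaleC_add_right scaleC_scaleR_commute norm_scaleC_hilbert mult.commute)

lemma riesz_representation:
  fixes f :: "'a::{real_inner,complete_space} \<Rightarrow> real"
  assumes f: "bounded_linear f"
  obtains y where "\<And>x. f x = inner x y"
proof -
  interpret f: bounded_linear f by fact
  obtain K where K: "\<And>x. norm (f x) \<le> norm x * K"
    using f.bounded by blast
  define J where "J x = inner x x - 2 * f x" for x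
  have low: "- K\<^sup>2 \<le> J x" for x
  proof -
    have "f x \<le> norm x * K" using K[of x] by simp
    moreover have "0 \<le> (norm x - K)\<^sup>2" by simp
    ultimately show ?thesis
      unfolding J_def power2_norm_eq_inner[symmetric] by (simp add: power2_diff)
  qed
  have bdd: "bdd_below (range J)" using low by (auto simp: bdd_below_def)
  define m where "m = Inf (range J)"
  have m: "m \<le> J x" for x unfolding m_def using bdd by (simp add: cINF_lower)
  have "\<exists>x. J x < m + 1 / real (Suc n)" for n
  proof -
    have "Inf (range J) < m + 1 / real (Suc n)" by (simp add: m_def)
    then show ?thesis using cInf_lessD[of "range J"] by auto
  qed
  then obtain X where X: "\<And>n. J (X n) < m + 1 / real (Suc n)" by metis
  have par: "inner (x - y) (x - y) = 2 * (J x + J y - 2 * J ((1/2) *\<^sub>R (x + y)))" for x y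
    unfolding J_def by (simp add: f.add f.scaleR inner_add_left inner_add_right inner_diff_left
        inner_diff_right inner_commute[of y x] algebra_simps)
  have dist2: "(dist (X i) (X j))\<^sup>2 \<le> 4 / real (Suc N)" if "N \<le> i" "N \<le> j" for i j N
  proof -
    have a: "1 / real (Suc i) \<le> 1 / real (Suc N)" "1 / real (Suc j) \<le> 1 / real (Suc N)"
      using that by (auto simp: frac_le)
    have "(dist (X i) (X j))\<^sup>2 = 2 * (J (X i) + J (X j) - 2 * J ((1/2) *\<^sub>R (X i + X j)))"
      by (simp add: dist_norm power2_norm_eq_inner par)
    also have "\<dots> \<le> 4 * (1 / real (Suc N))"
      using X[of i] X[of j] m[of "(1/2) *\<^sub>R (X i + X j)"] a by argo
    finally show ?thesis by simp
  qed
  have "Cauchy X"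
  proof (rule metric_CauchyI)
    fix e :: real assume e: "0 < e"
    obtain N where N: "4 / e\<^sup>2 < real N" using reals_Archimedean2 by blast
    have "4 < e\<^sup>2 * real (Suc N)" using N e by (simp add: field_simps add_strict_increasing)
    then have lt: "4 / real (Suc N) < e\<^sup>2" by (simp add: field_simps)
    have "dist (X i) (X j) < e" if "N \<le> i" "N \<le> j" for i j
      using dist2[OF that] lt e power2_less_imp_less[of "dist (X i) (X j)" e] by linarith
    then show "\<exists>M. \<forall>m\<ge>M. \<forall>n\<ge>M. dist (X m) (X n) < e" by blast
  qed
  then have "convergent X" by (rule Cauchy_convergent)
  then obtain y where y: "X \<longlonglongrightarrow> y"
    by (auto simp: convergent_def)
  have "(\<lambda>n. J (X n)) \<longlonglongrightarrow> J y"
    unfolding J_def by (intro tendsto_intros y f.tendsto)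
  moreover have "(\<lambda>n. m + 1 / real (Suc n)) \<longlonglongrightarrow> m + 0"
    by (intro tendsto_intros LIMSEQ_inverse_real_of_nat[unfolded inverse_eq_divide])
  ultimately have "J y \<le> m + 0"
    using X by (intro LIMSEQ_le[of "\<lambda>n. J (X n)"]) (auto intro: less_imp_le)
  then have Jy: "J y \<le> m" by simp
  have "f x = inner x y" for x
  proof (rule ccontr)
    assume "f x \<noteq> inner x y"
    define a where "a = inner x y - f x"
    define q where "q = inner x x"
    have q: "0 \<le> q" by (simp add: q_def)
    have a: "a \<noteq> 0" using \<open>f x \<noteq> inner x y\<close> by (simp add: a_def)
    define t where "t = - a / (q + 1)"
    have t: "t \<noteq> 0" and at: "a = - (t * (q + 1))" using a q by (simp_all add: t_def)
    have "J (y + t *\<^sub>R x) = J y + 2 * t * a + t\<^sup>2 * q"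
      unfolding J_def a_def q_def
      by (simp add: f.add f.scaleR inner_add_left inner_add_right inner_commute[of y x]
          algebra_simps power2_eq_square)
    then have "0 \<le> 2 * t * a + t\<^sup>2 * q" using m[of "y + t *\<^sub>R x"] Jy by linarith
    also have "2 * t * a + t\<^sup>2 * q = - (t\<^sup>2 * (q + 2))"
      unfolding at by (simp add: algebra_simps power2_eq_square)
    also have "\<dots> < 0" using t q by (simp add: zero_less_mult_iff)
    finally show False by simp
  qed
  then show ?thesis using that by blast
qed

instantiation prod :: (complex_vector, complex_vector) complex_vector
begin

definition scaleC_prod_def: "c *\<^sub>C z = (c *\<^sub>C fst z, c *\<^sub>C snd z)"

instance
  by standard (simp_all add: scaleC_prod_def scaleC_add_right scaleC_add_left scaleC_scaleC
      scaleR_scaleC prod_eq_iff)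

end

instantiation prod :: (chilbert_space, chilbert_space) chilbert_space
begin

definition cinner_prod_def: "cinner z w = cinner (fst z) (fst w) + cinner (snd z) (snd w)"

instance
proof
  fix x y z :: "'a \<times> 'b" and c :: complex
  show "cinner (x + y) z = cinner x z + cinner y z"
    by (simp add: cinner_prod_def cinner_add_left)
  show "cinner (c *\<^sub>C x) y = c * cinner x y"
    by (simp add: cinner_prod_def scaleC_prod_def cinner_scaleC_left distrib_left)
  show "cinner x y = cnj (cinner y x)"
    unfolding cinner_prod_def
    using cinner_commute[of "fst x" "fst y"] cinner_commute[of "snd x" "snd y"] by simp
  show "inner x y = Re (cinner x y)"
    by (simp add: cinner_prod_def inner_prod_def inner_eq_Re_cinner)
  obtain u :: 'a where "u \<noteq> 0" using ex_nonzero by blast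
  then have "(u, 0) \<noteq> (0 :: 'a \<times> 'b)" by (simp add: zero_prod_def)
  then show "\<exists>x::'a \<times> 'b. x \<noteq> 0" by blast
qed

end


section \<open>The C*-algebra of bounded operators on a Hilbert space\<close>

typedef (overloaded) 'h bop = "{T :: 'h::chilbert_space \<Rightarrow>\<^sub>L 'h. \<forall>c x. T (c *\<^sub>C x) = c *\<^sub>C T x}"
  by (rule exI[where x=0]) simp

setup_lifting type_definition_bop

lift_definition bop_app :: "'h::chilbert_space bop \<Rightarrow> 'h \<Rightarrow> 'h" (infixr "\<bullet>\<^sub>o" 75)
  is blinfun_apply .

lemma bop_eqI: "(\<And>x. S \<bullet>\<^sub>o x = T \<bullet>\<^sub>o x) \<Longrightarrow> S = T"
  by transfer (auto intro: blinfun_eqI)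

definition Bop :: "('h::chilbert_space \<Rightarrow> 'h) \<Rightarrow> 'h bop"
  where "Bop f = Abs_bop (Blinfun f)"

lemma Bop_app:
  assumes "bounded_linear f" "\<And>c x. f (c *\<^sub>C x) = c *\<^sub>C f x"
  shows "Bop f \<bullet>\<^sub>o x = f x"
  using assms by (simp add: Bop_def bop_app.rep_eq Abs_bop_inverse bounded_linear_Blinfun_apply)

instantiation bop :: (chilbert_space) real_vector
begin

lift_definition zero_bop :: "'a bop" is 0 by simp
lift_definition plus_bop :: "'a bop \<Rightarrow> 'a bop \<Rightarrow> 'a bop" is "(+)"
  by (simp add: blinfun.add_left scaleC_add_right)
lift_definition minus_bop :: "'a bop \<Rightarrow> 'a bop \<Rightarrow> 'a bop" is "(-)"
  by (simp add: blinfun.diff_left scaleC_diff_right)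
lift_definition uminus_bop :: "'a bop \<Rightarrow> 'a bop" is uminus
  by (simp add: blinfun.minus_left scaleC_minus_right)
lift_definition scaleR_bop :: "real \<Rightarrow> 'a bop \<Rightarrow> 'a bop" is "(*\<^sub>R)"
  by (simp add: blinfun.scaleR_left scaleC_scaleR_commute)
instance
proof
  fix S T U :: "'a bop" and r s :: real
  show "S + T + U = S + (T + U)" by transfer simp
  show "S + T = T + S" by transfer simp
  show "0 + S = S" by transfer simp
  show "- S + S = 0" by transfer simp
  show "S - T = S + - T" by transfer simp
  show "r *\<^sub>R (S + T) = r *\<^sub>R S + r *\<^sub>R T" by transfer (simp add: scaleR_add_right)
  show "(r + s) *\<^sub>R S = r *\<^sub>R S + s *\<^sub>R S" by transfer (simp add: scaleR_add_left)
  show "r *\<^sub>R s *\<^sub>R S = (r * s) *\<^sub>R S" by transfer simp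
  show "1 *\<^sub>R S = S" by transfer simp
qed

end

instantiation bop :: (chilbert_space) real_normed_algebra_1
begin

lift_definition one_bop :: "'a bop" is id_blinfun by simp
lift_definition times_bop :: "'a bop \<Rightarrow> 'a bop \<Rightarrow> 'a bop" is "(o\<^sub>L)"
  by simp
lift_definition norm_bop :: "'a bop \<Rightarrow> real" is norm .
lift_definition dist_bop :: "'a bop \<Rightarrow> 'a bop \<Rightarrow> real" is dist .
lift_definition sgn_bop :: "'a bop \<Rightarrow> 'a bop" is sgn
  by (simp add: sgn_div_norm blinfun.scaleR_left scaleC_scaleR_commute)

definition uniformity_bop :: "('a bop \<times> 'a bop) filter"
  where "uniformity_bop = (INF e\<in>{0<..}. principal {(x, y). dist x y < e})"

definition open_bop :: "'a bop set \<Rightarrow> bool"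
  where "open_bop S = (\<forall>x\<in>S. \<forall>\<^sub>F (x', y) in uniformity. x' = x \<longrightarrow> y \<in> S)"

instance
proof
  fix S T U :: "'a bop" and r s :: real
  show "S * T * U = S * (T * U)" by transfer (auto intro: blinfun_eqI)
  show "(S + T) * U = S * U + T * U"
    by transfer (auto intro: blinfun_eqI simp: blinfun.add_left)
  show "S * (T + U) = S * T + S * U"
    by transfer (auto intro: blinfun_eqI simp: blinfun.add_left blinfun.add_right)
  show "r *\<^sub>R S * T = r *\<^sub>R (S * T)"
    by transfer (auto intro: blinfun_eqI simp: blinfun.scaleR_left)
  show "S * r *\<^sub>R T = r *\<^sub>R (S * T)"
    by transfer (auto intro: blinfun_eqI simp: blinfun.scaleR_left blinfun.scaleR_right)
  show "1 * S = S" by transfer (auto intro: blinfun_eqI)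
  show "S * 1 = S" by transfer (auto intro: blinfun_eqI)
  show "(0 :: 'a bop) \<noteq> 1"
  proof
    assume *: "(0 :: 'a bop) = 1"
    obtain u :: 'a where "u \<noteq> 0" using ex_nonzero by blast
    moreover have "(0 :: 'a bop) \<bullet>\<^sub>o u = 0" by transfer simp
    moreover have "(1 :: 'a bop) \<bullet>\<^sub>o u = u" by transfer simp
    ultimately show False using * by metis
  qed
  show "dist S T = norm (S - T)" by transfer (simp add: dist_norm)
  show "sgn S = S /\<^sub>R norm S" by transfer (simp add: sgn_div_norm)
  show "(uniformity :: ('a bop \<times> 'a bop) filter) = (INF e\<in>{0<..}. principal {(x, y). dist x y < e})"
    by (rule uniformity_bop_def)
  show "open A = (\<forall>x\<in>A. \<forall>\<^sub>F (x', y) in uniformity. x' = x \<longrightarrow> y \<in> A)" for A :: "'a bop set"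
    by (rule open_bop_def)
  show "(norm S = 0) = (S = 0)" by transfer simp
  show "norm (S + T) \<le> norm S + norm T" by transfer (rule norm_triangle_ineq)
  show "norm (r *\<^sub>R S) = \<bar>r\<bar> * norm S" by transfer simp
  show "norm (S * T) \<le> norm S * norm T" by transfer (rule norm_blinfun_compose)
  show "norm (1 :: 'a bop) = 1"
  proof transfer
    obtain u :: 'a where u: "u \<noteq> 0" using ex_nonzero by blast
    have "norm (id_blinfun u) \<le> norm (id_blinfun :: 'a \<Rightarrow>\<^sub>L 'a) * norm u" by (rule norm_blinfun)
    then have "1 \<le> norm (id_blinfun :: 'a \<Rightarrow>\<^sub>L 'a)" using u by simp
    then show "norm (id_blinfun :: 'a \<Rightarrow>\<^sub>L 'a) = 1"
      using norm_blinfun_id_le[where 'a='a] by simp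
  qed
qed

end

lemma bop_app_simps [simp]:
  "0 \<bullet>\<^sub>o x = 0" "1 \<bullet>\<^sub>o x = x" "(S + T) \<bullet>\<^sub>o x = S \<bullet>\<^sub>o x + T \<bullet>\<^sub>o x"
  "(S - T) \<bullet>\<^sub>o x = S \<bullet>\<^sub>o x - T \<bullet>\<^sub>o x" "(- S) \<bullet>\<^sub>o x = - (S \<bullet>\<^sub>o x)"
  "(S * T) \<bullet>\<^sub>o x = S \<bullet>\<^sub>o (T \<bullet>\<^sub>o x)"
  by (transfer, simp add: blinfun.bilinear_simps)+

lemma bounded_linear_bop_app: "bounded_linear (\<lambda>x. T \<bullet>\<^sub>o x)"
  by transfer (rule blinfun.bounded_linear_right)

lemma bop_app_scaleC: "T \<bullet>\<^sub>o (c *\<^sub>C x) = c *\<^sub>C (T \<bullet>\<^sub>o x)"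
  by transfer simp

lemma norm_bop_app: "norm (T \<bullet>\<^sub>o x) \<le> norm T * norm x"
  by transfer (rule norm_blinfun)

lemma norm_bop_bound:
  assumes "0 \<le> b" "\<And>x. norm (T \<bullet>\<^sub>o x) \<le> b * norm x"
  shows "norm T \<le> b"
  using assms by transfer (rule norm_blinfun_bound)

instance bop :: (chilbert_space) complete_space
proof
  fix X :: "nat \<Rightarrow> 'a bop"
  assume X: "Cauchy X"
  have "Cauchy (\<lambda>n. Rep_bop (X n))"
    using X unfolding Cauchy_def dist_bop.rep_eq .
  then have "convergent (\<lambda>n. Rep_bop (X n))" by (rule Cauchy_convergent)
  then obtain L where L: "(\<lambda>n. Rep_bop (X n)) \<longlonglongrightarrow> L"
    by (auto simp: convergent_def)
  have "blinfun_apply L (c *\<^sub>C x) = c *\<^sub>C blinfun_apply L x" for c x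
  proof (rule LIMSEQ_unique)
    show "(\<lambda>n. blinfun_apply (Rep_bop (X n)) (c *\<^sub>C x)) \<longlonglongrightarrow> blinfun_apply L (c *\<^sub>C x)"
      by (intro tendsto_intros L)
    have "(\<lambda>n. blinfun_apply (Rep_bop (X n)) x) \<longlonglongrightarrow> blinfun_apply L x"
      by (intro tendsto_intros L)
    then have "(\<lambda>n. c *\<^sub>C blinfun_apply (Rep_bop (X n)) x) \<longlonglongrightarrow> c *\<^sub>C blinfun_apply L x"
      by (rule bounded_linear.tendsto[OF bounded_linear_scaleC_hilbert])
    moreover have "blinfun_apply (Rep_bop (X n)) (c *\<^sub>C x) = c *\<^sub>C blinfun_apply (Rep_bop (X n)) x" for n
      using Rep_bop[of "X n"] by simp
    ultimately show "(\<lambda>n. blinfun_apply (Rep_bop (X n)) (c *\<^sub>C x)) \<longlonglongrightarrow> c *\<^sub>C blinfun_apply L x"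
      by simp
  qed
  then have "Rep_bop (Abs_bop L) = L" by (simp add: Abs_bop_inverse)
  then have "X \<longlonglongrightarrow> Abs_bop L"
    using L unfolding tendsto_iff dist_bop.rep_eq by simp
  then show "convergent X" by (auto simp: convergent_def)
qed

lemma ex_adjoint: "\<exists>S. \<forall>x y. cinner (T \<bullet>\<^sub>o x) y = cinner x (S \<bullet>\<^sub>o y)"
  for T :: "'h::chilbert_space bop"
proof -
  have "\<exists>z. \<forall>x. inner (T \<bullet>\<^sub>o x) y = inner x z" for y
  proof -
    have "bounded_linear (\<lambda>x. inner (T \<bullet>\<^sub>o x) y)"
      using bounded_linear_compose[OF bounded_linear_inner_left bounded_linear_bop_app] .
    then obtain z where "\<And>x. inner (T \<bullet>\<^sub>o x) y = inner x z"
      by (rule riesz_representation) blast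
    then show ?thesis by blast
  qed
  then have "\<exists>f. \<forall>y x. inner (T \<bullet>\<^sub>o x) y = inner x (f y)" by (intro choice allI) blast
  then obtain f where f: "\<And>x y. inner (T \<bullet>\<^sub>o x) y = inner x (f y)" by blast
  have eqI: "u = v" if "\<And>x. inner x u = inner x v" for u v :: 'h
    using that vector_eq_ldot[of u v] by simp
  have sc: "inner x (c *\<^sub>C y) = inner (cnj c *\<^sub>C x) y" for x y :: 'h and c
    by (simp add: inner_eq_Re_cinner cinner_scaleC_left cinner_scaleC_right)
  have fC: "f (c *\<^sub>C y) = c *\<^sub>C f y" for c y
    by (rule eqI) (simp add: f[symmetric] sc bop_app_scaleC)
  have bl: "bounded_linear f"
  proof (rule bounded_linear_intro[where K="norm T"])
    show "f (x + y) = f x + f y" for x y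
      by (rule eqI) (simp add: f[symmetric] inner_add_right)
    show "f (r *\<^sub>R x) = r *\<^sub>R f x" for r x
      by (simp add: scaleR_scaleC fC)
    show "norm (f x) \<le> norm x * norm T" for x
    proof (cases "f x = 0")
      case False
      have "norm (f x) * norm (f x) = inner (T \<bullet>\<^sub>o f x) x"
        by (simp add: f power2_norm_eq_inner[symmetric] power2_eq_square)
      also have "\<dots> \<le> norm (T \<bullet>\<^sub>o f x) * norm x"
        using Cauchy_Schwarz_ineq2[of "T \<bullet>\<^sub>o f x" x] by linarith
      also have "\<dots> \<le> norm T * norm (f x) * norm x"
        by (intro mult_right_mono norm_bop_app) simp
      finally have "norm (f x) * norm (f x) \<le> norm (f x) * (norm x * norm T)"
        by (simp add: ac_simps)
      then show ?thesis using False by simp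
    qed simp
  qed
  show ?thesis
  proof (intro exI[of _ "Bop f"] allI)
    fix x y
    show "cinner (T \<bullet>\<^sub>o x) y = cinner x (Bop f \<bullet>\<^sub>o y)"
      by (simp only: Bop_app[OF bl fC] cinner_eq_inner[of "T \<bullet>\<^sub>o x"] cinner_eq_inner[of x] f fC)
  qed
qed

instantiation bop :: (chilbert_space) cstar_algebra
begin

definition scaleC_bop :: "complex \<Rightarrow> 'a bop \<Rightarrow> 'a bop"
  where "scaleC_bop c T = Bop (\<lambda>x. c *\<^sub>C (T \<bullet>\<^sub>o x))"

definition star_bop :: "'a bop \<Rightarrow> 'a bop"
  where "star_bop T = (THE S. \<forall>x y. cinner (T \<bullet>\<^sub>o x) y = cinner x (S \<bullet>\<^sub>o y))"

lemma bop_app_scaleC_left: "(c *\<^sub>C T) \<bullet>\<^sub>o x = c *\<^sub>C (T \<bullet>\<^sub>o (x::'a))"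
  unfolding scaleC_bop_def
  by (rule Bop_app[OF bounded_linear_compose[OF bounded_linear_scaleC_hilbert bounded_linear_bop_app]])
    (simp add: bop_app_scaleC scaleC_scaleC mult.commute)

lemma cinner_right_eqI: "(\<And>x. cinner x u = cinner x v) \<Longrightarrow> u = (v::'a)"
  using vector_eq_ldot[of u v] by (simp add: inner_eq_Re_cinner)

lemma star_bop_unique:
  assumes "\<And>x y. cinner (T \<bullet>\<^sub>o x) y = cinner x (S \<bullet>\<^sub>o (y::'a))"
  shows "star T = S"
  unfolding star_bop_def
proof (rule the_equality)
  fix S' assume "\<forall>x y. cinner (T \<bullet>\<^sub>o x) y = cinner x (S' \<bullet>\<^sub>o y)"
  then have "cinner x (S' \<bullet>\<^sub>o y) = cinner x (S \<bullet>\<^sub>o y)" for x y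
    using assms[of x y] by simp
  then show "S' = S" by (intro bop_eqI cinner_right_eqI)
qed (use assms in blast)

lemma cinner_star_right: "cinner x (star T \<bullet>\<^sub>o y) = cinner (T \<bullet>\<^sub>o x) (y::'a)"
proof -
  obtain S where "\<And>x y. cinner (T \<bullet>\<^sub>o x) y = cinner x (S \<bullet>\<^sub>o y)"
    using ex_adjoint[of T] by blast
  then show ?thesis using star_bop_unique[of T S] by simp
qed

lemma cinner_star_left: "cinner (star T \<bullet>\<^sub>o x) y = cinner x (T \<bullet>\<^sub>o (y::'a))"
  using cinner_star_right[of y T x] cinner_commute[of "star T \<bullet>\<^sub>o x" y]
    cinner_commute[of x "T \<bullet>\<^sub>o y"] by simp

instance
proof
  fix S T :: "'a bop" and b c :: complex and r :: real
  show "c *\<^sub>C (S + T) = c *\<^sub>C S + c *\<^sub>C T"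
    by (rule bop_eqI) (simp add: bop_app_scaleC_left scaleC_add_right)
  show "(b + c) *\<^sub>C S = b *\<^sub>C S + c *\<^sub>C S"
    by (rule bop_eqI) (simp add: bop_app_scaleC_left scaleC_add_left)
  show "b *\<^sub>C c *\<^sub>C S = (b * c) *\<^sub>C S"
    by (rule bop_eqI) (simp add: bop_app_scaleC_left scaleC_scaleC)
  have "(r *\<^sub>R S) \<bullet>\<^sub>o x = r *\<^sub>R (S \<bullet>\<^sub>o x)" for x
    by transfer (simp add: blinfun.scaleR_left)
  then show "r *\<^sub>R S = complex_of_real r *\<^sub>C S"
    by (intro bop_eqI) (simp add: bop_app_scaleC_left scaleR_scaleC)
  show "c *\<^sub>C S * T = c *\<^sub>C (S * T)"
    by (rule bop_eqI) (simp add: bop_app_scaleC_left)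
  show "S * c *\<^sub>C T = c *\<^sub>C (S * T)"
    by (rule bop_eqI) (simp add: bop_app_scaleC_left bop_app_scaleC)
  have le: "norm (c *\<^sub>C S) \<le> cmod c * norm S" for c and S :: "'a bop"
    by (rule norm_bop_bound)
      (simp_all add: bop_app_scaleC_left norm_scaleC_hilbert mult.assoc mult_left_mono norm_bop_app)
  show "norm (c *\<^sub>C S) = cmod c * norm S"
  proof (cases "c = 0")
    case True
    then show ?thesis using le[of c S] by simp
  next
    case False
    have "inverse c *\<^sub>C c *\<^sub>C S = S"
      using False by (intro bop_eqI) (simp add: bop_app_scaleC_left scaleC_scaleC)
    then have "norm S \<le> inverse (cmod c) * norm (c *\<^sub>C S)"
      using le[of "inverse c" "c *\<^sub>C S"] by (simp add: norm_inverse)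
    then have "cmod c * norm S \<le> norm (c *\<^sub>C S)"
      using False by (simp add: field_simps)
    then show ?thesis using le[of c S] by linarith
  qed
  show "star (S + T) = star S + star T"
    by (rule star_bop_unique) (simp add: cinner_add_left cinner_add_right cinner_star_right)
  show "star (c *\<^sub>C S) = cnj c *\<^sub>C star S"
    by (rule star_bop_unique)
      (simp add: bop_app_scaleC_left cinner_scaleC_left cinner_scaleC_right cinner_star_right)
  show "star (S * T) = star T * star S"
    by (rule star_bop_unique) (simp add: cinner_star_right)
  show ss: "star (star S) = S" for S :: "'a bop"
    by (rule star_bop_unique) (simp add: cinner_star_left)
  have sq: "(norm S)\<^sup>2 \<le> norm (star S * S)" for S :: "'a bop"
  proof -
    have "norm (S \<bullet>\<^sub>o x) \<le> sqrt (norm (star S * S)) * norm x" for x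
    proof -
      have "(norm (S \<bullet>\<^sub>o x))\<^sup>2 = inner ((star S * S) \<bullet>\<^sub>o x) x"
        by (simp add: power2_norm_eq_inner inner_eq_Re_cinner cinner_star_left)
      also have "\<dots> \<le> norm ((star S * S) \<bullet>\<^sub>o x) * norm x"
        using Cauchy_Schwarz_ineq2[of "(star S * S) \<bullet>\<^sub>o x" x] by linarith
      also have "\<dots> \<le> norm (star S * S) * norm x * norm x"
        by (intro mult_right_mono norm_bop_app) simp
      also have "\<dots> = (sqrt (norm (star S * S)) * norm x)\<^sup>2"
        by (simp add: power_mult_distrib power2_eq_square)
      finally show ?thesis by (simp add: power2_le_iff_abs_le)
    qed
    then have "norm S \<le> sqrt (norm (star S * S))" by (intro norm_bop_bound) simp_all
    then show ?thesis by (metis norm_ge_zero power_mono real_sqrt_pow2)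
  qed
  have le_star: "norm S \<le> norm (star S)" for S :: "'a bop"
  proof (cases "S = 0")
    case False
    have "norm S * norm S \<le> norm (star S) * norm S"
      using sq[of S] norm_mult_ineq[of "star S" S] by (simp add: power2_eq_square)
    then show ?thesis using False by simp
  qed simp
  have "norm (star S) = norm S" using le_star[of S] le_star[of "star S"] ss by simp
  then have "norm (star S * S) \<le> (norm S)\<^sup>2"
    using norm_mult_ineq[of "star S" S] by (simp add: power2_eq_square)
  then show "norm (star S * S) = (norm S)\<^sup>2" using sq[of S] by simp
qed

end


section \<open>The Hilbert space of square-summable sequences over the integers\<close>

text \<open>
  \<open>'h l2Z\<close> is \<open>l\<^sup>2(\<int>, H)\<close>, identified with \<open>H \<otimes> l\<^sup>2(\<int>)\<close> in such a way that
  \<open>\<xi> \<otimes> \<delta>\<^sub>n\<close> is the sequence supported at \<open>n\<close> with value \<open>\<xi>\<close>.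
\<close>

typedef (overloaded) 'h l2Z = "{f :: int \<Rightarrow> 'h::chilbert_space. (\<lambda>n. (norm (f n))\<^sup>2) summable_on UNIV}"
  morphisms coord l2Z
  by (rule exI[where x="\<lambda>_. 0"]) simp

setup_lifting type_definition_l2Z

lemma l2Z_eqI: "(\<And>n. coord u n = coord v n) \<Longrightarrow> u = v"
  by (metis coord_inverse ext)

lemma summable_coord: "(\<lambda>n. (norm (coord u n))\<^sup>2) summable_on UNIV"
  using coord[of u] by simp

lemma square_summable_add:
  fixes f g :: "int \<Rightarrow> 'h::real_normed_vector"
  assumes "(\<lambda>n. (norm (f n))\<^sup>2) summable_on UNIV" "(\<lambda>n. (norm (g n))\<^sup>2) summable_on UNIV"
  shows "(\<lambda>n. (norm (f n + g n))\<^sup>2) summable_on UNIV"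
proof (rule summable_on_comparison_test)
  show "(\<lambda>n. 2 * (norm (f n))\<^sup>2 + 2 * (norm (g n))\<^sup>2) summable_on UNIV"
    by (intro summable_on_add summable_on_cmult_right assms)
  show "(norm (f n + g n))\<^sup>2 \<le> 2 * (norm (f n))\<^sup>2 + 2 * (norm (g n))\<^sup>2" for n
  proof -
    have "(norm (f n + g n))\<^sup>2 \<le> (norm (f n) + norm (g n))\<^sup>2"
      by (intro power_mono norm_triangle_ineq) simp
    also have "\<dots> \<le> 2 * (norm (f n))\<^sup>2 + 2 * (norm (g n))\<^sup>2"
      using zero_le_power2[of "norm (f n) - norm (g n)"] by (simp add: power2_sum power2_diff)
    finally show ?thesis .
  qed
qed simp

lemma square_summable_scaleC:
  fixes f :: "int \<Rightarrow> 'h::chilbert_space"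
  assumes "(\<lambda>n. (norm (f n))\<^sup>2) summable_on UNIV"
  shows "(\<lambda>n. (norm (c *\<^sub>C f n))\<^sup>2) summable_on UNIV"
  unfolding norm_scaleC_hilbert power_mult_distrib by (intro summable_on_cmult_right assms)

lemma square_summable_diff:
  fixes f g :: "int \<Rightarrow> 'h::real_normed_vector"
  assumes "(\<lambda>n. (norm (f n))\<^sup>2) summable_on UNIV" "(\<lambda>n. (norm (g n))\<^sup>2) summable_on UNIV"
  shows "(\<lambda>n. (norm (f n - g n))\<^sup>2) summable_on UNIV"
  using square_summable_add[of f "\<lambda>n. - g n"] assms by simp

lemma abs_summable_inner:
  fixes f g :: "int \<Rightarrow> 'h::real_inner"
  assumes "(\<lambda>n. (norm (f n))\<^sup>2) summable_on UNIV" "(\<lambda>n. (norm (g n))\<^sup>2) summable_on UNIV"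
  shows "(\<lambda>n. norm (f n) * norm (g n)) summable_on UNIV"
proof (rule summable_on_comparison_test)
  show "(\<lambda>n. (norm (f n))\<^sup>2 + (norm (g n))\<^sup>2) summable_on UNIV"
    by (intro summable_on_add assms)
  show "norm (f n) * norm (g n) \<le> (norm (f n))\<^sup>2 + (norm (g n))\<^sup>2" for n
  proof -
    have "2 * (norm (f n) * norm (g n)) \<le> (norm (f n))\<^sup>2 + (norm (g n))\<^sup>2"
      using sum_squares_bound[of "norm (f n)" "norm (g n)"] by (simp add: mult.assoc)
    moreover have "0 \<le> norm (f n) * norm (g n)" by simp
    ultimately show ?thesis by linarith
  qed
qed simp

lemma cinner_Cauchy_Schwarz: "cmod (cinner x y) \<le> 2 * (norm x * norm (y::'h::chilbert_space))"
proof -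
  have "\<bar>inner x y\<bar> \<le> norm x * norm y" "\<bar>inner x (\<i> *\<^sub>C y)\<bar> \<le> norm x * norm y"
    using Cauchy_Schwarz_ineq2[of x y] Cauchy_Schwarz_ineq2[of x "\<i> *\<^sub>C y"]
    by (simp_all add: norm_scaleC_hilbert)
  then show ?thesis
    using cmod_le[of "cinner x y"] by (simp add: Im_cinner inner_eq_Re_cinner[symmetric])
qed

lemma summable_coord_bilinear:
  fixes F :: "'h::chilbert_space \<Rightarrow> 'h \<Rightarrow> 'b::banach"
  assumes "\<And>x y. norm (F x y) \<le> 2 * (norm x * norm y)"
  shows "(\<lambda>n. F (coord u n) (coord v n)) summable_on UNIV"
proof (rule abs_summable_summable)
  have s: "(\<lambda>n. 2 * (norm (coord u n) * norm (coord v n))) summable_on UNIV"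
    by (rule summable_on_cmult_right[OF abs_summable_inner[OF summable_coord summable_coord]])
  show "(\<lambda>n. norm (F (coord u n) (coord v n))) summable_on UNIV"
    by (rule summable_on_comparison_test[OF s]) (simp_all add: assms)
qed

lemma summable_inner_coord: "(\<lambda>n. inner (coord u n) (coord v n)) summable_on UNIV"
proof (rule summable_coord_bilinear[where F=inner])
  show "norm (inner x y) \<le> 2 * (norm x * norm y)" for x y :: 'a
    using Cauchy_Schwarz_ineq2[of x y] mult_nonneg_nonneg[of "norm x" "norm y"] by simp
qed

lemma summable_cinner_coord: "(\<lambda>n. cinner (coord u n) (coord v n)) summable_on UNIV"
  by (rule summable_coord_bilinear[where F=cinner]) (rule cinner_Cauchy_Schwarz)

instantiation l2Z :: (chilbert_space) complex_vector
begin

lift_definition zero_l2Z :: "'a l2Z" is "\<lambda>_. 0" by simp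
lift_definition plus_l2Z :: "'a l2Z \<Rightarrow> 'a l2Z \<Rightarrow> 'a l2Z" is "\<lambda>f g n. f n + g n"
  by (rule square_summable_add)
lift_definition minus_l2Z :: "'a l2Z \<Rightarrow> 'a l2Z \<Rightarrow> 'a l2Z" is "\<lambda>f g n. f n - g n"
  by (rule square_summable_diff)
lift_definition uminus_l2Z :: "'a l2Z \<Rightarrow> 'a l2Z" is "\<lambda>f n. - f n" by simp
lift_definition scaleC_l2Z :: "complex \<Rightarrow> 'a l2Z \<Rightarrow> 'a l2Z" is "\<lambda>c f n. c *\<^sub>C f n"
  by (rule square_summable_scaleC)
lift_definition scaleR_l2Z :: "real \<Rightarrow> 'a l2Z \<Rightarrow> 'a l2Z" is "\<lambda>r f n. r *\<^sub>R f n"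
  unfolding scaleR_scaleC by (rule square_summable_scaleC)

instance
  by standard (transfer, simp add: add.assoc add.commute scaleR_add_right scaleR_add_left
      scaleC_add_right scaleC_add_left scaleC_scaleC scaleR_scaleC fun_eq_iff)+

end

lemmas coord_simps [simp] = zero_l2Z.rep_eq plus_l2Z.rep_eq minus_l2Z.rep_eq uminus_l2Z.rep_eq
  scaleC_l2Z.rep_eq scaleR_l2Z.rep_eq

instantiation l2Z :: (chilbert_space) real_inner
begin

definition inner_l2Z :: "'a l2Z \<Rightarrow> 'a l2Z \<Rightarrow> real"
  where "inner u v = (\<Sum>\<^sub>\<infinity>n. inner (coord u n) (coord v n))"

definition norm_l2Z :: "'a l2Z \<Rightarrow> real"
  where "norm_l2Z u = sqrt (inner u u)"

definition dist_l2Z :: "'a l2Z \<Rightarrow> 'a l2Z \<Rightarrow> real"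
  where "dist_l2Z u v = norm (u - v)"

definition sgn_l2Z :: "'a l2Z \<Rightarrow> 'a l2Z"
  where "sgn_l2Z u = u /\<^sub>R norm u"

definition uniformity_l2Z :: "('a l2Z \<times> 'a l2Z) filter"
  where "uniformity_l2Z = (INF e\<in>{0<..}. principal {(x, y). dist x y < e})"

definition open_l2Z :: "'a l2Z set \<Rightarrow> bool"
  where "open_l2Z S = (\<forall>x\<in>S. \<forall>\<^sub>F (x', y) in uniformity. x' = x \<longrightarrow> y \<in> S)"

instance
proof
  fix u v w :: "'a l2Z" and r :: real
  show "dist u v = norm (u - v)" by (rule dist_l2Z_def)
  show "sgn u = u /\<^sub>R norm u" by (rule sgn_l2Z_def)
  show "(uniformity :: ('a l2Z \<times> 'a l2Z) filter) = (INF e\<in>{0<..}. principal {(x, y). dist x y < e})"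
    by (rule uniformity_l2Z_def)
  show "open S = (\<forall>x\<in>S. \<forall>\<^sub>F (x', y) in uniformity. x' = x \<longrightarrow> y \<in> S)" for S :: "'a l2Z set"
    by (rule open_l2Z_def)
  show "inner u v = inner v u" by (simp add: inner_l2Z_def inner_commute)
  show "inner (u + v) w = inner u w + inner v w"
    by (simp add: inner_l2Z_def inner_add_left infsum_add summable_inner_coord)
  show "inner (r *\<^sub>R u) v = r * inner u v"
    by (simp add: inner_l2Z_def infsum_cmult_right')
  show "0 \<le> inner u u" by (simp add: inner_l2Z_def infsum_nonneg)
  show "inner u u = 0 \<longleftrightarrow> u = 0"
  proof
    assume "inner u u = 0"
    then have "inner (coord u n) (coord u n) = 0" for n
      using nonneg_infsum_le_0D[OF _ summable_inner_coord[of u u], of n] by (simp add: inner_l2Z_def)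
    then show "u = 0" by (intro l2Z_eqI) simp
  qed (simp add: inner_l2Z_def)
  show "norm u = sqrt (inner u u)" by (rule norm_l2Z_def)
qed

end

lemma norm_l2Z_square: "(norm u)\<^sup>2 = (\<Sum>\<^sub>\<infinity>n. (norm (coord u n))\<^sup>2)"
  by (simp add: power2_norm_eq_inner inner_l2Z_def)

lemma sum_coord_le_norm: "finite F \<Longrightarrow> (\<Sum>n\<in>F. (norm (coord u n))\<^sup>2) \<le> (norm u)\<^sup>2"
  unfolding norm_l2Z_square by (rule finite_sum_le_infsum[OF summable_coord]) auto

lemma norm_coord_le: "norm (coord u n) \<le> norm u"
  using sum_coord_le_norm[of "{n}" u] by (simp add: power2_le_iff_abs_le)

lemma l2Z_boundI:
  fixes f :: "int \<Rightarrow> 'h::chilbert_space"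
  assumes "0 \<le> b" "\<And>F. finite F \<Longrightarrow> (\<Sum>n\<in>F. (norm (f n))\<^sup>2) \<le> b\<^sup>2"
  shows "coord (l2Z f) = f" "norm (l2Z f) \<le> b"
proof -
  have s: "(\<lambda>n. (norm (f n))\<^sup>2) summable_on UNIV"
    by (rule nonneg_bdd_above_summable_on) (use assms in \<open>auto intro!: bdd_aboveI2\<close>)
  then show c: "coord (l2Z f) = f" by (simp add: l2Z_inverse)
  have "(norm (l2Z f))\<^sup>2 \<le> b\<^sup>2"
    unfolding norm_l2Z_square c using s assms(2) by (intro infsum_le_finite_sums) auto
  then show "norm (l2Z f) \<le> b" using assms(1) by (rule power2_le_imp_le)
qed

instance l2Z :: (chilbert_space) complete_space
proof
  fix X :: "nat \<Rightarrow> 'a l2Z"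
  assume X: "Cauchy X"
  have "convergent (\<lambda>i. coord (X i) n)" for n
  proof (rule Cauchy_convergent, rule metric_CauchyI)
    fix e :: real assume "0 < e"
    then obtain M where M: "\<And>i j. M \<le> i \<Longrightarrow> M \<le> j \<Longrightarrow> dist (X i) (X j) < e"
      using metric_CauchyD[OF X] by blast
    have "dist (coord (X i) n) (coord (X j) n) \<le> dist (X i) (X j)" for i j
      using norm_coord_le[of "X i - X j" n] by (simp add: dist_norm)
    then show "\<exists>M. \<forall>i\<ge>M. \<forall>j\<ge>M. dist (coord (X i) n) (coord (X j) n) < e"
      using M by (meson le_less_trans)
  qed
  then have lim: "(\<lambda>i. coord (X i) n) \<longlonglongrightarrow> lim (\<lambda>i. coord (X i) n)" for n
    by (simp add: convergent_LIMSEQ_iff)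
  define g where "g n = lim (\<lambda>i. coord (X i) n)" for n
  have lim: "(\<lambda>i. coord (X i) n) \<longlonglongrightarrow> g n" for n
    using lim by (simp add: g_def)
  have key: "(\<Sum>n\<in>F. (norm (coord (X i) n - g n))\<^sup>2) \<le> e\<^sup>2"
    if M: "\<And>i j. M \<le> i \<Longrightarrow> M \<le> j \<Longrightarrow> dist (X i) (X j) < e" and "M \<le> i" "finite F" "0 < e" for e M i F
  proof (rule LIMSEQ_le_const2)
    show "(\<lambda>j. \<Sum>n\<in>F. (norm (coord (X i) n - coord (X j) n))\<^sup>2)
        \<longlonglongrightarrow> (\<Sum>n\<in>F. (norm (coord (X i) n - g n))\<^sup>2)"
      by (intro tendsto_intros lim)
    have "(\<Sum>n\<in>F. (norm (coord (X i) n - coord (X j) n))\<^sup>2) \<le> e\<^sup>2" if "M \<le> j" for j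
    proof -
      have "(\<Sum>n\<in>F. (norm (coord (X i) n - coord (X j) n))\<^sup>2) \<le> (norm (X i - X j))\<^sup>2"
        using sum_coord_le_norm[OF \<open>finite F\<close>, of "X i - X j"] by simp
      also have "\<dots> \<le> e\<^sup>2"
        using M[OF \<open>M \<le> i\<close> that] by (intro power_mono) (simp_all add: dist_norm)
      finally show ?thesis .
    qed
    then show "\<exists>N. \<forall>j\<ge>N. (\<Sum>n\<in>F. (norm (coord (X i) n - coord (X j) n))\<^sup>2) \<le> e\<^sup>2" by blast
  qed
  obtain M1 where M1: "\<And>i j. M1 \<le> i \<Longrightarrow> M1 \<le> j \<Longrightarrow> dist (X i) (X j) < 1"
    using metric_CauchyD[OF X, of 1] by auto
  have "coord (l2Z (\<lambda>n. coord (X M1) n - g n)) = (\<lambda>n. coord (X M1) n - g n)"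
    using key[OF M1] by (intro l2Z_boundI(1)[of 1]) auto
  then have "coord (X M1 - l2Z (\<lambda>n. coord (X M1) n - g n)) = g"
    by (simp add: fun_eq_iff)
  then obtain G where G: "coord G = g" by blast
  have "X \<longlonglongrightarrow> G"
  proof (rule metric_LIMSEQ_I)
    fix e :: real assume e: "0 < e"
    then obtain M where M: "\<And>i j. M \<le> i \<Longrightarrow> M \<le> j \<Longrightarrow> dist (X i) (X j) < e / 2"
      using metric_CauchyD[OF X, of "e / 2"] by auto
    have "dist (X i) G < e" if "M \<le> i" for i
    proof -
      have "(\<Sum>n\<in>F. (norm (coord (X i - G) n))\<^sup>2) \<le> (e / 2)\<^sup>2" if "finite F" for F
        using key[OF M \<open>M \<le> i\<close> that] e by (simp add: G)
      then have "norm (l2Z (coord (X i - G))) \<le> e / 2"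
        using e by (intro l2Z_boundI(2)) auto
      then show ?thesis using e by (simp add: coord_inverse dist_norm del: minus_l2Z.rep_eq)
    qed
    then show "\<exists>N. \<forall>i\<ge>N. dist (X i) G < e" by blast
  qed
  then show "convergent X" by (auto simp: convergent_def)
qed

lift_definition tensor_delta :: "'h::chilbert_space \<Rightarrow> int \<Rightarrow> 'h l2Z" (infix "\<otimes>\<delta>" 80)
  is "\<lambda>\<xi> n m. if m = n then \<xi> else 0"
proof -
  fix \<xi> :: 'h and n :: int
  show "(\<lambda>m. (norm (if m = n then \<xi> else 0))\<^sup>2) summable_on UNIV"
    by (rule finite_nonzero_values_imp_summable_on) (rule finite_subset[of _ "{n}"], auto)
qed

instantiation l2Z :: (chilbert_space) chilbert_space
begin

definition cinner_l2Z :: "'a l2Z \<Rightarrow> 'a l2Z \<Rightarrow> complex"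
  where "cinner u v = (\<Sum>\<^sub>\<infinity>n. cinner (coord u n) (coord v n))"

instance
proof
  fix u v w :: "'a l2Z" and c :: complex
  show "cinner (u + v) w = cinner u w + cinner v w"
    by (simp add: cinner_l2Z_def cinner_add_left infsum_add summable_cinner_coord)
  show "cinner (c *\<^sub>C u) v = c * cinner u v"
    by (simp add: cinner_l2Z_def cinner_scaleC_left infsum_cmult_right')
  show "cinner u v = cnj (cinner v u)"
    unfolding cinner_l2Z_def infsum_cnj[symmetric]
    by (rule infsum_cong) (rule cinner_commute)
  show "inner u v = Re (cinner u v)"
    unfolding cinner_l2Z_def inner_l2Z_def inner_eq_Re_cinner
    by (rule infsum_Re) (rule summable_cinner_coord)
  obtain x :: 'a where "x \<noteq> 0" using ex_nonzero by blast
  then have "coord (x \<otimes>\<delta> 0) 0 \<noteq> coord 0 0" by (simp add: tensor_delta.rep_eq)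
  then have "x \<otimes>\<delta> 0 \<noteq> 0" by auto
  then show "\<exists>u::'a l2Z. u \<noteq> 0" by blast
qed

end


section \<open>Unbounded operators\<close>

text \<open>
  An unbounded operator is its graph.  Hence \<open>T O S\<close> is the operator that applies \<open>T\<close> first and
  then \<open>S\<close>, on its natural domain; \<open>T\<inverse>\<close> is the inverse operator, and \<open>Id\<close> is the identity.
\<close>

definition linear_operator :: "('h::chilbert_space \<times> 'k::chilbert_space) set \<Rightarrow> bool"
  where "linear_operator T \<longleftrightarrow> single_valued T \<and> (0, 0) \<in> T \<and>
    (\<forall>u\<in>T. \<forall>v\<in>T. u + v \<in> T) \<and> (\<forall>c. \<forall>u\<in>T. c *\<^sub>C u \<in> T)"

definition densely_defined :: "('h::chilbert_space \<times> 'k::chilbert_space) set \<Rightarrow> bool"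
  where "densely_defined T \<longleftrightarrow> linear_operator T \<and> closure (Domain T) = UNIV"

definition op_adjoint :: "('h::chilbert_space \<times> 'k::chilbert_space) set \<Rightarrow> ('k \<times> 'h) set"
  where "op_adjoint T = {(y, z). \<forall>(x, w)\<in>T. cinner w y = cinner x z}"

definition selfadjoint_operator :: "('h::chilbert_space \<times> 'h) set \<Rightarrow> bool"
  where "selfadjoint_operator D \<longleftrightarrow> densely_defined D \<and> op_adjoint D = D"

definition op_add :: "('h \<times> 'k::plus) set \<Rightarrow> ('h \<times> 'k) set \<Rightarrow> ('h \<times> 'k) set"
  where "op_add S T = {(x, y + z) |x y z. (x, y) \<in> S \<and> (x, z) \<in> T}"

definition op_scaleC :: "complex \<Rightarrow> ('h \<times> 'k::complex_vector) set \<Rightarrow> ('h \<times> 'k) set"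
  where "op_scaleC c T = {(x, c *\<^sub>C y) |x y. (x, y) \<in> T}"

definition bop_graph :: "'h::chilbert_space bop \<Rightarrow> ('h \<times> 'h) set"
  where "bop_graph T = {(x, T \<bullet>\<^sub>o x) |x. True}"

definition positive_bop :: "'h::chilbert_space bop \<Rightarrow> bool"
  where "positive_bop T \<longleftrightarrow> (\<forall>x. cinner (T \<bullet>\<^sub>o x) x \<in> \<real>\<^sub>\<ge>\<^sub>0)"

definition compact_bop :: "'h::chilbert_space bop \<Rightarrow> bool"
  where "compact_bop T \<longleftrightarrow> compact (closure ((\<lambda>x. T \<bullet>\<^sub>o x) ` cball 0 1))"

text \<open>
  \<open>(1 + D\<^sup>2)\<^sup>-\<^sup>1\<^sup>/\<^sup>2\<close> is the unique positive bounded operator whose square is the bounded inverse of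
  \<open>1 + D\<^sup>2\<close>.
\<close>

definition is_inverse_sqrt_one_plus_square :: "'h::chilbert_space bop \<Rightarrow> ('h \<times> 'h) set \<Rightarrow> bool"
  where "is_inverse_sqrt_one_plus_square S D \<longleftrightarrow>
    positive_bop S \<and> bop_graph (S * S) = (op_add Id (D O D))\<inverse>"

text \<open>\<open>C\<close> is a bounded operator extending \<open>[D, T]\<close>, where \<open>T\<close> maps the domain of \<open>D\<close> into itself.\<close>

definition extends_commutator ::
    "'h::chilbert_space bop \<Rightarrow> ('h \<times> 'h) set \<Rightarrow> 'h bop \<Rightarrow> bool"
  where "extends_commutator C D T \<longleftrightarrow>
    (\<forall>x y z. (x, y) \<in> D \<and> (T \<bullet>\<^sub>o x, z) \<in> D \<longrightarrow> C \<bullet>\<^sub>o x = z - T \<bullet>\<^sub>o y)"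


section \<open>Spectral triples\<close>

text \<open>
  C*-algebras are norm-closed unital *-subalgebras \<open>A\<close> of an ambient C*-algebra, possibly all of it.
\<close>

definition star_subalgebra :: "'a::cstar_algebra set \<Rightarrow> bool"
  where "star_subalgebra B \<longleftrightarrow> 0 \<in> B \<and> (\<forall>a\<in>B. \<forall>b\<in>B. a + b \<in> B \<and> a * b \<in> B) \<and>
    (\<forall>c. \<forall>a\<in>B. c *\<^sub>C a \<in> B) \<and> (\<forall>a\<in>B. star a \<in> B)"

definition unital_cstar_subalgebra :: "'a::cstar_algebra set \<Rightarrow> bool"
  where "unital_cstar_subalgebra A \<longleftrightarrow> star_subalgebra A \<and> 1 \<in> A \<and> closed A"

definition representation :: "'a::cstar_algebra set \<Rightarrow> ('a \<Rightarrow> 'h::chilbert_space bop) \<Rightarrow> bool"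
  where "representation A \<pi> \<longleftrightarrow>
    (\<forall>a\<in>A. \<forall>b\<in>A. \<pi> (a + b) = \<pi> a + \<pi> b \<and> \<pi> (a * b) = \<pi> a * \<pi> b) \<and>
    (\<forall>c. \<forall>a\<in>A. \<pi> (c *\<^sub>C a) = c *\<^sub>C \<pi> a) \<and> (\<forall>a\<in>A. \<pi> (star a) = star (\<pi> a)) \<and> \<pi> 1 = 1"

definition odd_spectral_triple ::
    "'a::cstar_algebra set \<Rightarrow> 'a set \<Rightarrow> ('a \<Rightarrow> 'h::chilbert_space bop) \<Rightarrow> ('h \<times> 'h) set \<Rightarrow> bool"
  where "odd_spectral_triple A \<A> \<pi> D \<longleftrightarrow>
    unital_cstar_subalgebra A \<and> separable_space (top_of_set A) \<and>
    separable_space (euclidean :: 'h topology) \<and> representation A \<pi> \<and>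
    star_subalgebra \<A> \<and> \<A> \<subseteq> A \<and> A \<subseteq> closure \<A> \<and>
    selfadjoint_operator D \<and>
    (\<exists>S. is_inverse_sqrt_one_plus_square S D \<and> compact_bop S) \<and>
    (\<forall>a\<in>\<A>. (\<forall>x\<in>Domain D. \<pi> a \<bullet>\<^sub>o x \<in> Domain D) \<and> (\<exists>C. extends_commutator C D (\<pi> a)))"

definition direct_sum_bop ::
    "'h::chilbert_space bop \<Rightarrow> 'k::chilbert_space bop \<Rightarrow> ('h \<times> 'k) bop" (infixr "\<oplus>\<^sub>o" 65)
  where "S \<oplus>\<^sub>o T = Bop (\<lambda>z. (S \<bullet>\<^sub>o fst z, T \<bullet>\<^sub>o snd z))"

text \<open>The operator matrix with zero diagonal, upper right entry \<open>S\<close> and lower left entry \<open>T\<close>.\<close>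

definition off_diagonal :: "('k \<times> 'h) set \<Rightarrow> ('h \<times> 'k) set \<Rightarrow> (('h \<times> 'k) \<times> ('h \<times> 'k)) set"
  where "off_diagonal S T = {((x, y), (u, v)). (y, u) \<in> S \<and> (x, v) \<in> T}"

definition even_spectral_triple ::
    "'a::cstar_algebra set \<Rightarrow> 'a set \<Rightarrow> ('a \<Rightarrow> ('h::chilbert_space \<times> 'k::chilbert_space) bop) \<Rightarrow>
      (('h \<times> 'k) \<times> ('h \<times> 'k)) set \<Rightarrow> bool"
  where "even_spectral_triple A \<A> \<pi> D \<longleftrightarrow>
    odd_spectral_triple A \<A> \<pi> D \<and>
    (\<exists>\<pi>0 \<pi>1. \<forall>a\<in>A. \<pi> a = \<pi>0 a \<oplus>\<^sub>o \<pi>1 a) \<and>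
    (\<exists>D0. densely_defined D0 \<and> D = off_diagonal D0 (op_adjoint D0))"

definition lip_seminorm ::
    "('a \<Rightarrow> 'h::chilbert_space bop) \<Rightarrow> ('h \<times> 'h) set \<Rightarrow> 'a \<Rightarrow> real"
  where "lip_seminorm \<pi> D a = norm (THE C. extends_commutator C D (\<pi> a))"


section \<open>State spaces and Lip-metrics\<close>

text \<open>States are undefined outside \<open>A\<close>, so that distinct states differ somewhere on \<open>A\<close>.\<close>

definition state_space :: "'a::cstar_algebra set \<Rightarrow> ('a \<Rightarrow> complex) set"
  where "state_space A = {\<phi> \<in> extensional A.
    (\<forall>a\<in>A. \<forall>b\<in>A. \<phi> (a + b) = \<phi> a + \<phi> b) \<and> (\<forall>c. \<forall>a\<in>A. \<phi> (c *\<^sub>C a) = c * \<phi> a) \<and>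
    (\<forall>a\<in>A. \<phi> (star a * a) \<in> \<real>\<^sub>\<ge>\<^sub>0) \<and> \<phi> 1 = 1}"

definition weak_star_topology :: "'a::cstar_algebra set \<Rightarrow> ('a \<Rightarrow> complex) topology"
  where "weak_star_topology A =
    subtopology (product_topology (\<lambda>_. euclidean) A) (state_space A)"

definition state_dist ::
    "'a::cstar_algebra set \<Rightarrow> ('a \<Rightarrow> real) \<Rightarrow> ('a \<Rightarrow> complex) \<Rightarrow> ('a \<Rightarrow> complex) \<Rightarrow> ennreal"
  where "state_dist \<A> L \<phi> \<psi> = (SUP a\<in>{a\<in>\<A>. L a \<le> 1}. ennreal (cmod (\<phi> a - \<psi> a)))"

definition lip_metric :: "'a::cstar_algebra set \<Rightarrow> 'a set \<Rightarrow> ('a \<Rightarrow> real) \<Rightarrow> bool"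
  where "lip_metric A \<A> L \<longleftrightarrow>
    (\<forall>\<phi>\<in>state_space A. \<forall>\<psi>\<in>state_space A. state_dist \<A> L \<phi> \<psi> < \<infinity>) \<and>
    Metric_space (state_space A) (\<lambda>\<phi> \<psi>. enn2real (state_dist \<A> L \<phi> \<psi>)) \<and>
    Metric_space.mtopology (state_space A) (\<lambda>\<phi> \<psi>. enn2real (state_dist \<A> L \<phi> \<psi>)) =
      weak_star_topology A"


section \<open>Equicontinuous actions and crossed products by the integers\<close>

definition star_automorphism :: "('a::cstar_algebra \<Rightarrow> 'a) \<Rightarrow> bool"
  where "star_automorphism f \<longleftrightarrow> bij f \<and> (\<forall>a b. f (a + b) = f a + f b \<and> f (a * b) = f a * f b) \<and>
    (\<forall>c a. f (c *\<^sub>C a) = c *\<^sub>C f a) \<and> (\<forall>a. f (star a) = star (f a))"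

definition group_action :: "('g::group_add \<Rightarrow> 'a::cstar_algebra \<Rightarrow> 'a) \<Rightarrow> bool"
  where "group_action \<alpha> \<longleftrightarrow>
    (\<forall>g. star_automorphism (\<alpha> g)) \<and> (\<forall>g h. \<alpha> (g + h) = \<alpha> g \<circ> \<alpha> h)"

definition metrically_equicontinuous ::
    "'a::cstar_algebra set \<Rightarrow> ('a \<Rightarrow> real) \<Rightarrow> ('g::group_add \<Rightarrow> 'a \<Rightarrow> 'a) \<Rightarrow> bool"
  where "metrically_equicontinuous \<A> L \<alpha> \<longleftrightarrow>
    star_subalgebra \<A> \<and> 1 \<in> \<A> \<and> closure \<A> = UNIV \<and>
    (\<forall>g. \<alpha> g ` \<A> = \<A>) \<and> (\<forall>a\<in>\<A>. bdd_above (range (\<lambda>g. L (\<alpha> g a))))"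

text \<open>
  \<open>A \<rtimes> \<int>\<close> is realised on \<open>H \<otimes> l\<^sup>2(\<int>)\<close> by the regular representation induced by \<open>\<pi>\<close>; this is the
  crossed product whenever \<open>\<pi>\<close> is faithful, full and reduced crossed products by \<open>\<int>\<close> being equal.
  The functions passed to \<open>Bop\<close> are bounded operators: see \<open>coord_pi_tilde\<close>, \<open>pi_tilde_tensor_delta\<close>
  and \<open>shift_op_tensor_delta\<close> below.
\<close>

definition pi_tilde ::
    "('a \<Rightarrow> 'h::chilbert_space bop) \<Rightarrow> (int \<Rightarrow> 'a \<Rightarrow> 'a) \<Rightarrow> 'a \<Rightarrow> 'h l2Z bop"
  where "pi_tilde \<pi> \<alpha> a = Bop (\<lambda>u. l2Z (\<lambda>n. \<pi> (\<alpha> (- n) a) \<bullet>\<^sub>o coord u n))"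

definition shift_op :: "int \<Rightarrow> 'h::chilbert_space l2Z bop"
  where "shift_op m = Bop (\<lambda>u. l2Z (\<lambda>n. coord u (n - m)))"

definition crossed_Cc ::
    "('a \<Rightarrow> 'h::chilbert_space bop) \<Rightarrow> (int \<Rightarrow> 'a \<Rightarrow> 'a) \<Rightarrow> 'a set \<Rightarrow> 'h l2Z bop set"
  where "crossed_Cc \<pi> \<alpha> \<A> =
    {(\<Sum>n\<in>F. pi_tilde \<pi> \<alpha> (x n) * shift_op n) |F x. finite F \<and> (\<forall>n\<in>F. x n \<in> \<A>)}"

definition crossed_product ::
    "('a \<Rightarrow> 'h::chilbert_space bop) \<Rightarrow> (int \<Rightarrow> 'a \<Rightarrow> 'a) \<Rightarrow> 'h l2Z bop set"
  where "crossed_product \<pi> \<alpha> = closure (crossed_Cc \<pi> \<alpha> UNIV)"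

text \<open>\<open>T \<otimes> 1\<close> and \<open>1 \<otimes> M\<^sub>f\<close> on \<open>H \<otimes> l\<^sup>2(\<int>)\<close>, with their maximal domains.\<close>

definition tensor_one :: "('h::chilbert_space \<times> 'h) set \<Rightarrow> ('h l2Z \<times> 'h l2Z) set"
  where "tensor_one T = {(u, v). \<forall>n. (coord u n, coord v n) \<in> T}"

definition one_tensor_mult :: "(int \<Rightarrow> int) \<Rightarrow> ('h::chilbert_space l2Z \<times> 'h l2Z) set"
  where "one_tensor_mult f = {(u, v). \<forall>n. coord v n = of_int (f n) *\<^sub>C coord u n}"

definition crossed_dirac ::
    "('h::chilbert_space \<times> 'h) set \<Rightarrow> (('h l2Z \<times> 'h l2Z) \<times> ('h l2Z \<times> 'h l2Z)) set"
  where "crossed_dirac D = off_diagonal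
    (op_add (tensor_one D) (op_scaleC (- \<i>) (one_tensor_mult id)))
    (op_add (tensor_one D) (op_scaleC \<i> (one_tensor_mult id)))"


section \<open>Basic facts about these operators\<close>

lemma direct_sum_bop_app: "(S \<oplus>\<^sub>o T) \<bullet>\<^sub>o z = (S \<bullet>\<^sub>o fst z, T \<bullet>\<^sub>o snd z)"
  unfolding direct_sum_bop_def
proof (rule Bop_app)
  show "bounded_linear (\<lambda>z. (S \<bullet>\<^sub>o fst z, T \<bullet>\<^sub>o snd z))"
    by (rule bounded_linear_Pair[OF
          bounded_linear_compose[OF bounded_linear_bop_app bounded_linear_fst]
          bounded_linear_compose[OF bounded_linear_bop_app bounded_linear_snd]])
qed (simp add: scaleC_prod_def bop_app_scaleC)

lemma extends_commutator_unique:
  assumes D: "densely_defined D" and T: "\<forall>x\<in>Domain D. T \<bullet>\<^sub>o x \<in> Domain D"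
    and C: "extends_commutator C D T" and C': "extends_commutator C' D T"
  shows "C' = C"
proof -
  have zero: "(C' - C) \<bullet>\<^sub>o x = 0" if x: "x \<in> Domain D" for x
  proof -
    have "T \<bullet>\<^sub>o x \<in> Domain D" using x T by blast
    with x obtain y z where "(x, y) \<in> D" "(T \<bullet>\<^sub>o x, z) \<in> D" by blast
    then have "C' \<bullet>\<^sub>o x = z - T \<bullet>\<^sub>o y" "C \<bullet>\<^sub>o x = z - T \<bullet>\<^sub>o y"
      using C C' unfolding extends_commutator_def by blast+
    then show ?thesis by simp
  qed
  have "(C' - C) \<bullet>\<^sub>o x = 0" for x
  proof (rule continuous_constant_on_closure[of "Domain D" "bop_app (C' - C)" 0 x])
    show "continuous_on (closure (Domain D)) (bop_app (C' - C))"
      by (rule linear_continuous_on[OF bounded_linear_bop_app])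
    show "x \<in> closure (Domain D)" using D by (simp add: densely_defined_def)
  qed (rule zero)
  then show ?thesis by (intro bop_eqI) simp
qed

lemma lip_seminorm_eq:
  assumes "densely_defined D" "\<forall>x\<in>Domain D. \<pi> a \<bullet>\<^sub>o x \<in> Domain D" "extends_commutator C D (\<pi> a)"
  shows "lip_seminorm \<pi> D a = norm C"
proof -
  have "(THE C. extends_commutator C D (\<pi> a)) = C"
    by (rule the_equality, rule assms(3), rule extends_commutator_unique[OF assms])
  then show ?thesis unfolding lip_seminorm_def by (rule arg_cong)
qed

lemma coord_tensor_delta: "coord (\<xi> \<otimes>\<delta> n) m = (if m = n then \<xi> else 0)"
  by (simp add: tensor_delta.rep_eq)

lemma cinner_tensor_delta:
  "cinner (\<xi> \<otimes>\<delta> m) (\<eta> \<otimes>\<delta> n) = (if m = n then cinner \<xi> \<eta> else 0)"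
proof -
  have z: "cinner 0 y = 0" "cinner y 0 = 0" for y :: 'a
    using cinner_add_left[of 0 0 y] cinner_add_right[of y 0 0] by simp_all
  have "((\<lambda>k. cinner (coord (\<xi> \<otimes>\<delta> m) k) (coord (\<eta> \<otimes>\<delta> n) k)) has_sum
      (if m = n then cinner \<xi> \<eta> else 0)) UNIV"
    by (rule has_sum_finite_neutralI[of "{m}"]) (auto simp: coord_tensor_delta z)
  then show ?thesis by (simp add: cinner_l2Z_def infsumI)
qed

lemma l2Z_operator:
  fixes f :: "'h::chilbert_space l2Z \<Rightarrow> int \<Rightarrow> 'h"
  assumes add: "\<And>u v n. f (u + v) n = f u n + f v n"
    and scale: "\<And>c u n. f (c *\<^sub>C u) n = c *\<^sub>C f u n"
    and b: "0 \<le> b" "\<And>u F. finite F \<Longrightarrow> (\<Sum>n\<in>F. (norm (f u n))\<^sup>2) \<le> (b * norm u)\<^sup>2"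
  shows "coord (Bop (\<lambda>u. l2Z (f u)) \<bullet>\<^sub>o u) = f u"
proof -
  have c: "coord (l2Z (f u)) = f u" and nm: "norm (l2Z (f u)) \<le> b * norm u" for u
    using l2Z_boundI[of "b * norm u" "f u"] b by simp_all
  have "Bop (\<lambda>u. l2Z (f u)) \<bullet>\<^sub>o u = l2Z (f u)"
  proof (rule Bop_app)
    show sc: "l2Z (f (c *\<^sub>C u)) = c *\<^sub>C l2Z (f u)" for c u
      by (rule l2Z_eqI) (simp add: c scale)
    show "bounded_linear (\<lambda>u. l2Z (f u))"
    proof (rule bounded_linear_intro[where K=b])
      show "l2Z (f (u + v)) = l2Z (f u) + l2Z (f v)" for u v
        by (rule l2Z_eqI) (simp add: c add)
      show "l2Z (f (r *\<^sub>R u)) = r *\<^sub>R l2Z (f u)" for r u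
        by (simp add: scaleR_scaleC sc)
      show "norm (l2Z (f u)) \<le> norm u * b" for u
        using nm[of u] by (simp add: mult.commute)
    qed
  qed
  then show ?thesis by (simp add: c)
qed

lemma coord_shift_op: "coord (shift_op m \<bullet>\<^sub>o u) n = coord u (n - m)"
proof -
  have "coord (shift_op m \<bullet>\<^sub>o u) = (\<lambda>n. coord u (n - m))"
    unfolding shift_op_def
  proof (rule l2Z_operator[where b=1])
    fix u :: "'a l2Z" and F :: "int set"
    assume F: "finite F"
    have "(\<Sum>n\<in>F. (norm (coord u (n - m)))\<^sup>2) = (\<Sum>n\<in>(\<lambda>n. n - m) ` F. (norm (coord u n))\<^sup>2)"
      by (subst sum.reindex) (auto simp: inj_on_def)
    then show "(\<Sum>n\<in>F. (norm (coord u (n - m)))\<^sup>2) \<le> (1 * norm u)\<^sup>2"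
      using sum_coord_le_norm[of "(\<lambda>n. n - m) ` F" u] F by simp
  qed simp_all
  then show ?thesis by simp
qed

lemma shift_op_tensor_delta: "shift_op m \<bullet>\<^sub>o (\<xi> \<otimes>\<delta> n) = \<xi> \<otimes>\<delta> (m + n)"
  by (rule l2Z_eqI) (auto simp: coord_shift_op coord_tensor_delta)

lemma left_inverse_one_minus:
  fixes x :: "'a::cstar_algebra"
  assumes "norm x < 1"
  obtains y where "y * (1 - x) = 1"
proof -
  have s: "summable (\<lambda>n. x ^ n)" using assms by (rule complete_algebra_summable_geometric)
  have "(\<Sum>n. x ^ n) * x = (\<Sum>n. x ^ n * x)" by (rule suminf_mult2[OF s])
  also have "\<dots> = (\<Sum>n. x ^ Suc n)" by (simp add: power_commutes)
  also have "\<dots> = (\<Sum>n. x ^ n) - 1" using suminf_split_head[OF s] by simp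
  finally have "(\<Sum>n. x ^ n) * (1 - x) = 1" by (simp add: right_diff_distrib)
  then show ?thesis by (rule that)
qed

lemma norm_representation_selfadjoint_le:
  fixes \<pi> :: "'a::cstar_algebra \<Rightarrow> 'h::chilbert_space bop"
  assumes \<pi>: "representation UNIV \<pi>" and h: "star h = h"
  shows "norm (\<pi> h) \<le> norm h"
proof (rule ccontr)
  assume gt: "\<not> norm (\<pi> h) \<le> norm h"
  define t where "t = norm (\<pi> h)"
  define T where "T = \<pi> h"
  have lt: "norm h < t" using gt by (simp add: t_def)
  then have t: "0 < t" using norm_ge_zero[of h] by linarith
  have "norm ((1 / t\<^sup>2) *\<^sub>R (h * h)) = norm (h * h) / t\<^sup>2" by simp
  also have "\<dots> \<le> (norm h)\<^sup>2 / t\<^sup>2"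
    using norm_mult_ineq[of h h] by (intro divide_right_mono) (simp_all add: power2_eq_square)
  also have "\<dots> < 1" using lt t by (simp add: power_strict_mono)
  finally obtain y where y: "y * (1 - (1 / t\<^sup>2) *\<^sub>R (h * h)) = 1"
    by (rule left_inverse_one_minus)
  have \<pi>_diff: "\<pi> (a - b) = \<pi> a - \<pi> b" for a b
  proof -
    have "\<pi> (a - b + b) = \<pi> (a - b) + \<pi> b" using \<pi> unfolding representation_def by blast
    then show ?thesis by simp
  qed
  have Y: "\<pi> y * (1 - complex_of_real (1 / t\<^sup>2) *\<^sub>C (T * T)) = 1"
    using arg_cong[OF y, of \<pi>] \<pi> unfolding representation_def T_def
    by (simp add: \<pi>_diff scaleR_scaleC)
  have "\<pi> (star h) = star (\<pi> h)" using \<pi> unfolding representation_def by blast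
  then have sT: "star T = T" by (simp add: h T_def)
  define k where "k = norm (\<pi> y)"
  have "\<pi> y \<noteq> 0" using Y by auto
  then have k: "0 < k" by (simp add: k_def)
  have bound: "(norm (T \<bullet>\<^sub>o v))\<^sup>2 \<le> t\<^sup>2 * (1 - 1 / k\<^sup>2) * (norm v)\<^sup>2" for v
  proof -
    define w where "w = v - (1 / t\<^sup>2) *\<^sub>R (T \<bullet>\<^sub>o T \<bullet>\<^sub>o v)"
    have "v = \<pi> y \<bullet>\<^sub>o w"
      using arg_cong[OF Y, of "\<lambda>S. S \<bullet>\<^sub>o v"] by (simp add: w_def bop_app_scaleC_left scaleR_scaleC)
    then have "norm v \<le> k * norm w" using norm_bop_app[of "\<pi> y" w] by (simp add: k_def)
    then have v: "(norm v)\<^sup>2 \<le> k\<^sup>2 * (norm w)\<^sup>2"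
      using power_mono[of "norm v" "k * norm w" 2] by (simp add: power_mult_distrib)
    have "inner v (T \<bullet>\<^sub>o T \<bullet>\<^sub>o v) = (norm (T \<bullet>\<^sub>o v))\<^sup>2"
      using cinner_star_left[of T v "T \<bullet>\<^sub>o v"] by (simp add: sT power2_norm_eq_inner inner_eq_Re_cinner)
    then have "(norm w)\<^sup>2 = (norm v)\<^sup>2 - 2 / t\<^sup>2 * (norm (T \<bullet>\<^sub>o v))\<^sup>2
        + (1 / t\<^sup>2)\<^sup>2 * (norm (T \<bullet>\<^sub>o T \<bullet>\<^sub>o v))\<^sup>2"
      unfolding w_def power2_norm_eq_inner
      by (simp add: inner_diff_left inner_diff_right inner_commute[of "T \<bullet>\<^sub>o T \<bullet>\<^sub>o v" v]
          power2_eq_square diff_divide_distrib)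
    also have "(1 / t\<^sup>2)\<^sup>2 * (norm (T \<bullet>\<^sub>o T \<bullet>\<^sub>o v))\<^sup>2 \<le> (1 / t\<^sup>2)\<^sup>2 * (t * norm (T \<bullet>\<^sub>o v))\<^sup>2"
      using norm_bop_app[of T "T \<bullet>\<^sub>o v"] by (intro mult_left_mono power_mono) (simp_all add: t_def T_def)
    also have "\<dots> = 1 / t\<^sup>2 * (norm (T \<bullet>\<^sub>o v))\<^sup>2"
      using t by (simp add: power_mult_distrib power2_eq_square)
    finally have w: "(norm w)\<^sup>2 \<le> (norm v)\<^sup>2 - 1 / t\<^sup>2 * (norm (T \<bullet>\<^sub>o v))\<^sup>2" by simp
    have "(norm v)\<^sup>2 / k\<^sup>2 \<le> (norm w)\<^sup>2" using v k by (simp add: pos_divide_le_eq mult.commute)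
    then have "1 / t\<^sup>2 * (norm (T \<bullet>\<^sub>o v))\<^sup>2 \<le> (1 - 1 / k\<^sup>2) * (norm v)\<^sup>2"
      using w by (simp add: left_diff_distrib)
    then have "t\<^sup>2 * (1 / t\<^sup>2 * (norm (T \<bullet>\<^sub>o v))\<^sup>2) \<le> t\<^sup>2 * ((1 - 1 / k\<^sup>2) * (norm v)\<^sup>2)"
      by (rule mult_left_mono) simp
    then show ?thesis using t by (simp add: mult.assoc)
  qed
  define q where "q = max 0 (1 - 1 / k\<^sup>2)"
  have q: "0 \<le> q" "q < 1" "1 - 1 / k\<^sup>2 \<le> q" using k by (simp_all add: q_def)
  have "norm (T \<bullet>\<^sub>o v) \<le> (t * sqrt q) * norm v" for v
  proof (rule power2_le_imp_le)
    have "(norm (T \<bullet>\<^sub>o v))\<^sup>2 \<le> t\<^sup>2 * q * (norm v)\<^sup>2"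
      using bound[of v] mult_right_mono[OF mult_left_mono[OF q(3), of "t\<^sup>2"], of "(norm v)\<^sup>2"]
      by simp
    then show "(norm (T \<bullet>\<^sub>o v))\<^sup>2 \<le> (t * sqrt q * norm v)\<^sup>2"
      using q(1) by (simp add: power_mult_distrib)
  qed (use t q in simp)
  then have "t \<le> t * sqrt q"
    unfolding T_def using t q by (subst t_def, intro norm_bop_bound) simp_all
  moreover have "sqrt q < 1" using q by simp
  ultimately show False using t by simp
qed

lemma norm_representation_le:
  fixes \<pi> :: "'a::cstar_algebra \<Rightarrow> 'h::chilbert_space bop"
  assumes \<pi>: "representation UNIV \<pi>"
  shows "norm (\<pi> a) \<le> norm a"
proof -
  have "(norm (\<pi> a))\<^sup>2 = norm (\<pi> (star a * a))"
    using \<pi> unfolding representation_def by (simp add: norm_star_mult)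
  also have "\<dots> \<le> norm (star a * a)"
    by (rule norm_representation_selfadjoint_le[OF \<pi>]) (simp add: star_mult star_star)
  also have "\<dots> = (norm a)\<^sup>2" by (rule norm_star_mult)
  finally show ?thesis by (rule power2_le_imp_le) simp
qed

lemma representation_comp_automorphism:
  assumes \<pi>: "representation UNIV \<pi>" and f: "star_automorphism f"
  shows "representation UNIV (\<lambda>a. \<pi> (f a))"
proof -
  have mult: "f (a * b) = f a * f b" for a b using f by (simp add: star_automorphism_def)
  obtain b where b: "f b = 1" using f bij_is_surj[of f] surjD[of f 1]
    unfolding star_automorphism_def by auto
  have "f 1 = 1" using mult[of 1 b] b by simp
  then show ?thesis using \<pi> f by (simp add: representation_def star_automorphism_def)
qed

lemma coord_pi_tilde:
  fixes \<pi> :: "'a::cstar_algebra \<Rightarrow> 'h::chilbert_space bop"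
  assumes \<pi>: "representation UNIV \<pi>" and \<alpha>: "group_action \<alpha>"
  shows "coord (pi_tilde \<pi> \<alpha> a \<bullet>\<^sub>o u) n = \<pi> (\<alpha> (- n) a) \<bullet>\<^sub>o coord u n"
proof -
  have le: "norm (\<pi> (\<alpha> n a)) \<le> norm a" for n
    using norm_representation_le[OF representation_comp_automorphism[OF \<pi>]] \<alpha>
    by (simp add: group_action_def)
  have "coord (pi_tilde \<pi> \<alpha> a \<bullet>\<^sub>o u) = (\<lambda>n. \<pi> (\<alpha> (- n) a) \<bullet>\<^sub>o coord u n)"
    unfolding pi_tilde_def
  proof (rule l2Z_operator[where b="norm a"])
    show "\<pi> (\<alpha> (- n) a) \<bullet>\<^sub>o coord (u + v) n =
        \<pi> (\<alpha> (- n) a) \<bullet>\<^sub>o coord u n + \<pi> (\<alpha> (- n) a) \<bullet>\<^sub>o coord v n" for u v n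
      by (simp add: linear_add[OF bounded_linear.linear[OF bounded_linear_bop_app]])
    fix u :: "'h l2Z" and F :: "int set"
    assume F: "finite F"
    have "(\<Sum>n\<in>F. (norm (\<pi> (\<alpha> (- n) a) \<bullet>\<^sub>o coord u n))\<^sup>2) \<le>
        (\<Sum>n\<in>F. (norm a)\<^sup>2 * (norm (coord u n))\<^sup>2)"
    proof (rule sum_mono)
      fix n
      have "norm (\<pi> (\<alpha> (- n) a) \<bullet>\<^sub>o coord u n) \<le> norm a * norm (coord u n)"
        using norm_bop_app le by (rule order_trans[OF _ mult_right_mono]) simp
      then show "(norm (\<pi> (\<alpha> (- n) a) \<bullet>\<^sub>o coord u n))\<^sup>2 \<le> (norm a)\<^sup>2 * (norm (coord u n))\<^sup>2"
        by (simp add: power_mult_distrib[symmetric] power_mono)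
    qed
    also have "\<dots> \<le> (norm a * norm u)\<^sup>2"
      using sum_coord_le_norm[OF F, of u]
      by (simp add: sum_distrib_left[symmetric] power_mult_distrib mult_left_mono)
    finally show "(\<Sum>n\<in>F. (norm (\<pi> (\<alpha> (- n) a) \<bullet>\<^sub>o coord u n))\<^sup>2) \<le> (norm a * norm u)\<^sup>2" .
  qed (simp_all add: bop_app_scaleC)
  then show ?thesis by simp
qed

lemma pi_tilde_tensor_delta:
  assumes "representation UNIV \<pi>" "group_action \<alpha>"
  shows "pi_tilde \<pi> \<alpha> a \<bullet>\<^sub>o (\<xi> \<otimes>\<delta> n) = (\<pi> (\<alpha> (- n) a) \<bullet>\<^sub>o \<xi>) \<otimes>\<delta> n"
proof -
  have "\<pi> (\<alpha> (- m) a) \<bullet>\<^sub>o 0 = 0" for m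
    by (rule linear_0[OF bounded_linear.linear[OF bounded_linear_bop_app]])
  then show ?thesis by (intro l2Z_eqI) (simp add: coord_pi_tilde[OF assms] coord_tensor_delta)
qed

lemma crossed_dirac_tensor_delta:
  assumes "(\<xi>, \<xi>') \<in> D" "(\<eta>, \<eta>') \<in> D" "(0, 0) \<in> D"
  shows "((\<xi> \<otimes>\<delta> n, \<eta> \<otimes>\<delta> n),
      ((\<eta>' - (\<i> * of_int n) *\<^sub>C \<eta>) \<otimes>\<delta> n, (\<xi>' + (\<i> * of_int n) *\<^sub>C \<xi>) \<otimes>\<delta> n))
    \<in> crossed_dirac D"
proof -
  have one: "(\<zeta> \<otimes>\<delta> n, \<zeta>' \<otimes>\<delta> n) \<in> tensor_one D" if "(\<zeta>, \<zeta>') \<in> D" for \<zeta> \<zeta>'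
    using that assms(3) by (simp add: tensor_one_def coord_tensor_delta)
  have M: "(\<zeta> \<otimes>\<delta> n, ((c * of_int n) *\<^sub>C \<zeta>) \<otimes>\<delta> n) \<in> op_scaleC c (one_tensor_mult id)" for c and \<zeta> :: 'a
  proof -
    have "(\<zeta> \<otimes>\<delta> n, (of_int n *\<^sub>C \<zeta>) \<otimes>\<delta> n) \<in> one_tensor_mult id"
      by (simp add: one_tensor_mult_def coord_tensor_delta)
    moreover have "((c * of_int n) *\<^sub>C \<zeta>) \<otimes>\<delta> n = c *\<^sub>C ((of_int n *\<^sub>C \<zeta>) \<otimes>\<delta> n)"
      by (rule l2Z_eqI) (simp add: coord_tensor_delta scaleC_scaleC)
    ultimately show ?thesis unfolding op_scaleC_def by blast
  qed
  have plus: "(\<zeta> + \<theta>) \<otimes>\<delta> n = \<zeta> \<otimes>\<delta> n + \<theta> \<otimes>\<delta> n" for \<zeta> \<theta> :: 'a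
    by (rule l2Z_eqI) (simp add: coord_tensor_delta)
  have neg: "\<eta>' - (\<i> * of_int n) *\<^sub>C \<eta> = \<eta>' + (- \<i> * of_int n) *\<^sub>C \<eta>"
    using scaleC_add_left[of "\<i> * of_int n" "- \<i> * of_int n" \<eta>]
    by (simp add: eq_neg_iff_add_eq_0 add.commute algebra_simps)
  show ?thesis
    unfolding crossed_dirac_def off_diagonal_def neg plus op_add_def
    using one[OF assms(1)] one[OF assms(2)] M[of \<xi> \<i>] M[of \<eta> "- \<i>"] by blast
qed

end

theory Submission
  imports Defs
begin

text \<open>
  By Rieffel's criterion, a densely defined seminorm induces a Lip-metric if and only if the image of its
  unit ball modulo scalars is totally bounded.  Both directions are needed: one for the given triple, where
  total boundedness is extracted from the Lip-metric (\<open>lip_metric_imp_net\<close>), and one for the crossed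
  product, where the Lip-metric is obtained from total boundedness (\<open>lip_metricI\<close>).

  Let \<open>x = \<Sum>\<^sub>n x\<^sub>n \<lambda>\<^sub>n\<close> be in the unit ball of the seminorm of the crossed product.  The corners of its commutator
  with the Dirac operator are \<open>Z \<plusminus> \<i> Y\<close>, where \<open>Z\<close> is the commutator with \<open>D\<^sub>A \<otimes> 1\<close> and
  \<open>Y = \<Sum>\<^sub>n n x\<^sub>n \<lambda>\<^sub>n\<close> is the commutator with \<open>1 \<otimes> M\<close>; hence both have norm at most \<open>1\<close>.  The entries of an
  operator matrix are dominated by the operator.  For \<open>Z\<close> this shows that every coefficient \<open>x\<^sub>n\<close> is in the
  unit ball of \<open>L\<close>; for \<open>Y\<close> it shows that the coefficients with \<open>n \<noteq> 0\<close> are bounded in norm.  So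
  \<open>x\<^sub>0\<close> modulo scalars, and \<open>x\<^sub>n\<close> for \<open>n \<noteq> 0\<close>, range over totally bounded sets.  Finally, the terms of the
  series outside a large finite set of indices are uniformly small: on a vector \<open>u\<close>, the
  Cauchy-Schwarz inequality bounds them by \<open>(\<Sum>\<^sub>n 1 / n\<^sup>2)\<^sup>1\<^sup>/\<^sup>2 (\<Sum>\<^sub>n \<parallel>n x\<^sub>n \<lambda>\<^sub>n u\<parallel>\<^sup>2)\<^sup>1\<^sup>/\<^sup>2\<close>, and the second factor is
  at most \<open>\<parallel>Y\<parallel> \<parallel>u\<parallel>\<close>, because the columns of the matrix of \<open>Y\<close> are images of vectors supported at one
  coordinate (\<open>sum_norm_band_le\<close>, \<open>norm_tail_le\<close>).  Finitely many totally bounded coefficients and a small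
  remainder give total boundedness (\<open>totally_bounded_crossed\<close>).

  Norms in the crossed product are compared with states of \<open>A\<close> through the vector states of the
  representations \<open>\<pi> \<circ> \<alpha>\<^sub>n\<close>, whose numerical radius determines the norm up to a factor \<open>2\<close>.

  That the Dirac operator defines an even spectral triple is seen coordinate by coordinate.  The vectors
  \<open>D\<^sub>A u\<^sub>n\<close> and \<open>\<i> n u\<^sub>n\<close> are orthogonal for the real inner product, so the domain of \<open>D\<^sub>A \<otimes> 1 \<plusminus> \<i> \<otimes> M\<close> has a
  coordinatewise description (\<open>dirac_corner_iff\<close>), from which selfadjointness follows.  The square of the
  Dirac operator is diagonal with entries \<open>D\<^sub>A\<^sup>2 + n\<^sup>2\<close>, and the square root of its resolvent is assembled
  from the compact operators \<open>(1 + n\<^sup>2 + D\<^sub>A\<^sup>2)\<^sup>-\<^sup>1\<^sup>/\<^sup>2\<close>, which are obtained from \<open>(1 + D\<^sub>A\<^sup>2)\<^sup>-\<^sup>1\<^sup>/\<^sup>2\<close> by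
  binomial series and whose norms tend to \<open>0\<close>.
\<close>

section \<open>Powers of elements close to the unit\<close>

text \<open>
  The binomial series of \<open>(1 + x)\<^sup>p\<close>.  It serves as functional calculus: the roots that occur below
  are those of elements at distance less than \<open>1\<close> from the unit.
\<close>

definition binomial_power :: "real \<Rightarrow> 'a::cstar_algebra \<Rightarrow> 'a"
  where "binomial_power p x = (\<Sum>k. (p gchoose k) *\<^sub>R x ^ k)"

lemma summable_norm_binomial_power:
  fixes x :: "'a::cstar_algebra"
  assumes "norm x < 1"
  shows "summable (\<lambda>k. norm ((p gchoose k) *\<^sub>R x ^ k))"
proof -
  have "summable (\<lambda>k. norm ((p gchoose k) * norm x ^ k))"
    by (rule abs_summable_in_conv_radius)
      (use assms in \<open>auto simp: conv_radius_gchoose one_ereal_def\<close>)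
  then show ?thesis
    by (rule summable_comparison_test'[where N=0])
      (simp add: abs_mult mult_left_mono norm_power_ineq)
qed

lemma summable_binomial_power:
  fixes x :: "'a::cstar_algebra"
  assumes "norm x < 1"
  shows "summable (\<lambda>k. (p gchoose k) *\<^sub>R x ^ k)"
  by (rule summable_norm_cancel[OF summable_norm_binomial_power[OF assms]])

text \<open>
  The coefficients of a Cauchy product of two binomial series are given by Vandermonde's identity.
\<close>

lemma binomial_power_add:
  fixes x :: "'a::cstar_algebra"
  assumes "norm x < 1"
  shows "binomial_power p x * binomial_power q x = binomial_power (p + q) x"
proof -
  have "(\<Sum>i\<le>k. ((p gchoose i) *\<^sub>R x ^ i) * ((q gchoose (k - i)) *\<^sub>R x ^ (k - i))) =
      ((p + q) gchoose k) *\<^sub>R x ^ k" for k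
  proof -
    have "(\<Sum>i\<le>k. ((p gchoose i) *\<^sub>R x ^ i) * ((q gchoose (k - i)) *\<^sub>R x ^ (k - i))) =
        (\<Sum>i\<le>k. ((p gchoose i) * (q gchoose (k - i))) *\<^sub>R x ^ k)"
      by (intro sum.cong) (simp_all add: power_add[symmetric])
    also have "\<dots> = ((p + q) gchoose k) *\<^sub>R x ^ k"
      by (simp add: scaleR_left.sum[symmetric] atMost_atLeast0 gbinomial_Vandermonde)
    finally show ?thesis .
  qed
  then show ?thesis
    unfolding binomial_power_def
    by (simp add: Cauchy_product[OF summable_norm_binomial_power[OF assms]
          summable_norm_binomial_power[OF assms]])
qed

lemma binomial_power_0: "binomial_power 0 x = 1"
proof -
  have "(\<lambda>k. ((0::real) gchoose k) *\<^sub>R x ^ k) sums (\<Sum>k\<in>{0}. ((0::real) gchoose k) *\<^sub>R x ^ k)"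
  proof (rule sums_finite)
    fix n :: nat
    assume "n \<notin> {0}"
    then show "((0::real) gchoose n) *\<^sub>R x ^ n = 0" by (cases n) (simp_all add: gbinomial_0)
  qed simp
  then show ?thesis by (simp add: binomial_power_def sums_iff)
qed

lemma binomial_power_1: "binomial_power 1 x = 1 + x"
proof -
  have "(\<lambda>k. ((1::real) gchoose k) *\<^sub>R x ^ k) sums (\<Sum>k\<in>{0,1}. ((1::real) gchoose k) *\<^sub>R x ^ k)"
  proof (rule sums_finite)
    fix n :: nat
    assume "n \<notin> {0, 1}"
    then have "(of_nat 1 :: real) gchoose n = 0"
      by (subst binomial_gbinomial[symmetric]) (simp add: binomial_eq_0)
    then show "((1::real) gchoose n) *\<^sub>R x ^ n = 0" by simp
  qed simp
  then show ?thesis by (simp add: binomial_power_def sums_iff)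
qed

lemma norm_star [simp]: "norm (star x) = norm (x::'a::cstar_algebra)"
proof -
  have le: "norm y \<le> norm (star y)" for y :: 'a
  proof (cases "y = 0")
    case False
    have "norm y * norm y \<le> norm (star y) * norm y"
      using norm_star_mult[of y] norm_mult_ineq[of "star y" y] by (simp add: power2_eq_square)
    then show ?thesis using False by simp
  qed simp
  show ?thesis using le[of x] le[of "star x"] by (simp add: star_star)
qed

lemma star_one [simp]: "star 1 = (1::'a::cstar_algebra)"
  using star_mult[of "star 1" "1::'a"] by (simp add: star_star)

lemma bounded_linear_star: "bounded_linear (star :: 'a::cstar_algebra \<Rightarrow> 'a)"
  by (rule bounded_linear_intro[where K=1])
    (simp_all add: star_add scaleR_scaleC star_scaleC)

lemma star_power: "star (x ^ n) = star (x::'a::cstar_algebra) ^ n"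
  by (induction n) (simp_all add: star_mult power_commutes)

lemma star_binomial_power:
  fixes x :: "'a::cstar_algebra"
  assumes "norm x < 1" "star x = x"
  shows "star (binomial_power p x) = binomial_power p x"
  unfolding binomial_power_def
  by (subst bounded_linear.suminf[OF bounded_linear_star summable_binomial_power[OF assms(1)]])
    (simp add: linear_scale[OF bounded_linear.linear[OF bounded_linear_star]] star_power assms(2))

lemma commute_power:
  fixes z :: "'a::monoid_mult"
  shows "z * x = x * z \<Longrightarrow> z * x ^ n = x ^ n * z"
  by (induction n) (simp_all add: mult.assoc, metis mult.assoc)

lemma binomial_power_commute:
  fixes x :: "'a::cstar_algebra"
  assumes "norm x < 1" "z * x = x * z"
  shows "z * binomial_power p x = binomial_power p x * z"
  unfolding binomial_power_def
  by (simp add: suminf_mult[OF summable_binomial_power[OF assms(1)], symmetric]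
      suminf_mult2[OF summable_binomial_power[OF assms(1)]] commute_power[OF assms(2)])

lemma star_subalgebra_scaleR: "star_subalgebra B \<Longrightarrow> x \<in> B \<Longrightarrow> r *\<^sub>R x \<in> B"
  by (simp add: star_subalgebra_def scaleR_scaleC)

lemma star_subalgebra_diff:
  assumes "star_subalgebra B" "x \<in> B" "y \<in> B"
  shows "x - y \<in> B"
proof -
  have "x + (-1) *\<^sub>R y \<in> B"
    using assms star_subalgebra_scaleR[OF assms(1,3), of "-1"] unfolding star_subalgebra_def by blast
  then show ?thesis by simp
qed

lemma star_subalgebra_sum:
  assumes "star_subalgebra B" "\<And>i. i \<in> I \<Longrightarrow> f i \<in> B"
  shows "(\<Sum>i\<in>I. f i) \<in> B"
  using assms(2) by (induction I rule: infinite_finite_induct)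
    (use assms(1) in \<open>auto simp: star_subalgebra_def\<close>)

lemma binomial_power_in_subalgebra:
  assumes A: "unital_cstar_subalgebra A" and x: "x \<in> A" "norm x < 1"
  shows "binomial_power p x \<in> A"
proof -
  have A': "star_subalgebra A" "1 \<in> A" "closed A"
    using A by (simp_all add: unital_cstar_subalgebra_def)
  have "x ^ k \<in> A" for k
    by (induction k) (use A' x in \<open>auto simp: star_subalgebra_def\<close>)
  then have "(\<Sum>k<n. (p gchoose k) *\<^sub>R x ^ k) \<in> A" for n
    by (intro star_subalgebra_sum star_subalgebra_scaleR A')
  then show ?thesis
    unfolding binomial_power_def
    using closed_sequentially[OF A'(3), of "\<lambda>n. \<Sum>k<n. (p gchoose k) *\<^sub>R x ^ k"]
      summable_LIMSEQ[OF summable_binomial_power[OF x(2), of p]] by blast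
qed

section \<open>Elementary properties of states\<close>

lemma stateD:
  assumes "\<phi> \<in> state_space A"
  shows "a \<in> A \<Longrightarrow> b \<in> A \<Longrightarrow> \<phi> (a + b) = \<phi> a + \<phi> b" "a \<in> A \<Longrightarrow> \<phi> (c *\<^sub>C a) = c * \<phi> a"
    "a \<in> A \<Longrightarrow> \<phi> (star a * a) \<in> \<real>\<^sub>\<ge>\<^sub>0" "\<phi> 1 = 1"
  using assms by (auto simp: state_space_def)

lemma state_diff:
  assumes "star_subalgebra A" "\<phi> \<in> state_space A" "a \<in> A" "b \<in> A"
  shows "\<phi> (a - b) = \<phi> a - \<phi> b"
  using stateD(1)[OF assms(2) star_subalgebra_diff[OF assms(1,3,4)] assms(4)] by simp

text \<open>
  The discriminant argument behind the Cauchy-Schwarz inequality; the coefficient \<open>q\<close> may vanish.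
\<close>

lemma nonneg_quadratic_imp:
  fixes p q :: real
  assumes "\<And>t. 0 \<le> p + 2 * t * r + t\<^sup>2 * q"
  shows "r\<^sup>2 \<le> p * q"
proof (cases "q = 0")
  case True
  have "r = 0"
  proof (rule ccontr)
    assume "r \<noteq> 0"
    then show False using assms[of "- (p + 1) / (2 * r)"] True by (simp add: field_simps)
  qed
  then show ?thesis using True by simp
next
  case False
  have "0 \<le> q"
  proof (rule ccontr)
    assume "\<not> 0 \<le> q"
    then have q: "q < 0" by simp
    have "0 \<le> 2 * p + 2 * t\<^sup>2 * q" for t
      using assms[of t] assms[of "- t"] by simp
    from this[of "sqrt ((1 - p) / q)"] this[of "sqrt ((p + 1) / - q)"] this[of 0] q
    show False by (auto simp: field_simps)
  qed
  then have q: "0 < q" using False by simp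
  have "0 \<le> p - r\<^sup>2 / q"
    using assms[of "- r / q"] q by (simp add: power2_eq_square field_simps)
  then show ?thesis using q by (simp add: field_simps)
qed

text \<open>
  By the Cauchy-Schwarz inequality it suffices that \<open>\<phi>(a\<^sup>*a) \<le> s\<^sup>2\<close> whenever \<open>\<parallel>a\<parallel> < s\<close>, and this is
  positivity of \<open>\<phi>\<close> on \<open>1 - a\<^sup>*a / s\<^sup>2\<close>, which is the square of its selfadjoint binomial root.
\<close>

lemma state_norm_le:
  assumes A: "unital_cstar_subalgebra A" and \<phi>: "\<phi> \<in> state_space A" and a: "a \<in> A"
  shows "cmod (\<phi> a) \<le> norm a"
proof -
  have sub: "star_subalgebra A" and one: "1 \<in> A"
    using A by (simp_all add: unital_cstar_subalgebra_def)
  have clo: "x + y \<in> A" "x * y \<in> A" "c *\<^sub>C x \<in> A" "star x \<in> A" if "x \<in> A" "y \<in> A" for x y c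
    using sub that by (auto simp: star_subalgebra_def)
  have add: "\<phi> (x + y) = \<phi> x + \<phi> y" if "x \<in> A" "y \<in> A" for x y
    using stateD(1)[OF \<phi>] that by blast
  have sc: "\<phi> (c *\<^sub>C x) = c * \<phi> x" if "x \<in> A" for x c
    using stateD(2)[OF \<phi>] that by blast
  have pos: "0 \<le> Re (\<phi> (star x * x))" "Im (\<phi> (star x * x)) = 0" if "x \<in> A" for x
    using stateD(3)[OF \<phi> that] by (auto simp: complex_nonneg_Reals_iff)
  have expand: "\<phi> (star (1 + c *\<^sub>C a) * (1 + c *\<^sub>C a)) =
      1 + c * \<phi> a + cnj c * \<phi> (star a) + (cnj c * c) * \<phi> (star a * a)" for c
    using a one stateD(4)[OF \<phi>]
    by (simp add: star_add star_scaleC distrib_left distrib_right mult_scaleC_left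
        mult_scaleC_right scaleC_scaleC add sc clo add.assoc mult.commute)
  have im: "Im (c * \<phi> a + cnj c * \<phi> (star a)) = 0" for c
    using pos(2)[of "1 + c *\<^sub>C a"] pos(2)[OF a] clo a one unfolding expand
    by (auto simp: complex_eq_iff algebra_simps)
  have st: "\<phi> (star a) = cnj (\<phi> a)"
    using im[of 1] im[of \<i>] by (simp add: complex_eq_iff)
  define q where "q = Re (\<phi> (star a * a))"
  have \<phi>q: "\<phi> (star a * a) = of_real q" using pos[OF a] by (simp add: q_def complex_eq_iff)
  \<comment> \<open>The Cauchy-Schwarz inequality for the positive form given by the state.\<close>
  have cs: "(cmod (\<phi> a))\<^sup>2 \<le> q"
  proof (cases "\<phi> a = 0")
    case False
    \<comment> \<open>A phase that makes \<open>\<phi> a\<close> real, so that the form is tested on \<open>1 + t u a\<close> with real \<open>t\<close>.\<close>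
    define u where "u = cnj (\<phi> a) / cmod (\<phi> a)"
    have u: "u * \<phi> a = cmod (\<phi> a)" "cnj u * u = 1"
      using False by (simp_all add: u_def complex_norm_square[symmetric] power2_eq_square mult.commute)
    have "0 \<le> 1 + 2 * t * cmod (\<phi> a) + t\<^sup>2 * q" for t :: real
    proof -
      have "0 \<le> Re (1 + (t * u) * \<phi> a + cnj (t * u) * \<phi> (star a)
          + (cnj (t * u) * (t * u)) * \<phi> (star a * a))"
        using pos(1)[of "1 + (t * u) *\<^sub>C a"] clo a one unfolding expand[symmetric] by blast
      also have "\<dots> = 1 + 2 * t * cmod (\<phi> a) + t\<^sup>2 * q"
      proof -
        have 1: "(t * u) * \<phi> a = t * cmod (\<phi> a)" using u by (simp add: mult.assoc)
        have 2: "cnj (t * u) * cnj (\<phi> a) = t * cmod (\<phi> a)"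
          using arg_cong[OF u(1), of cnj] by (simp add: mult.assoc)
        have 3: "cnj (t * u) * (t * u) = complex_of_real (t\<^sup>2)"
          using u(2) by (simp add: power2_eq_square mult.assoc mult.left_commute)
        show ?thesis unfolding st \<phi>q 1 2 3 by simp
      qed
      finally show ?thesis .
    qed
    then show ?thesis using nonneg_quadratic_imp[of 1 "cmod (\<phi> a)" q] by simp
  qed (use pos(1)[OF a] in \<open>simp add: q_def\<close>)
  have "(cmod (\<phi> a))\<^sup>2 \<le> s * s" if s: "norm a < s" for s
  proof -
    have s0: "0 < s" using s norm_ge_zero[of a] by linarith
    define h where "h = - (1 / (s * s)) *\<^sub>R (star a * a)"
    have "norm h = (norm a)\<^sup>2 / (s * s)" using s0 by (simp add: h_def norm_star_mult)
    also have "\<dots> < 1" using s s0 by (simp add: power2_eq_square mult_strict_mono)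
    finally have h1: "norm h < 1" .
    have hA: "h \<in> A" using a clo by (simp add: h_def scaleR_scaleC)
    have hs: "star h = h"
      by (simp add: h_def linear_scale[OF bounded_linear.linear[OF bounded_linear_star]]
          star_mult star_star linear_neg[OF bounded_linear.linear[OF bounded_linear_star]])
    define b where "b = binomial_power (1/2) h"
    have bA: "b \<in> A" unfolding b_def by (rule binomial_power_in_subalgebra[OF A hA h1])
    have "star b * b = 1 + h"
      unfolding b_def star_binomial_power[OF h1 hs] binomial_power_add[OF h1]
      by (simp add: binomial_power_1)
    then have "0 \<le> Re (\<phi> (1 + h))" using pos(1)[OF bA] by simp
    moreover have "h = complex_of_real (- (1 / (s * s))) *\<^sub>C (star a * a)"
      unfolding h_def by (rule scaleR_scaleC)
    then have "\<phi> (1 + h) = 1 - complex_of_real (1 / (s * s)) * q"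
      using add[OF one hA] sc[of "star a * a"] stateD(4)[OF \<phi>] a clo \<phi>q by simp
    ultimately have "0 \<le> 1 - q / (s * s)" by simp
    then have "q \<le> s * s" using s0 by (simp add: field_simps)
    then show ?thesis using cs by linarith
  qed
  then have "cmod (\<phi> a) \<le> s" if "norm a < s" for s
    using that norm_ge_zero[of a]
    by (metis abs_of_nonneg less_eq_real_def order_trans power2_eq_square power2_le_imp_le)
  then show ?thesis by (rule dense_ge)
qed

section \<open>Total boundedness\<close>

lemma totally_bounded_iff:
  fixes S :: "'a::metric_space set"
  shows "totally_bounded S \<longleftrightarrow> (\<forall>e>0. \<exists>Z. finite Z \<and> (\<forall>x\<in>S. \<exists>z\<in>Z. dist x z < e))"
proof -
  have "S \<subseteq> (\<Union>x\<in>k. {y. dist x y < e}) \<longleftrightarrow> (\<forall>x\<in>S. \<exists>z\<in>k. dist x z < e)" for k e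
    by (simp add: subset_iff Ball_def dist_commute)
  then show ?thesis unfolding totally_bounded_metric by simp
qed

lemma totally_boundedE:
  fixes S :: "'a::metric_space set"
  assumes "totally_bounded S" "0 < e"
  obtains Z where "finite Z" "\<And>x. x \<in> S \<Longrightarrow> \<exists>z\<in>Z. dist x z < e"
proof -
  have "\<exists>Z. finite Z \<and> (\<forall>x\<in>S. \<exists>z\<in>Z. dist x z < e)"
    using assms(1)[unfolded totally_bounded_iff, rule_format, OF assms(2)] .
  then obtain Z where "finite Z" "\<forall>x\<in>S. \<exists>z\<in>Z. dist x z < e" by (elim exE conjE)
  then show ?thesis by (intro that[of Z]) simp_all
qed

lemma totally_bounded_if_bounded:
  fixes S :: "'a::heine_borel set"
  assumes "bounded S"
  shows "totally_bounded S"
proof -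
  have "compact (closure S)" using assms by simp
  then have cover: "\<exists>k. finite k \<and> closure S \<subseteq> (\<Union>x\<in>k. ball x e)" if "0 < e" for e
    using that unfolding compact_eq_totally_bounded by blast
  show ?thesis
    unfolding totally_bounded_metric
  proof (intro allI impI)
    fix e :: real
    assume "0 < e"
    then obtain k where "finite k" "closure S \<subseteq> (\<Union>x\<in>k. ball x e)" using cover by blast
    then show "\<exists>k. finite k \<and> S \<subseteq> (\<Union>x\<in>k. {y. dist x y < e})"
      using closure_subset[of S] by (intro exI[of _ k]) (auto simp: ball_def)
  qed
qed

lemma totally_bounded_add:
  fixes S T :: "'a::real_normed_vector set"
  assumes "totally_bounded S" "totally_bounded T"
  shows "totally_bounded {x + y |x y. x \<in> S \<and> y \<in> T}"
  unfolding totally_bounded_iff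
proof (intro allI impI)
  fix e :: real
  assume e: "0 < e"
  then have e2: "0 < e / 2" by simp
  obtain Z where Z: "finite Z" "\<And>x. x \<in> S \<Longrightarrow> \<exists>z\<in>Z. dist x z < e / 2"
    by (rule totally_boundedE[OF assms(1) e2]) (rule that)
  obtain W where W: "finite W" "\<And>x. x \<in> T \<Longrightarrow> \<exists>z\<in>W. dist x z < e / 2"
    by (rule totally_boundedE[OF assms(2) e2]) (rule that)
  let ?N = "(\<lambda>(z, w). z + w) ` (Z \<times> W)"
  have near: "\<exists>z\<in>?N. dist (x + y) z < e" if "x \<in> S" "y \<in> T" for x y
  proof -
    obtain z w where "z \<in> Z" "dist x z < e / 2" "w \<in> W" "dist y w < e / 2"
      using Z W \<open>x \<in> S\<close> \<open>y \<in> T\<close> by blast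
    then have "dist (x + y) (z + w) < e" using dist_triangle_add[of x y z w] by linarith
    moreover have "z + w \<in> ?N"
      using \<open>z \<in> Z\<close> \<open>w \<in> W\<close> by (intro image_eqI[of _ _ "(z, w)"]) simp_all
    ultimately show ?thesis by blast
  qed
  show "\<exists>Z. finite Z \<and> (\<forall>x\<in>{x + y |x y. x \<in> S \<and> y \<in> T}. \<exists>z\<in>Z. dist x z < e)"
  proof (intro exI conjI ballI)
    show "finite ?N" using Z(1) W(1) by simp
    fix v
    assume "v \<in> {x + y |x y. x \<in> S \<and> y \<in> T}"
    then obtain x y where "v = x + y" "x \<in> S" "y \<in> T" by blast
    then show "\<exists>z\<in>?N. dist v z < e" using near by simp
  qed
qed

lemma totally_bounded_lipschitz_image:
  fixes f :: "'a::metric_space \<Rightarrow> 'b::metric_space"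
  assumes "totally_bounded S" "\<And>x y. dist (f x) (f y) \<le> k * dist x y"
  shows "totally_bounded (f ` S)"
  unfolding totally_bounded_iff
proof (intro allI impI)
  fix e :: real
  assume e: "0 < e"
  have k: "0 < \<bar>k\<bar> + 1" by simp
  have "0 < e / (\<bar>k\<bar> + 1)" using e k by simp
  then obtain Z where Z: "finite Z" "\<And>x. x \<in> S \<Longrightarrow> \<exists>z\<in>Z. dist x z < e / (\<bar>k\<bar> + 1)"
    by (rule totally_boundedE[OF assms(1)]) (rule that)
  have "\<exists>z\<in>f ` Z. dist (f x) z < e" if x: "x \<in> S" for x
  proof -
    obtain z where z: "z \<in> Z" "dist x z < e / (\<bar>k\<bar> + 1)" using Z(2)[OF x] by blast
    have "dist (f x) (f z) \<le> (\<bar>k\<bar> + 1) * dist x z"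
      using assms(2)[of x z] mult_right_mono[of k "\<bar>k\<bar> + 1" "dist x z"] abs_ge_self[of k]
      by simp
    also have "\<dots> < e" using z(2) k by (simp add: field_simps)
    finally show ?thesis using z(1) by blast
  qed
  then have "\<forall>y\<in>f ` S. \<exists>z\<in>f ` Z. dist y z < e" by simp
  moreover have "finite (f ` Z)" using Z(1) by simp
  ultimately show "\<exists>Z. finite Z \<and> (\<forall>x\<in>f ` S. \<exists>z\<in>Z. dist x z < e)" by blast
qed

text \<open>
  Each point is coded by close net points of its finitely many images.  There are finitely many codes,
  and keeping one point of \<open>B\<close> for each of them gives a net inside \<open>B\<close> that works for all maps at once.
\<close>

lemma simultaneous_finite_net:
  fixes f :: "'i \<Rightarrow> 'b \<Rightarrow> 'm::metric_space"
  assumes I: "finite I" and tb: "\<And>i. i \<in> I \<Longrightarrow> totally_bounded (f i ` B)" and e: "0 < e"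
  shows "\<exists>F. finite F \<and> F \<subseteq> B \<and> (\<forall>a\<in>B. \<exists>b\<in>F. \<forall>i\<in>I. dist (f i a) (f i b) < e)"
proof -
  have "\<exists>Z. finite Z \<and> (\<forall>a\<in>B. \<exists>z\<in>Z. dist (f i a) z < e / 2)" if i: "i \<in> I" for i
  proof -
    have "0 < e / 2" using e by simp
    then have "\<exists>Z. finite Z \<and> (\<forall>y\<in>f i ` B. \<exists>z\<in>Z. dist y z < e / 2)"
      by (rule tb[OF i, unfolded totally_bounded_iff, rule_format])
    then show ?thesis by simp
  qed
  then obtain Z where Z: "\<And>i. i \<in> I \<Longrightarrow> finite (Z i)"
    "\<And>i a. i \<in> I \<Longrightarrow> a \<in> B \<Longrightarrow> \<exists>z\<in>Z i. dist (f i a) z < e / 2"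
    by metis
  \<comment> \<open>Two points with the same code of nearest net points are close in every coordinate.\<close>
  define code where "code a = (\<lambda>i\<in>I. SOME z. z \<in> Z i \<and> dist (f i a) z < e / 2)" for a
  have code: "code a i \<in> Z i \<and> dist (f i a) (code a i) < e / 2" if "i \<in> I" "a \<in> B" for a i
    unfolding code_def using someI_ex[of "\<lambda>z. z \<in> Z i \<and> dist (f i a) z < e / 2"] Z(2)[OF that] that
    by auto
  have "code ` B \<subseteq> Pi\<^sub>E I Z" using code by (auto simp: code_def)
  then have "finite (code ` B)" using finite_PiE[OF I] Z(1) finite_subset by blast
  then obtain F where F: "F \<subseteq> B" "finite F" "code ` B = code ` F"
    using finite_subset_image[of "code ` B" code B] by auto
  have "\<exists>b\<in>F. \<forall>i\<in>I. dist (f i a) (f i b) < e" if a: "a \<in> B" for a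
  proof -
    obtain b where b: "b \<in> F" "code a = code b" using F(3) a by (metis (no_types, lifting) imageE imageI)
    have "dist (f i a) (f i b) < e" if i: "i \<in> I" for i
      using code[OF i a] code[OF i, of b] b F(1)
        dist_triangle_half_r[of "code a i" "f i a" e "f i b"] by (auto simp: dist_commute)
    then show ?thesis using b by blast
  qed
  then show ?thesis using F(1,2) by (intro exI[of _ F]) simp
qed

section \<open>Rieffel's criterion for Lip-metrics\<close>

text \<open>
  A scalar added to \<open>a\<close> cancels in \<open>\<phi> a - \<psi> a\<close>, so that only the distance of \<open>a\<close> and \<open>b\<close> modulo
  scalars matters.
\<close>

lemma state_norm_diff_le:
  assumes A: "unital_cstar_subalgebra A" and "\<phi> \<in> state_space A" "\<psi> \<in> state_space A"
    "a \<in> A" "b \<in> A"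
  shows "cmod (\<phi> a - \<psi> a) \<le> cmod (\<phi> b - \<psi> b) + 2 * norm (a - b - c *\<^sub>C 1)"
proof -
  have sub: "star_subalgebra A" "1 \<in> A" using A by (simp_all add: unital_cstar_subalgebra_def)
  have cA: "c *\<^sub>C 1 \<in> A" and abA: "a - b \<in> A"
    using sub assms star_subalgebra_diff[OF sub(1)] unfolding star_subalgebra_def by blast+
  have "a - b - c *\<^sub>C 1 \<in> A" by (rule star_subalgebra_diff[OF sub(1) abA cA])
  moreover have "\<rho> (a - b - c *\<^sub>C 1) = \<rho> a - \<rho> b - c" if "\<rho> \<in> state_space A" for \<rho>
    using that sub assms cA abA by (simp add: state_diff stateD(2,4))
  ultimately have "cmod (\<phi> a - \<phi> b - c) \<le> norm (a - b - c *\<^sub>C 1)"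
    "cmod (\<psi> a - \<psi> b - c) \<le> norm (a - b - c *\<^sub>C 1)"
    using state_norm_le[OF A, of _ "a - b - c *\<^sub>C 1"] assms(2,3) by metis+
  moreover have "\<phi> a - \<psi> a = (\<phi> b - \<psi> b) + ((\<phi> a - \<phi> b - c) - (\<psi> a - \<psi> b - c))" by simp
  ultimately show ?thesis
    using norm_triangle_ineq[of "\<phi> b - \<psi> b" "(\<phi> a - \<phi> b - c) - (\<psi> a - \<psi> b - c)"]
      norm_triangle_ineq4[of "\<phi> a - \<phi> b - c" "\<psi> a - \<psi> b - c"] by simp
qed

text \<open>
  Total boundedness of the image of \<open>B\<close> in the quotient by the scalars.
\<close>

definition totally_bounded_mod_scalars :: "'a::cstar_algebra set \<Rightarrow> bool"
  where "totally_bounded_mod_scalars B \<longleftrightarrow>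
    (\<forall>e>0. \<exists>F. finite F \<and> F \<subseteq> B \<and> (\<forall>a\<in>B. \<exists>b\<in>F. \<exists>c. norm (a - b - c *\<^sub>C 1) < e))"

lemma state_dist_ge:
  assumes "state_dist \<A> L \<phi> \<psi> < \<infinity>" "a \<in> \<A>" "L a \<le> 1"
  shows "cmod (\<phi> a - \<psi> a) \<le> enn2real (state_dist \<A> L \<phi> \<psi>)"
proof -
  have "ennreal (cmod (\<phi> a - \<psi> a)) \<le> state_dist \<A> L \<phi> \<psi>"
    unfolding state_dist_def using assms(2,3) by (intro SUP_upper) simp
  also have "\<dots> = ennreal (enn2real (state_dist \<A> L \<phi> \<psi>))"
    using assms(1) by (simp add: infinity_ennreal_def)
  finally show ?thesis by simp
qed

lemma continuous_map_weak_star: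
  "a \<in> A \<Longrightarrow> continuous_map (weak_star_topology A) euclidean (\<lambda>\<phi>. \<phi> a)"
  unfolding weak_star_topology_def
  by (intro continuous_map_from_subtopology continuous_map_product_projection)

lemma topspace_weak_star [simp]: "topspace (weak_star_topology A) = state_space A"
  by (auto simp: weak_star_topology_def state_space_def PiE_def)

text \<open>
  The sufficient half of Rieffel's criterion.  A finite net modulo scalars of the unit ball of \<open>L\<close> controls
  the distance of two states by finitely many of their values: distances are finite, and balls of
  states contain weak-* neighbourhoods of their points.  Conversely, evaluations are continuous for the
  metric, as every element is a limit of multiples of elements of the unit ball.
\<close>

lemma lip_metricI:
  fixes \<A> :: "'a::cstar_algebra set"
  assumes A: "unital_cstar_subalgebra A" and sub: "\<A> \<subseteq> A" and dense: "A \<subseteq> closure \<A>"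
    and absorb: "\<And>a. a \<in> \<A> \<Longrightarrow> \<exists>k>0. k *\<^sub>R a \<in> \<A> \<and> L (k *\<^sub>R a) \<le> 1"
    and tb: "totally_bounded_mod_scalars {a\<in>\<A>. L a \<le> 1}"
  shows "lip_metric A \<A> L"
proof -
  define B where "B = {a\<in>\<A>. L a \<le> 1}"
  define S where "S = state_space A"
  define d where "d \<phi> \<psi> = enn2real (state_dist \<A> L \<phi> \<psi>)" for \<phi> \<psi>
  have ext: "S \<subseteq> extensional A" by (auto simp: S_def state_space_def)
  have BA: "B \<subseteq> A" using sub by (auto simp: B_def)
  have net: "\<exists>F. finite F \<and> F \<subseteq> B \<and> (\<forall>a\<in>B. \<exists>b\<in>F. \<exists>c. norm (a - b - c *\<^sub>C 1) < e)"
    if "0 < e" for e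
    by (rule tb[unfolded totally_bounded_mod_scalars_def, folded B_def, rule_format, OF that])
  have dist_le: "state_dist \<A> L \<phi> \<psi> \<le> ennreal r"
    if "\<And>a. a \<in> B \<Longrightarrow> cmod (\<phi> a - \<psi> a) \<le> r" for \<phi> \<psi> r
    unfolding state_dist_def using that by (intro SUP_least ennreal_leI) (auto simp: B_def)
  have fin: "state_dist \<A> L \<phi> \<psi> < \<infinity>" if \<phi>: "\<phi> \<in> S" and \<psi>: "\<psi> \<in> S" for \<phi> \<psi>
  proof -
    obtain F where F: "finite F" "F \<subseteq> B" "\<forall>a\<in>B. \<exists>b\<in>F. \<exists>c. norm (a - b - c *\<^sub>C 1) < 1"
      using net[OF zero_less_one] by (elim exE conjE)
    have "cmod (\<phi> a - \<psi> a) \<le> (\<Sum>b\<in>F. cmod (\<phi> b - \<psi> b)) + 2" if a: "a \<in> B" for a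
    proof -
      obtain b c where b: "b \<in> F" "norm (a - b - c *\<^sub>C 1) < 1" using F(3) a by blast
      have "cmod (\<phi> a - \<psi> a) \<le> cmod (\<phi> b - \<psi> b) + 2"
        using state_norm_diff_le[OF A, of \<phi> \<psi> a b c] \<phi> \<psi> a b BA F(2) unfolding S_def by force
      then show ?thesis
        using member_le_sum[OF b(1), of "\<lambda>b. cmod (\<phi> b - \<psi> b)"] F(1) by simp
    qed
    then have "state_dist \<A> L \<phi> \<psi> \<le> ennreal ((\<Sum>b\<in>F. cmod (\<phi> b - \<psi> b)) + 2)"
      by (rule dist_le)
    also have "\<dots> < \<infinity>" unfolding infinity_ennreal_def by (rule ennreal_less_top)
    finally show ?thesis .
  qed
  have dist_d: "state_dist \<A> L \<phi> \<psi> = ennreal (d \<phi> \<psi>)" if "\<phi> \<in> S" "\<psi> \<in> S" for \<phi> \<psi>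
    using fin[OF that] by (simp add: d_def infinity_ennreal_def)
  have d_ge: "cmod (\<phi> a - \<psi> a) \<le> d \<phi> \<psi>" if "\<phi> \<in> S" "\<psi> \<in> S" "a \<in> B" for \<phi> \<psi> a
    using state_dist_ge[where L=L, OF fin[OF that(1,2)]] that(3) by (simp add: d_def B_def)
  have d_le: "d \<phi> \<psi> \<le> r" if "\<phi> \<in> S" "\<psi> \<in> S" "0 \<le> r" "\<And>a. a \<in> B \<Longrightarrow> cmod (\<phi> a - \<psi> a) \<le> r"
    for \<phi> \<psi> r
  proof -
    have "state_dist \<A> L \<phi> \<psi> \<le> ennreal r" using that(4) by (rule dist_le)
    then show ?thesis unfolding dist_d[OF that(1,2)] by (simp add: ennreal_le_iff that(3))
  qed
  have separated: "\<exists>r>0. \<forall>\<psi>\<in>S. d \<phi> \<psi> < r \<longrightarrow> cmod (\<phi> a - \<psi> a) < e"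
    if \<phi>: "\<phi> \<in> S" and a: "a \<in> A" and e: "0 < e" for \<phi> a e
  proof -
    obtain a' where a': "a' \<in> \<A>" "norm (a - a') < e / 4"
      using dense a e closure_approachable[of a \<A>]
      by (metis subsetD dist_commute dist_norm divide_pos_pos zero_less_numeral)
    obtain k where k: "0 < k" "k *\<^sub>R a' \<in> B" using absorb[OF a'(1)] by (auto simp: B_def)
    have "cmod (\<phi> a - \<psi> a) < e" if \<psi>: "\<psi> \<in> S" and lt: "d \<phi> \<psi> < k * (e / 2)" for \<psi>
    proof -
      have scale: "\<rho> (k *\<^sub>R a') = complex_of_real k * \<rho> a'" if "\<rho> \<in> S" for \<rho>
        using that a'(1) sub by (auto simp: S_def scaleR_scaleC stateD(2))
      have "\<phi> (k *\<^sub>R a') - \<psi> (k *\<^sub>R a') = complex_of_real k * (\<phi> a' - \<psi> a')"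
        unfolding right_diff_distrib using scale[OF \<phi>] scale[OF \<psi>] by simp
      then have "k * cmod (\<phi> a' - \<psi> a') = cmod (\<phi> (k *\<^sub>R a') - \<psi> (k *\<^sub>R a'))"
        using k(1) by (simp add: norm_mult)
      also have "\<dots> \<le> d \<phi> \<psi>" by (rule d_ge[OF \<phi> \<psi> k(2)])
      also have "\<dots> < k * (e / 2)" by (rule lt)
      finally have "k * cmod (\<phi> a' - \<psi> a') < k * (e / 2)" .
      then have "cmod (\<phi> a' - \<psi> a') < e / 2" using k(1) mult_less_cancel_left_pos by blast
      then show ?thesis
        using state_norm_diff_le[OF A, of \<phi> \<psi> a a' 0] \<phi> \<psi> a a' sub unfolding S_def by force
    qed
    then show ?thesis using k(1) e by (intro exI[of _ "k * (e / 2)"]) auto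
  qed
  interpret Metric_space S d
  proof
    show "0 \<le> d \<phi> \<psi>" for \<phi> \<psi> by (simp add: d_def)
    show "d \<phi> \<psi> = d \<psi> \<phi>" for \<phi> \<psi> by (simp add: d_def state_dist_def norm_minus_commute)
    show "d \<phi> \<psi> = 0 \<longleftrightarrow> \<phi> = \<psi>" if \<phi>: "\<phi> \<in> S" and \<psi>: "\<psi> \<in> S" for \<phi> \<psi>
    proof
      assume 0: "d \<phi> \<psi> = 0"
      have "\<phi> a = \<psi> a" if a: "a \<in> A" for a
      proof (rule ccontr)
        assume "\<phi> a \<noteq> \<psi> a"
        then show False using separated[OF \<phi> a, of "cmod (\<phi> a - \<psi> a)"] \<psi> 0 by auto
      qed
      then show "\<phi> = \<psi>"
        using \<phi> \<psi> unfolding S_def state_space_def by (auto intro: extensionalityI)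
    next
      assume "\<phi> = \<psi>"
      then have "d \<phi> \<psi> \<le> 0" using \<phi> \<psi> by (intro d_le) auto
      moreover have "0 \<le> d \<phi> \<psi>" by (simp add: d_def)
      ultimately show "d \<phi> \<psi> = 0" by linarith
    qed
    show "d \<phi> \<rho> \<le> d \<phi> \<psi> + d \<psi> \<rho>" if "\<phi> \<in> S" "\<psi> \<in> S" "\<rho> \<in> S" for \<phi> \<psi> \<rho>
    proof (rule d_le[OF that(1,3)])
      show "cmod (\<phi> a - \<rho> a) \<le> d \<phi> \<psi> + d \<psi> \<rho>" if a: "a \<in> B" for a
        using d_ge[OF \<open>\<phi> \<in> S\<close> \<open>\<psi> \<in> S\<close> a] d_ge[OF \<open>\<psi> \<in> S\<close> \<open>\<rho> \<in> S\<close> a]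
          norm_triangle_ineq[of "\<phi> a - \<psi> a" "\<psi> a - \<rho> a"] by simp
    qed (simp add: d_def)
  qed
  have "openin mtopology U" if U: "openin (weak_star_topology A) U" for U
  proof -
    have "continuous_map mtopology euclidean (\<lambda>\<phi>. \<phi> a)" if a: "a \<in> A" for a
      unfolding continuous_map_def
    proof (intro conjI allI impI)
      fix V :: "complex set"
      assume "openin euclidean V"
      then have V: "open V" by simp
      show "openin mtopology {\<phi> \<in> topspace mtopology. \<phi> a \<in> V}"
        unfolding openin_mtopology
      proof (intro conjI allI impI)
        fix \<phi>
        assume "\<phi> \<in> {\<phi> \<in> topspace mtopology. \<phi> a \<in> V}"
        then have \<phi>: "\<phi> \<in> S" "\<phi> a \<in> V" by auto
        obtain e where e: "0 < e" "ball (\<phi> a) e \<subseteq> V" using V \<phi>(2) openE by blast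
        obtain r where "0 < r" "\<forall>\<psi>\<in>S. d \<phi> \<psi> < r \<longrightarrow> cmod (\<phi> a - \<psi> a) < e"
          using separated[OF \<phi>(1) a e(1)] by blast
        then show "\<exists>r>0. mball \<phi> r \<subseteq> {\<phi> \<in> topspace mtopology. \<phi> a \<in> V}"
          using e(2) by (intro exI[of _ r]) (auto simp: subset_iff dist_norm)
      qed auto
    qed simp
    then have "continuous_map mtopology (weak_star_topology A) (\<lambda>\<phi>. \<phi>)"
      unfolding weak_star_topology_def continuous_map_in_subtopology continuous_map_componentwise
      using ext by (auto simp flip: S_def)
    from openin_continuous_map_preimage[OF this U] show ?thesis
      using openin_subset[OF U] by (simp add: Collect_conj_eq Int_absorb1 flip: S_def)
  qed
  moreover have "openin (weak_star_topology A) U" if U: "openin mtopology U" for U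
    unfolding openin_subopen[of _ U]
  proof
    fix \<phi>
    assume \<phi>U: "\<phi> \<in> U"
    then obtain r where r: "0 < r" "mball \<phi> r \<subseteq> U" using U unfolding openin_mtopology by blast
    have \<phi>: "\<phi> \<in> S" using U \<phi>U unfolding openin_mtopology by blast
    have r8: "0 < r / 8" using r(1) by simp
    obtain F where F: "finite F" "F \<subseteq> B"
      "\<forall>a\<in>B. \<exists>b\<in>F. \<exists>c. norm (a - b - c *\<^sub>C 1) < r / 8"
      using net[OF r8] by (elim exE conjE)
    define T where "T = S \<inter> (\<Inter>b\<in>F. {\<psi>\<in>topspace (weak_star_topology A). \<psi> b \<in> ball (\<phi> b) (r / 4)})"
    have "openin (weak_star_topology A) T"
      unfolding T_def
    proof (cases "F = {}")
      case False
      then have "openin (weak_star_topology A)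
          (\<Inter>b\<in>F. {\<psi>\<in>topspace (weak_star_topology A). \<psi> b \<in> ball (\<phi> b) (r / 4)})"
        using F(1,2) BA
        by (intro openin_INT2 openin_continuous_map_preimage[OF continuous_map_weak_star]) auto
      then show "openin (weak_star_topology A)
          (S \<inter> (\<Inter>b\<in>F. {\<psi>\<in>topspace (weak_star_topology A). \<psi> b \<in> ball (\<phi> b) (r / 4)}))"
        using openin_topspace[of "weak_star_topology A"] by (simp add: S_def openin_Int)
    qed (use openin_topspace[of "weak_star_topology A"] in \<open>simp add: S_def\<close>)
    moreover have "\<phi> \<in> T" using \<phi> r(1) by (simp add: T_def S_def)
    moreover have "T \<subseteq> mball \<phi> r"
    proof
      fix \<psi>
      assume \<psi>T: "\<psi> \<in> T"
      then have \<psi>: "\<psi> \<in> S" by (simp add: T_def)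
      have "d \<phi> \<psi> \<le> r / 2"
      proof (rule d_le[OF \<phi> \<psi>])
        fix a
        assume a: "a \<in> B"
        then obtain b c where b: "b \<in> F" "norm (a - b - c *\<^sub>C 1) < r / 8" using F(3) by blast
        have "cmod (\<phi> b - \<psi> b) < r / 4" using \<psi>T b(1) by (auto simp: T_def dist_norm)
        then show "cmod (\<phi> a - \<psi> a) \<le> r / 2"
          using state_norm_diff_le[OF A, of \<phi> \<psi> a b c] \<phi> \<psi> a b BA F(2) unfolding S_def by force
      qed (use r(1) in simp)
      then show "\<psi> \<in> mball \<phi> r" using \<phi> \<psi> r(1) by simp
    qed
    ultimately show "\<exists>T. openin (weak_star_topology A) T \<and> \<phi> \<in> T \<and> T \<subseteq> U" using r(2) by blast
  qed
  ultimately have "mtopology = weak_star_topology A" by (auto simp: topology_eq)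
  moreover have "(\<lambda>\<phi> \<psi>. enn2real (state_dist \<A> L \<phi> \<psi>)) = d" by (simp add: d_def fun_eq_iff)
  ultimately show ?thesis
    unfolding lip_metric_def S_def[symmetric] using fin Metric_space_axioms by simp
qed

text \<open>
  The Banach-Alaoglu theorem for states: they form a closed subset of a product of discs.
\<close>

lemma compact_space_weak_star:
  assumes A: "unital_cstar_subalgebra A"
  shows "compact_space (weak_star_topology A)"
proof -
  let ?X = "product_topology (\<lambda>_. euclidean :: complex topology) A"
  have sub: "star_subalgebra A" "1 \<in> A" using A by (simp_all add: unital_cstar_subalgebra_def)
  have cont: "continuous_map ?X euclidean (\<lambda>\<phi>. \<phi> a)" if "a \<in> A" for a
    using that by (rule continuous_map_product_projection)
  have cont_mult: "continuous_map ?X euclidean (\<lambda>\<phi>. c * \<phi> a)" if "a \<in> A" for a c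
    using continuous_map_compose[OF cont[OF that], of euclidean "\<lambda>z. c * z"]
    by (simp add: o_def continuous_on_mult_left)
  have closed: "closedin ?X {\<phi> \<in> topspace ?X. f \<phi> \<in> C}"
    if "continuous_map ?X euclidean f" "closed C" for f :: "_ \<Rightarrow> complex" and C
    by (rule closedin_continuous_map_preimage[OF that(1)]) (simp add: that(2))
  have "state_space A = topspace ?X \<inter>
      (\<Inter>a\<in>A. \<Inter>b\<in>A. {\<phi> \<in> topspace ?X. \<phi> (a + b) - (\<phi> a + \<phi> b) \<in> {0}}) \<inter>
      (\<Inter>c. \<Inter>a\<in>A. {\<phi> \<in> topspace ?X. \<phi> (c *\<^sub>C a) - c * \<phi> a \<in> {0}}) \<inter>
      (\<Inter>a\<in>A. {\<phi> \<in> topspace ?X. \<phi> (star a * a) \<in> \<real>\<^sub>\<ge>\<^sub>0}) \<inter>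
      {\<phi> \<in> topspace ?X. \<phi> 1 - 1 \<in> {0}}"
    using sub by (auto simp: state_space_def PiE_def)
  also have "closedin ?X \<dots>"
    using sub
    by (intro closedin_Int closedin_INT closed continuous_intros cont cont_mult closedin_topspace
        closed_nonneg_Reals_complex)
      (auto simp: star_subalgebra_def)
  finally have "closedin ?X (state_space A)" .
  moreover have "state_space A \<subseteq> Pi\<^sub>E A (\<lambda>a. cball 0 (norm a))"
    using state_norm_le[OF A] by (auto simp: state_space_def PiE_def Pi_def)
  moreover have "compactin ?X (Pi\<^sub>E A (\<lambda>a. cball 0 (norm a)))"
    by (simp add: compactin_PiE)
  ultimately show ?thesis
    unfolding weak_star_topology_def by (intro compact_space_subtopology) (rule closed_compactin)
qed

text \<open>
  The necessary half of Rieffel's criterion, with the supremum over all states in place of the norm.  The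
  state space is a compact metric space, on which the elements of the unit ball of \<open>L\<close>, normalized to
  vanish at \<open>\<omega>\<close>, are bounded \<open>1\<close>-Lipschitz functions.  As in the theorem of Arzela and Ascoli, such
  functions are determined up to a small error by their values on a finite net of states.
\<close>

lemma lip_metric_imp_net:
  fixes \<A> :: "'a::cstar_algebra set"
  assumes A: "unital_cstar_subalgebra A" and lip: "lip_metric A \<A> L"
    and \<omega>: "\<omega> \<in> state_space A" and e: "0 < e"
  shows "\<exists>F. finite F \<and> F \<subseteq> {a\<in>\<A>. L a \<le> 1} \<and> (\<forall>a\<in>{a\<in>\<A>. L a \<le> 1}.
      \<exists>b\<in>F. \<forall>\<phi>\<in>state_space A. cmod (\<phi> a - \<omega> a - (\<phi> b - \<omega> b)) < e)"
proof -
  define B where "B = {a\<in>\<A>. L a \<le> 1}"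
  define S where "S = state_space A"
  define d where "d \<phi> \<psi> = enn2real (state_dist \<A> L \<phi> \<psi>)" for \<phi> \<psi>
  interpret Metric_space S d
    using lip unfolding lip_metric_def S_def d_def by blast
  have "mtopology = weak_star_topology A"
    using lip unfolding lip_metric_def S_def d_def by blast
  then have "compact_space mtopology" using compact_space_weak_star[OF A] by simp
  then have "mtotally_bounded S"
    by (intro compactin_imp_mtotally_bounded) (simp add: compact_space_def)
  then obtain K where K: "finite K" "K \<subseteq> S" "S \<subseteq> (\<Union>x\<in>K. mball x (e / 4))"
    using e unfolding mtotally_bounded_def by (elim allE[of _ "e / 4"]) auto
  have d_ge: "cmod (\<phi> a - \<psi> a) \<le> d \<phi> \<psi>" if "\<phi> \<in> S" "\<psi> \<in> S" "a \<in> B" for \<phi> \<psi> a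
  proof -
    have "state_dist \<A> L \<phi> \<psi> < \<infinity>" using lip that unfolding lip_metric_def S_def by blast
    from state_dist_ge[where L=L, OF this] show ?thesis using that(3) by (simp add: d_def B_def)
  qed
  have "totally_bounded ((\<lambda>a. \<phi> a - \<omega> a) ` B)" if "\<phi> \<in> K" for \<phi>
    using that K(2) \<omega> d_ge
    by (intro totally_bounded_if_bounded boundedI[where B="d \<phi> \<omega>"]) (auto simp: S_def)
  then have "\<exists>F. finite F \<and> F \<subseteq> B \<and>
      (\<forall>a\<in>B. \<exists>b\<in>F. \<forall>\<phi>\<in>K. dist (\<phi> a - \<omega> a) (\<phi> b - \<omega> b) < e / 4)"
    using e by (intro simultaneous_finite_net[OF K(1)]) auto
  then obtain F where F: "finite F" "F \<subseteq> B"
    "\<forall>a\<in>B. \<exists>b\<in>F. \<forall>\<phi>\<in>K. dist (\<phi> a - \<omega> a) (\<phi> b - \<omega> b) < e / 4"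
    by (elim exE conjE)
  have "\<exists>b\<in>F. \<forall>\<phi>\<in>S. cmod (\<phi> a - \<omega> a - (\<phi> b - \<omega> b)) < e" if a: "a \<in> B" for a
  proof -
    obtain b where b: "b \<in> F" "\<forall>\<phi>\<in>K. dist (\<phi> a - \<omega> a) (\<phi> b - \<omega> b) < e / 4"
      using F(3) a by blast
    have "cmod (\<phi> a - \<omega> a - (\<phi> b - \<omega> b)) < e" if \<phi>: "\<phi> \<in> S" for \<phi>
    proof -
      obtain \<psi> where \<psi>: "\<psi> \<in> K" "d \<psi> \<phi> < e / 4" using K(3) \<phi> by auto
      have "\<psi> \<in> S" using \<psi>(1) K(2) by blast
      have "cmod (\<psi> a - \<phi> a) < e / 4" "cmod (\<psi> b - \<phi> b) < e / 4"
        using d_ge[OF \<open>\<psi> \<in> S\<close> \<phi> a] d_ge[OF \<open>\<psi> \<in> S\<close> \<phi>, of b] b(1) F(2) \<psi>(2) by fastforce+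
      moreover have "cmod (\<psi> a - \<omega> a - (\<psi> b - \<omega> b)) < e / 4"
        using b(2) \<psi>(1) by (simp add: dist_norm)
      moreover have eq: "\<phi> a - \<omega> a - (\<phi> b - \<omega> b) =
          (\<psi> a - \<omega> a - (\<psi> b - \<omega> b)) - ((\<psi> a - \<phi> a) - (\<psi> b - \<phi> b))" by simp
      ultimately show ?thesis
        unfolding eq using norm_triangle_ineq4[of "\<psi> a - \<omega> a - (\<psi> b - \<omega> b)" "(\<psi> a - \<phi> a) - (\<psi> b - \<phi> b)"]
          norm_triangle_ineq4[of "\<psi> a - \<phi> a" "\<psi> b - \<phi> b"] e by linarith
    qed
    then show ?thesis using b(1) by blast
  qed
  then show ?thesis using F(1,2) by (intro exI[of _ F]) (simp add: S_def B_def)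
qed

section \<open>Bounded operators on Hilbert spaces\<close>

lemma bop_app_linear:
  "T \<bullet>\<^sub>o (x + y) = T \<bullet>\<^sub>o x + T \<bullet>\<^sub>o y" "T \<bullet>\<^sub>o (x - y) = T \<bullet>\<^sub>o x - T \<bullet>\<^sub>o y"
  "T \<bullet>\<^sub>o 0 = 0" "T \<bullet>\<^sub>o (r *\<^sub>R x) = r *\<^sub>R (T \<bullet>\<^sub>o x)"
  by (rule linear_add linear_diff linear_0 linear_scale,
      rule bounded_linear.linear[OF bounded_linear_bop_app])+

text \<open>
  The quadratic form of \<open>T\<close> determines its sesquilinear form by polarization, which is then evaluated at
  \<open>x\<close> and at the multiple of \<open>T x\<close> that has the norm of \<open>x\<close>.
\<close>

lemma norm_le_numerical_radius:
  fixes T :: "'h::chilbert_space bop"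
  assumes r: "\<And>x. cmod (cinner (T \<bullet>\<^sub>o x) x) \<le> r * (norm x)\<^sup>2"
  shows "norm T \<le> 2 * r"
proof -
  define Q where "Q x = cinner (T \<bullet>\<^sub>o x) x" for x
  have dl: "cinner (x - y) z = cinner x z - cinner y z" for x y z :: 'h
    using cinner_add_left[of "x - y" y z] by simp
  have dr: "cinner z (x - y) = cinner z x - cinner z y" for x y z :: 'h
    using cinner_add_right[of z "x - y" y] by simp
  have par: "(norm (x + y))\<^sup>2 + (norm (x - y))\<^sup>2 = 2 * ((norm x)\<^sup>2 + (norm y)\<^sup>2)" for x y :: 'h
    by (simp add: power2_norm_eq_inner inner_add_left inner_add_right inner_diff_left
        inner_diff_right)
  \<comment> \<open>Polarization of the form of \<open>T\<close>.\<close>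
  have pol: "4 * cinner (T \<bullet>\<^sub>o x) y =
      (Q (x + y) - Q (x - y)) + \<i> * (Q (x + \<i> *\<^sub>C y) - Q (x - \<i> *\<^sub>C y))" for x y
    by (simp add: Q_def bop_app_linear dl dr cinner_add_left cinner_add_right cinner_scaleC_left
        cinner_scaleC_right bop_app_scaleC algebra_simps)
  have bound: "cmod (cinner (T \<bullet>\<^sub>o x) y) \<le> r * ((norm x)\<^sup>2 + (norm y)\<^sup>2)" for x y
  proof -
    have Q: "cmod (Q x) \<le> r * (norm x)\<^sup>2" for x using r by (simp add: Q_def)
    have "cmod ((Q (x + y) - Q (x - y)) + \<i> * (Q (x + \<i> *\<^sub>C y) - Q (x - \<i> *\<^sub>C y)))
        \<le> cmod (Q (x + y) - Q (x - y)) + cmod (\<i> * (Q (x + \<i> *\<^sub>C y) - Q (x - \<i> *\<^sub>C y)))"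
      by (rule norm_triangle_ineq)
    also have "\<dots> \<le> (cmod (Q (x + y)) + cmod (Q (x - y)))
        + (cmod (Q (x + \<i> *\<^sub>C y)) + cmod (Q (x - \<i> *\<^sub>C y)))"
      unfolding norm_mult by (intro add_mono) (simp_all add: norm_triangle_ineq4)
    also have "\<dots> \<le> (r * (norm (x + y))\<^sup>2 + r * (norm (x - y))\<^sup>2)
        + (r * (norm (x + \<i> *\<^sub>C y))\<^sup>2 + r * (norm (x - \<i> *\<^sub>C y))\<^sup>2)"
      by (intro add_mono Q)
    also have "\<dots> = r * (4 * ((norm x)\<^sup>2 + (norm y)\<^sup>2))"
      unfolding distrib_left[symmetric] par by (simp add: norm_scaleC_hilbert)
    finally have "cmod (4 * cinner (T \<bullet>\<^sub>o x) y) \<le> 4 * (r * ((norm x)\<^sup>2 + (norm y)\<^sup>2))"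
      unfolding pol[symmetric] by (simp add: algebra_simps)
    then show ?thesis unfolding norm_mult by (simp add: algebra_simps)
  qed
  obtain u :: 'h where u: "u \<noteq> 0" using ex_nonzero by blast
  have "0 \<le> r * (norm u)\<^sup>2" using r[of u] norm_ge_zero order_trans by blast
  then have r0: "0 \<le> r" using u by (simp add: zero_le_mult_iff)
  have "norm (T \<bullet>\<^sub>o x) \<le> (2 * r) * norm x" for x
  proof (cases "x = 0 \<or> T \<bullet>\<^sub>o x = 0")
    case True
    then show ?thesis
      using r0 by (auto simp: bop_app_linear)
  next
    case False
    define t where "t = norm x / norm (T \<bullet>\<^sub>o x)"
    define y where "y = complex_of_real t *\<^sub>C (T \<bullet>\<^sub>o x)"
    have t: "0 \<le> t" by (simp add: t_def)
    have n: "norm y = norm x" using False by (simp add: y_def norm_scaleC_hilbert t_def norm_divide)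
    have "cinner (T \<bullet>\<^sub>o x) y = complex_of_real (t * (norm (T \<bullet>\<^sub>o x))\<^sup>2)"
      by (simp add: y_def cinner_scaleC_right cinner_self)
    then have c: "cmod (cinner (T \<bullet>\<^sub>o x) y) = t * (norm (T \<bullet>\<^sub>o x))\<^sup>2"
      using t by (simp add: norm_mult norm_power)
    have tt: "t * (norm (T \<bullet>\<^sub>o x))\<^sup>2 = norm x * norm (T \<bullet>\<^sub>o x)"
      using False by (simp add: t_def power2_eq_square)
    have "norm x * norm (T \<bullet>\<^sub>o x) \<le> r * ((norm x)\<^sup>2 + (norm x)\<^sup>2)"
      using bound[of x y] unfolding n c tt .
    also have "\<dots> = norm x * ((2 * r) * norm x)" by (simp add: power2_eq_square)
    finally have "norm x * norm (T \<bullet>\<^sub>o x) \<le> norm x * ((2 * r) * norm x)" .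
    then show ?thesis using False by (simp add: mult_le_cancel_left)
  qed
  then show ?thesis using r0 by (intro norm_bop_bound) simp_all
qed

text \<open>
  A real quadratic form is that of the adjoint as well, so the form of \<open>S - S\<^sup>*\<close> is zero.
\<close>

lemma star_eq_if_positive:
  fixes S :: "'h::chilbert_space bop"
  assumes "positive_bop S"
  shows "star S = S"
proof -
  have "cinner ((S - star S) \<bullet>\<^sub>o x) x = 0" for x
  proof -
    have "cinner (S \<bullet>\<^sub>o x) x \<in> \<real>"
      using assms nonneg_Reals_subset_Reals unfolding positive_bop_def by blast
    then have "cnj (cinner (S \<bullet>\<^sub>o x) x) = cinner (S \<bullet>\<^sub>o x) x" by (rule Reals_cnj_iff[THEN iffD1])
    then have "cinner (star S \<bullet>\<^sub>o x) x = cinner (S \<bullet>\<^sub>o x) x"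
      using cinner_commute[of x "S \<bullet>\<^sub>o x"] by (simp add: cinner_star_left)
    then show ?thesis using cinner_add_left[of "S \<bullet>\<^sub>o x - star S \<bullet>\<^sub>o x" "star S \<bullet>\<^sub>o x" x] by simp
  qed
  then have "norm (S - star S) \<le> 2 * 0" by (intro norm_le_numerical_radius) simp
  then show ?thesis by simp
qed

text \<open>
  The operator matrix that is concentrated on the \<open>m\<close>-th diagonal, with entry \<open>K n\<close> in row \<open>n\<close>.  It is
  a bounded operator if the norms of the entries are bounded.  The elements \<open>a \<lambda>\<^sub>m\<close> of the crossed
  product, their commutators with the Dirac operator and its resolvent are of this form.
\<close>

definition band :: "(int \<Rightarrow> 'h::chilbert_space bop) \<Rightarrow> int \<Rightarrow> 'h l2Z bop"
  where "band K m = Bop (\<lambda>u. l2Z (\<lambda>n. K n \<bullet>\<^sub>o coord u (n - m)))"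

lemma band_sum_le:
  assumes b: "\<And>n. norm (K n) \<le> b" and F: "finite F"
  shows "(\<Sum>n\<in>F. (norm (K n \<bullet>\<^sub>o coord u (n - m)))\<^sup>2) \<le> (b * norm u)\<^sup>2"
proof -
  have b0: "0 \<le> b" using b[of 0] norm_ge_zero order_trans by blast
  have "(\<Sum>n\<in>F. (norm (K n \<bullet>\<^sub>o coord u (n - m)))\<^sup>2) \<le> (\<Sum>n\<in>F. b\<^sup>2 * (norm (coord u (n - m)))\<^sup>2)"
  proof (rule sum_mono)
    fix n
    have "norm (K n \<bullet>\<^sub>o coord u (n - m)) \<le> b * norm (coord u (n - m))"
      using norm_bop_app[of "K n"] mult_right_mono[OF b[of n]] by (rule order_trans) simp
    then show "(norm (K n \<bullet>\<^sub>o coord u (n - m)))\<^sup>2 \<le> b\<^sup>2 * (norm (coord u (n - m)))\<^sup>2"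
      by (simp add: power_mult_distrib[symmetric] power_mono)
  qed
  also have "\<dots> = b\<^sup>2 * (\<Sum>n\<in>(\<lambda>n. n - m) ` F. (norm (coord u n))\<^sup>2)"
    by (subst sum.reindex) (auto simp: inj_on_def sum_distrib_left)
  also have "\<dots> \<le> b\<^sup>2 * (norm u)\<^sup>2"
    using F by (intro mult_left_mono sum_coord_le_norm) simp_all
  finally show ?thesis by (simp add: power_mult_distrib)
qed

lemma coord_band:
  assumes b: "\<And>n. norm (K n) \<le> b"
  shows "coord (band K m \<bullet>\<^sub>o u) n = K n \<bullet>\<^sub>o coord u (n - m)"
proof -
  have b0: "0 \<le> b" using b[of 0] norm_ge_zero order_trans by blast
  have "coord (band K m \<bullet>\<^sub>o u) = (\<lambda>n. K n \<bullet>\<^sub>o coord u (n - m))"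
    unfolding band_def
    by (rule l2Z_operator[where b=b])
      (simp_all add: bop_app_linear bop_app_scaleC b0 band_sum_le[OF b])
  then show ?thesis by simp
qed

lemma norm_band_le:
  assumes b: "\<And>n. norm (K n) \<le> b"
  shows "norm (band K m) \<le> b"
proof (rule norm_bop_bound)
  show b0: "0 \<le> b" using b[of 0] norm_ge_zero order_trans by blast
  fix u
  have "norm (l2Z (coord (band K m \<bullet>\<^sub>o u))) \<le> b * norm u"
    using b0 by (intro l2Z_boundI(2)) (simp_all add: coord_band[OF b] band_sum_le[OF b])
  then show "norm (band K m \<bullet>\<^sub>o u) \<le> b * norm u" by (simp add: coord_inverse)
qed

lemma coord_sum: "coord (\<Sum>i\<in>I. f i) n = (\<Sum>i\<in>I. coord (f i) n)"
  by (induction I rule: infinite_finite_induct) simp_all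

lemma bop_app_sum: "(\<Sum>i\<in>I. f i) \<bullet>\<^sub>o u = (\<Sum>i\<in>I. f i \<bullet>\<^sub>o u)"
  by (induction I rule: infinite_finite_induct) simp_all

section \<open>Density and separability\<close>

lemma finite_truncation_l2Z:
  fixes u :: "'h::chilbert_space l2Z"
  assumes e: "0 < e"
  shows "\<exists>F. finite F \<and> norm (u - (\<Sum>n\<in>F. coord u n \<otimes>\<delta> n)) < e"
proof -
  let ?f = "\<lambda>n. (norm (coord u n))\<^sup>2"
  have "0 < e\<^sup>2 / 2" using e by simp
  from infsum_finite_approximation[OF summable_coord[of u] this]
  obtain F where F: "finite F" "dist (sum ?f F) (infsum ?f UNIV) \<le> e\<^sup>2 / 2" by blast
  have c: "coord (u - (\<Sum>n\<in>F. coord u n \<otimes>\<delta> n)) n = (if n \<in> F then 0 else coord u n)" for n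
    using F(1) by (simp add: coord_sum coord_tensor_delta)
  have "(norm (u - (\<Sum>n\<in>F. coord u n \<otimes>\<delta> n)))\<^sup>2 = infsum ?f (UNIV - F)"
    unfolding norm_l2Z_square c by (rule infsum_cong_neutral) auto
  also have "\<dots> = infsum ?f UNIV - sum ?f F"
    using infsum_Diff[OF summable_coord[of u] summable_on_finite[OF F(1)] subset_UNIV] F(1) by simp
  also have "\<dots> \<le> e\<^sup>2 / 2" using F(2) unfolding dist_real_def by linarith
  also have "\<dots> < e\<^sup>2" using e by simp
  finally show ?thesis using F(1) e power2_less_imp_less by fastforce
qed

lemma closure_add_closed:
  fixes P :: "'a::real_normed_vector set"
  assumes "\<And>x y. x \<in> P \<Longrightarrow> y \<in> P \<Longrightarrow> x + y \<in> P" "x \<in> closure P" "y \<in> closure P"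
  shows "x + y \<in> closure P"
proof -
  obtain X Y where "\<forall>n. X n \<in> P" "X \<longlonglongrightarrow> x" "\<forall>n. Y n \<in> P" "Y \<longlonglongrightarrow> y"
    using assms(2,3) unfolding closure_sequential by blast
  then show ?thesis
    unfolding closure_sequential using assms(1)
    by (intro exI[of _ "\<lambda>n. X n + Y n"]) (auto intro: tendsto_add)
qed

lemma closure_sum_closed:
  fixes P :: "'a::real_normed_vector set"
  assumes "\<And>x y. x \<in> P \<Longrightarrow> y \<in> P \<Longrightarrow> x + y \<in> P" "0 \<in> P" "\<And>i. i \<in> I \<Longrightarrow> f i \<in> closure P"
  shows "(\<Sum>i\<in>I. f i) \<in> closure P"
  using assms(3)
  by (induction I rule: infinite_finite_induct)
    (auto intro: closure_add_closed[OF assms(1)] closure_subset[THEN subsetD] assms(2))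

lemma closure_bounded_linear_image:
  assumes f: "bounded_linear f" and P: "\<And>x. x \<in> P \<Longrightarrow> f x \<in> closure R" and x: "x \<in> closure P"
  shows "f x \<in> closure R"
  using image_closure_subset[OF linear_continuous_on[OF f, of "closure P"], of "closure R"] P x by auto

lemma dense_l2Z:
  fixes P :: "'h::chilbert_space l2Z set"
  assumes "\<And>x y. x \<in> P \<Longrightarrow> y \<in> P \<Longrightarrow> x + y \<in> P" "0 \<in> P" "\<And>\<xi> n. \<xi> \<otimes>\<delta> n \<in> closure P"
  shows "closure P = UNIV"
proof -
  have "u \<in> closure (closure P)" for u
    unfolding closure_approachable
  proof (intro allI impI)
    fix e :: real
    assume "0 < e"
    then obtain F where F: "finite F" "norm (u - (\<Sum>n\<in>F. coord u n \<otimes>\<delta> n)) < e"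
      using finite_truncation_l2Z by blast
    have "(\<Sum>n\<in>F. coord u n \<otimes>\<delta> n) \<in> closure P"
      by (rule closure_sum_closed) (simp_all add: assms)
    then show "\<exists>y\<in>closure P. dist y u < e"
      using F(2) by (intro bexI[of _ "\<Sum>n\<in>F. coord u n \<otimes>\<delta> n"]) (simp_all add: dist_norm norm_minus_commute)
  qed
  then show ?thesis by auto
qed

lemma norm_tensor_delta [simp]: "norm (\<xi> \<otimes>\<delta> n) = norm (\<xi> :: 'h::chilbert_space)"
proof -
  have "complex_of_real ((norm (\<xi> \<otimes>\<delta> n))\<^sup>2) = complex_of_real ((norm \<xi>)\<^sup>2)"
    unfolding cinner_self[symmetric] cinner_tensor_delta by simp
  then have "(norm (\<xi> \<otimes>\<delta> n))\<^sup>2 = (norm \<xi>)\<^sup>2" by (simp only: of_real_eq_iff)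
  then show ?thesis by simp
qed

lemma bounded_linear_tensor_delta: "bounded_linear (\<lambda>\<xi>::'h::chilbert_space. \<xi> \<otimes>\<delta> n)"
proof (rule bounded_linear_intro[where K=1])
  show "(\<xi> + \<eta>) \<otimes>\<delta> n = \<xi> \<otimes>\<delta> n + \<eta> \<otimes>\<delta> n" for \<xi> \<eta> :: 'h
    by (rule l2Z_eqI) (simp add: coord_tensor_delta)
  show "(r *\<^sub>R \<xi>) \<otimes>\<delta> n = r *\<^sub>R (\<xi> \<otimes>\<delta> n)" for r and \<xi> :: 'h
    by (rule l2Z_eqI) (simp add: coord_tensor_delta)
  show "norm (\<xi> \<otimes>\<delta> n) \<le> norm \<xi> * 1" for \<xi> :: 'h by simp
qed

lemma separable_space_iff:
  fixes A :: "'a::topological_space set"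
  shows "separable_space (top_of_set A) \<longleftrightarrow> (\<exists>Q. countable Q \<and> Q \<subseteq> A \<and> A \<subseteq> closure Q)"
  unfolding separable_space_def
  by (intro ex_cong1) (auto simp: closure_of_subtopology Int_absorb1)

lemma sum_list_lists_add_closed:
  assumes "x \<in> sum_list ` lists G" "y \<in> sum_list ` lists G"
  shows "x + y \<in> (sum_list ` lists G :: 'a::monoid_add set)"
proof -
  obtain k l where "k \<in> lists G" "l \<in> lists G" "x = sum_list k" "y = sum_list l" using assms by blast
  then show ?thesis by (intro image_eqI[of _ _ "k @ l"]) auto
qed

lemma sum_list_lists_contains:
  shows "0 \<in> sum_list ` lists G" "G \<subseteq> (sum_list ` lists G :: 'a::monoid_add set)"
proof -
  show "0 \<in> sum_list ` lists G" by (rule image_eqI[of _ _ "[]"]) auto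
  show "G \<subseteq> sum_list ` lists G" by (auto intro!: image_eqI[of _ sum_list "[_]"])
qed

text \<open>
  Finite sums of vectors \<open>q \<otimes> \<delta>\<^sub>n\<close> with \<open>q\<close> from a countable dense set are enumerated by lists.
\<close>

lemma separable_l2Z:
  assumes "separable_space (euclidean :: 'h::chilbert_space topology)"
  shows "separable_space (euclidean :: 'h l2Z topology)"
proof -
  obtain Q :: "'h set" where Q: "countable Q" "closure Q = UNIV"
    using assms separable_space_iff[of "UNIV :: 'h set"] by auto
  define G :: "'h l2Z set" where "G = (\<lambda>(\<xi>, n). \<xi> \<otimes>\<delta> n) ` (Q \<times> UNIV)"
  have "countable (sum_list ` lists G)" using Q(1) by (simp add: G_def)
  moreover have "closure (sum_list ` lists G) = UNIV"
  proof (rule dense_l2Z)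
    have GG: "G \<subseteq> closure (sum_list ` lists G)"
      using sum_list_lists_contains(2) closure_subset by (rule order_trans)
    show "\<xi> \<otimes>\<delta> n \<in> closure (sum_list ` lists G)" for \<xi> n
      by (rule closure_bounded_linear_image[OF bounded_linear_tensor_delta, of Q])
        (use Q(2) GG in \<open>auto simp: G_def\<close>)
  qed (auto intro: sum_list_lists_add_closed sum_list_lists_contains(1))
  ultimately show ?thesis using separable_space_iff[of "UNIV :: 'h l2Z set"] by auto
qed

lemma separable_prod:
  assumes "separable_space (euclidean :: 'h::topological_space topology)"
    "separable_space (euclidean :: 'k::topological_space topology)"
  shows "separable_space (euclidean :: ('h \<times> 'k) topology)"
proof -
  obtain Q :: "'h set" where Q: "countable Q" "closure Q = UNIV"
    using assms(1) separable_space_iff[of "UNIV :: 'h set"] by auto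
  obtain R :: "'k set" where R: "countable R" "closure R = UNIV"
    using assms(2) separable_space_iff[of "UNIV :: 'k set"] by auto
  have "countable (Q \<times> R)" "closure (Q \<times> R) = UNIV"
    using Q R by (simp_all add: closure_Times)
  then show ?thesis using separable_space_iff[of "UNIV :: ('h \<times> 'k) set"] by auto
qed

section \<open>The algebra of the crossed product\<close>

lemma bounded_linear_scaleC: "bounded_linear (\<lambda>x::'a::cstar_algebra. c *\<^sub>C x)"
  by (rule bounded_linear_intro[where K="cmod c"])
    (simp_all add: scaleC_add_right scaleC_scaleR_commute norm_scaleC mult.commute)

lemma star_subalgebra_closure:
  fixes B :: "'a::cstar_algebra set"
  assumes "star_subalgebra B"
  shows "star_subalgebra (closure B)"
proof -
  have B: "0 \<in> B" "\<And>x y. x \<in> B \<Longrightarrow> y \<in> B \<Longrightarrow> x + y \<in> B"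
    "\<And>x y. x \<in> B \<Longrightarrow> y \<in> B \<Longrightarrow> x * y \<in> B"
    "\<And>c x. x \<in> B \<Longrightarrow> c *\<^sub>C x \<in> B" "\<And>x. x \<in> B \<Longrightarrow> star x \<in> B"
    using assms by (auto simp: star_subalgebra_def)
  have sub: "x \<in> closure B" if "x \<in> B" for x using that closure_subset by blast
  have "x * y \<in> closure B" if "x \<in> closure B" "y \<in> closure B" for x y
  proof -
    have "z * y \<in> closure B" if "z \<in> B" for z
      by (rule closure_bounded_linear_image[OF bounded_linear_mult_right, of B])
        (use that \<open>y \<in> closure B\<close> B(3) sub in auto)
    then show ?thesis
      using \<open>x \<in> closure B\<close>
      by (rule closure_bounded_linear_image[OF bounded_linear_mult_left, of B])
  qed
  moreover have "c *\<^sub>C x \<in> closure B" if "x \<in> closure B" for c x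
    by (rule closure_bounded_linear_image[OF bounded_linear_scaleC, of B]) (use that B sub in auto)
  moreover have "star x \<in> closure B" if "x \<in> closure B" for x
    by (rule closure_bounded_linear_image[OF bounded_linear_star, of B]) (use that B sub in auto)
  moreover have "x + y \<in> closure B" if "x \<in> closure B" "y \<in> closure B" for x y
    using B(2) that by (rule closure_add_closed)
  ultimately show ?thesis unfolding star_subalgebra_def using sub[OF B(1)] by simp
qed

locale covariant_system =
  fixes \<pi> :: "'a::cstar_algebra \<Rightarrow> 'h::chilbert_space bop" and \<alpha> :: "int \<Rightarrow> 'a \<Rightarrow> 'a"
  assumes rep: "representation UNIV \<pi>" and act: "group_action \<alpha>"
begin

lemma \<pi>_simps: "\<pi> (a + b) = \<pi> a + \<pi> b" "\<pi> (a * b) = \<pi> a * \<pi> b" "\<pi> (c *\<^sub>C a) = c *\<^sub>C \<pi> a"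
  "\<pi> (star a) = star (\<pi> a)" "\<pi> 1 = 1"
  using rep by (simp_all add: representation_def)

lemma \<alpha>_aut: "star_automorphism (\<alpha> n)"
  using act by (simp add: group_action_def)

lemma \<alpha>_simps: "\<alpha> n (a + b) = \<alpha> n a + \<alpha> n b" "\<alpha> n (a * b) = \<alpha> n a * \<alpha> n b"
  "\<alpha> n (c *\<^sub>C a) = c *\<^sub>C \<alpha> n a" "\<alpha> n (star a) = star (\<alpha> n a)"
  using \<alpha>_aut[of n] by (simp_all add: star_automorphism_def)

lemma \<alpha>_add: "\<alpha> m (\<alpha> n a) = \<alpha> (m + n) a"
  using act by (simp add: group_action_def)

lemma \<alpha>_0 [simp]: "\<alpha> 0 a = a"
proof -
  have "\<alpha> 0 (\<alpha> 0 a) = \<alpha> 0 a" by (simp add: \<alpha>_add)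
  moreover have "inj (\<alpha> 0)" using \<alpha>_aut[of 0] by (simp add: star_automorphism_def bij_is_inj)
  ultimately show ?thesis by (simp add: inj_eq)
qed

lemma \<alpha>_1 [simp]: "\<alpha> n 1 = 1"
  using \<alpha>_simps(2)[of n 1 "\<alpha> (- n) 1"] by (simp add: \<alpha>_add)

lemma norm_\<pi>\<alpha>_le: "norm (\<pi> (\<alpha> n a)) \<le> norm a"
  by (rule norm_representation_le[OF representation_comp_automorphism[OF rep \<alpha>_aut]])

text \<open>
  The element \<open>a \<lambda>\<^sub>n\<close> of the crossed product.
\<close>

definition monomial :: "'a \<Rightarrow> int \<Rightarrow> 'h l2Z bop"
  where "monomial a n = pi_tilde \<pi> \<alpha> a * shift_op n"

lemma coord_monomial: "coord (monomial a n \<bullet>\<^sub>o u) k = \<pi> (\<alpha> (- k) a) \<bullet>\<^sub>o coord u (k - n)"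
  by (simp add: monomial_def coord_pi_tilde[OF rep act] coord_shift_op)

lemma monomial_eq_band: "monomial a n = band (\<lambda>k. \<pi> (\<alpha> (- k) a)) n"
  by (intro bop_eqI l2Z_eqI) (simp add: coord_monomial coord_band[OF norm_\<pi>\<alpha>_le])

lemma norm_monomial_le: "norm (monomial a n) \<le> norm a"
  unfolding monomial_eq_band by (rule norm_band_le[OF norm_\<pi>\<alpha>_le])

lemma monomial_add: "monomial (a + b) n = monomial a n + monomial b n"
  by (intro bop_eqI l2Z_eqI) (simp add: coord_monomial \<alpha>_simps \<pi>_simps)

lemma monomial_scaleC: "monomial (c *\<^sub>C a) n = c *\<^sub>C monomial a n"
  by (intro bop_eqI l2Z_eqI) (simp add: coord_monomial \<alpha>_simps \<pi>_simps bop_app_scaleC_left)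

lemma monomial_0 [simp]: "monomial 0 n = 0"
  using monomial_scaleC[of 0 0 n] by simp

lemma monomial_1_0: "monomial 1 0 = 1"
  by (intro bop_eqI l2Z_eqI) (simp add: coord_monomial \<pi>_simps)

lemma monomial_mult: "monomial a m * monomial b n = monomial (a * \<alpha> m b) (m + n)"
  by (intro bop_eqI l2Z_eqI) (simp add: coord_monomial \<alpha>_simps \<pi>_simps \<alpha>_add algebra_simps)

lemma star_monomial: "star (monomial a m) = monomial (\<alpha> (- m) (star a)) (- m)"
proof (rule star_bop_unique)
  fix u v :: "'h l2Z"
  have "cinner (monomial a m \<bullet>\<^sub>o u) v =
      (\<Sum>\<^sub>\<infinity>k. cinner (coord u (k - m)) (\<pi> (\<alpha> (- k) (star a)) \<bullet>\<^sub>o coord v k))"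
    by (simp add: cinner_l2Z_def coord_monomial \<alpha>_simps \<pi>_simps cinner_star_right)
  also have "\<dots> = (\<Sum>\<^sub>\<infinity>j. cinner (coord u j) (\<pi> (\<alpha> (- (j + m)) (star a)) \<bullet>\<^sub>o coord v (j + m)))"
    by (rule infsum_reindex_bij_betw[symmetric, where g="\<lambda>j. j + m", THEN trans])
      (auto intro!: bij_betwI[where g="\<lambda>j. j - m"])
  also have "\<dots> = cinner u (monomial (\<alpha> (- m) (star a)) (- m) \<bullet>\<^sub>o v)"
    by (simp add: cinner_l2Z_def coord_monomial \<alpha>_add algebra_simps)
  finally show "cinner (monomial a m \<bullet>\<^sub>o u) v = cinner u (monomial (\<alpha> (- m) (star a)) (- m) \<bullet>\<^sub>o v)" .
qed

lemma bounded_linear_monomial: "bounded_linear (\<lambda>a. monomial a n)"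
  by (rule bounded_linear_intro[where K=1])
    (simp_all add: monomial_add scaleR_scaleC monomial_scaleC norm_monomial_le)

lemma crossed_Cc_eq:
  "crossed_Cc \<pi> \<alpha> S = {\<Sum>n\<in>F. monomial (x n) n |F x. finite F \<and> (\<forall>n\<in>F. x n \<in> S)}"
  by (simp add: crossed_Cc_def monomial_def)

lemma monomial_in_crossed_Cc: "a \<in> S \<Longrightarrow> monomial a n \<in> crossed_Cc \<pi> \<alpha> S"
  unfolding crossed_Cc_eq by (intro CollectI exI[of _ "{n}"] exI[of _ "\<lambda>_. a"]) simp

lemma crossed_Cc_add:
  assumes S: "star_subalgebra S" and "x \<in> crossed_Cc \<pi> \<alpha> S" "y \<in> crossed_Cc \<pi> \<alpha> S"
  shows "x + y \<in> crossed_Cc \<pi> \<alpha> S"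
proof -
  obtain F G f g where F: "finite F" "\<forall>n\<in>F. f n \<in> S" "x = (\<Sum>n\<in>F. monomial (f n) n)"
    and G: "finite G" "\<forall>n\<in>G. g n \<in> S" "y = (\<Sum>n\<in>G. monomial (g n) n)"
    using assms(2,3) unfolding crossed_Cc_eq by blast
  \<comment> \<open>A coefficient function is arbitrary outside its index set, so it is cut off there before adding.\<close>
  define h where "h n = (if n \<in> F then f n else 0) + (if n \<in> G then g n else 0)" for n
  have "(\<Sum>n\<in>F \<union> G. monomial (h n) n) = x + y"
  proof -
    have "(\<Sum>n\<in>F \<union> G. monomial (h n) n) =
        (\<Sum>n\<in>F \<union> G. if n \<in> F then monomial (f n) n else 0) +
        (\<Sum>n\<in>F \<union> G. if n \<in> G then monomial (g n) n else 0)"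
      unfolding sum.distrib[symmetric] by (intro sum.cong) (simp_all add: h_def monomial_add)
    then show ?thesis
      using F(1) G(1) unfolding F(3) G(3)
      by (simp add: sum.inter_restrict[symmetric] Int_absorb1 Int_absorb2 Un_Int_distrib2)
  qed
  moreover have "\<forall>n\<in>F \<union> G. h n \<in> S"
    using S F(2) G(2) unfolding h_def star_subalgebra_def by auto
  ultimately show ?thesis
    unfolding crossed_Cc_eq using F(1) G(1)
    by (intro CollectI exI[of _ "F \<union> G"] exI[of _ h]) auto
qed

lemma zero_in_crossed_Cc: "0 \<in> crossed_Cc \<pi> \<alpha> S"
  unfolding crossed_Cc_eq by (intro CollectI exI[of _ "{}"]) simp

lemma crossed_Cc_sum:
  assumes S: "star_subalgebra S" and f: "\<And>i. i \<in> I \<Longrightarrow> f i \<in> crossed_Cc \<pi> \<alpha> S"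
  shows "(\<Sum>i\<in>I. f i) \<in> crossed_Cc \<pi> \<alpha> S"
  using f by (induction I rule: infinite_finite_induct)
    (auto intro: crossed_Cc_add[OF S] zero_in_crossed_Cc)

lemma star_subalgebra_crossed_Cc:
  assumes S: "star_subalgebra S" and inv: "\<And>n. \<alpha> n ` S \<subseteq> S"
  shows "star_subalgebra (crossed_Cc \<pi> \<alpha> S)"
  unfolding star_subalgebra_def
proof (intro conjI ballI allI)
  have S': "a * b \<in> S" "c *\<^sub>C a \<in> S" "star a \<in> S" if "a \<in> S" "b \<in> S" for a b c
    using S that by (auto simp: star_subalgebra_def)
  have invD: "\<alpha> n a \<in> S" if "a \<in> S" for n a using inv that by blast
  show "0 \<in> crossed_Cc \<pi> \<alpha> S" by (rule zero_in_crossed_Cc)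
  fix x
  assume x: "x \<in> crossed_Cc \<pi> \<alpha> S"
  then obtain F f where F: "finite F" "\<forall>n\<in>F. f n \<in> S" "x = (\<Sum>n\<in>F. monomial (f n) n)"
    unfolding crossed_Cc_eq by blast
  show "c *\<^sub>C x \<in> crossed_Cc \<pi> \<alpha> S" for c
    unfolding F(3) linear_sum[OF bounded_linear.linear[OF bounded_linear_scaleC]]
      monomial_scaleC[symmetric]
    using F(2) S' by (intro crossed_Cc_sum[OF S] monomial_in_crossed_Cc) auto
  show "star x \<in> crossed_Cc \<pi> \<alpha> S"
    unfolding F(3) linear_sum[OF bounded_linear.linear[OF bounded_linear_star]] star_monomial
    using F(2) S' by (intro crossed_Cc_sum[OF S] monomial_in_crossed_Cc invD) auto
  fix y
  assume y: "y \<in> crossed_Cc \<pi> \<alpha> S"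
  then obtain G g where G: "finite G" "\<forall>n\<in>G. g n \<in> S" "y = (\<Sum>n\<in>G. monomial (g n) n)"
    unfolding crossed_Cc_eq by blast
  show "x + y \<in> crossed_Cc \<pi> \<alpha> S" by (rule crossed_Cc_add[OF S x y])
  show "x * y \<in> crossed_Cc \<pi> \<alpha> S"
    unfolding F(3) G(3) sum_product monomial_mult
    using F(2) G(2) by (intro crossed_Cc_sum[OF S] monomial_in_crossed_Cc S' invD) auto
qed

lemma star_subalgebra_UNIV: "star_subalgebra (UNIV :: 'a set)"
  by (simp add: star_subalgebra_def)

lemma unital_crossed_product: "unital_cstar_subalgebra (crossed_product \<pi> \<alpha>)"
proof -
  have "1 \<in> crossed_Cc \<pi> \<alpha> UNIV" using monomial_in_crossed_Cc[of 1 UNIV 0] monomial_1_0 by simp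
  then have "1 \<in> closure (crossed_Cc \<pi> \<alpha> UNIV)" using closure_subset by blast
  then show ?thesis
    unfolding unital_cstar_subalgebra_def crossed_product_def
    using star_subalgebra_closure[OF star_subalgebra_crossed_Cc[OF star_subalgebra_UNIV]] by simp
qed

lemma crossed_Cc_subset: "crossed_Cc \<pi> \<alpha> S \<subseteq> crossed_product \<pi> \<alpha>"
proof -
  have "crossed_Cc \<pi> \<alpha> S \<subseteq> crossed_Cc \<pi> \<alpha> UNIV"
  proof
    fix x
    assume "x \<in> crossed_Cc \<pi> \<alpha> S"
    then obtain F f where "finite F" "x = (\<Sum>n\<in>F. monomial (f n) n)" unfolding crossed_Cc_eq by blast
    then show "x \<in> crossed_Cc \<pi> \<alpha> UNIV"
      unfolding crossed_Cc_eq by (intro CollectI exI[of _ F] exI[of _ f]) simp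
  qed
  then show ?thesis unfolding crossed_product_def using closure_subset by (rule subset_trans)
qed

text \<open>
  As \<open>a \<lambda>\<^sub>n\<close> depends continuously on \<open>a\<close>, coefficients from a dense set suffice.  This gives both the
  density of \<open>C\<^sub>c(\<int>, \<A>)\<close> and the separability of the crossed product.
\<close>

lemma crossed_product_subset_closure:
  assumes P: "\<And>x y. x \<in> P \<Longrightarrow> y \<in> P \<Longrightarrow> x + y \<in> P" "0 \<in> P"
    and Q: "closure Q = UNIV" "\<And>q n. q \<in> Q \<Longrightarrow> monomial q n \<in> P"
  shows "crossed_product \<pi> \<alpha> \<subseteq> closure P"
proof -
  have mono: "monomial a n \<in> closure P" for a n
  proof (rule closure_bounded_linear_image[OF bounded_linear_monomial, of Q])
    show "monomial q n \<in> closure P" if "q \<in> Q" for q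
      using Q(2)[OF that, of n] closure_subset[of P] by (rule rev_subsetD)
    show "a \<in> closure Q" by (simp add: Q(1))
  qed
  have "crossed_Cc \<pi> \<alpha> UNIV \<subseteq> closure P"
  proof
    fix x
    assume "x \<in> crossed_Cc \<pi> \<alpha> UNIV"
    then obtain F f where "x = (\<Sum>n\<in>F. monomial (f n) n)" unfolding crossed_Cc_eq by blast
    then show "x \<in> closure P" by (simp add: closure_sum_closed P mono)
  qed
  then show ?thesis unfolding crossed_product_def by (rule closure_minimal) simp
qed

lemma crossed_Cc_dense:
  assumes S: "star_subalgebra S" "closure S = UNIV"
  shows "crossed_product \<pi> \<alpha> \<subseteq> closure (crossed_Cc \<pi> \<alpha> S)"
proof (rule crossed_product_subset_closure[OF _ zero_in_crossed_Cc S(2)])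
  show "x + y \<in> crossed_Cc \<pi> \<alpha> S" if "x \<in> crossed_Cc \<pi> \<alpha> S" "y \<in> crossed_Cc \<pi> \<alpha> S" for x y
    using that by (rule crossed_Cc_add[OF S(1)])
  show "monomial q n \<in> crossed_Cc \<pi> \<alpha> S" if "q \<in> S" for q n
    using that by (rule monomial_in_crossed_Cc)
qed

lemma separable_crossed_product:
  assumes "separable_space (euclidean :: 'a topology)"
  shows "separable_space (top_of_set (crossed_product \<pi> \<alpha>))"
proof -
  obtain Q :: "'a set" where Q: "countable Q" "closure Q = UNIV"
    using assms separable_space_iff[of "UNIV :: 'a set"] by auto
  define G where "G = (\<lambda>(q, n). monomial q n) ` (Q \<times> UNIV)"
  let ?P = "sum_list ` lists G"
  have "countable ?P" using Q(1) by (simp add: G_def)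
  moreover have "?P \<subseteq> crossed_product \<pi> \<alpha>"
  proof
    fix x
    assume "x \<in> ?P"
    then obtain l where "l \<in> lists G" "x = sum_list l" by blast
    then have "x \<in> crossed_Cc \<pi> \<alpha> UNIV"
    proof (induction l arbitrary: x)
      case Nil
      then show ?case by (simp add: zero_in_crossed_Cc)
    next
      case (Cons g l)
      then show ?case
        by (auto simp: G_def intro!: crossed_Cc_add[OF star_subalgebra_UNIV] monomial_in_crossed_Cc)
    qed
    then show "x \<in> crossed_product \<pi> \<alpha>" using crossed_Cc_subset by blast
  qed
  moreover have "crossed_product \<pi> \<alpha> \<subseteq> closure ?P"
  proof (rule crossed_product_subset_closure[OF _ _ Q(2)])
    show "monomial q n \<in> ?P" if "q \<in> Q" for q n
    proof -
      have "monomial q n \<in> G" using that by (auto simp: G_def)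
      then show ?thesis using sum_list_lists_contains(2)[of G] by blast
    qed
    show "x + y \<in> ?P" if "x \<in> ?P" "y \<in> ?P" for x y
      using that by (rule sum_list_lists_add_closed)
    show "0 \<in> ?P" by (rule sum_list_lists_contains(1))
  qed
  ultimately show ?thesis unfolding separable_space_iff by (intro exI[of _ ?P] conjI)
qed

end

section \<open>The Dirac operator\<close>

lemma linear_operatorD:
  assumes "linear_operator T"
  shows "single_valued T" "(0, 0) \<in> T" "(x, y) \<in> T \<Longrightarrow> (x', y') \<in> T \<Longrightarrow> (x + x', y + y') \<in> T"
    "(x, y) \<in> T \<Longrightarrow> (c *\<^sub>C x, c *\<^sub>C y) \<in> T"
proof -
  show "single_valued T" "(0, 0) \<in> T" using assms by (simp_all add: linear_operator_def)
  show "(x, y) \<in> T \<Longrightarrow> (x', y') \<in> T \<Longrightarrow> (x + x', y + y') \<in> T"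
    using assms unfolding linear_operator_def by force
  show "(x, y) \<in> T \<Longrightarrow> (c *\<^sub>C x, c *\<^sub>C y) \<in> T"
    using assms unfolding linear_operator_def scaleC_prod_def by force
qed

lemma linear_operator_diff:
  assumes T: "linear_operator T" and "(x, y) \<in> T" "(x', y') \<in> T"
  shows "(x - x', y - y') \<in> T"
proof -
  have m: "(- 1) *\<^sub>C z = - z" for z :: "'z::complex_vector"
    using scaleR_scaleC[of "- 1" z] by simp
  show ?thesis
    using linear_operatorD(3)[OF T assms(2) linear_operatorD(4)[OF T assms(3), of "- 1"]]
    by (simp add: m)
qed

text \<open>
  Vectors with one vanishing component separate the conditions that membership in the adjoint imposes on
  the two components of a vector.
\<close>

lemma selfadjoint_off_diagonal:
  fixes S :: "('k::chilbert_space \<times> 'h::chilbert_space) set"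
  assumes S: "densely_defined S" and T: "densely_defined T"
    and adj: "op_adjoint S = T" "op_adjoint T = S"
  shows "selfadjoint_operator (off_diagonal S T)"
proof -
  have lS: "linear_operator S" and lT: "linear_operator T"
    using S T by (simp_all add: densely_defined_def)
  have lin: "linear_operator (off_diagonal S T)"
    unfolding linear_operator_def
  proof (intro conjI allI ballI)
    show "single_valued (off_diagonal S T)"
      using linear_operatorD(1)[OF lS] linear_operatorD(1)[OF lT]
      unfolding single_valued_def off_diagonal_def by fast
    show "(0, 0) \<in> off_diagonal S T"
      using linear_operatorD(2)[OF lS] linear_operatorD(2)[OF lT]
      by (simp add: off_diagonal_def zero_prod_def)
    show "u + v \<in> off_diagonal S T" if "u \<in> off_diagonal S T" "v \<in> off_diagonal S T" for u v
      using that linear_operatorD(3)[OF lS] linear_operatorD(3)[OF lT]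
      by (auto simp: off_diagonal_def split: prod.splits)
    show "c *\<^sub>C u \<in> off_diagonal S T" if "u \<in> off_diagonal S T" for u c
      using that linear_operatorD(4)[OF lS] linear_operatorD(4)[OF lT]
      by (auto simp: off_diagonal_def scaleC_prod_def split: prod.splits)
  qed
  have "Domain (off_diagonal S T) = Domain T \<times> Domain S"
    by (auto simp: off_diagonal_def Domain_iff)
  then have dense: "closure (Domain (off_diagonal S T)) = UNIV"
    using S T by (simp add: closure_Times densely_defined_def)
  have S': "(y, z) \<in> S \<longleftrightarrow> (\<forall>(x, w)\<in>T. cinner w y = cinner x z)" for y z
    unfolding adj(2)[symmetric] op_adjoint_def by simp
  have T': "(y, z) \<in> T \<longleftrightarrow> (\<forall>(x, w)\<in>S. cinner w y = cinner x z)" for y z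
    unfolding adj(1)[symmetric] op_adjoint_def by simp
  have z: "cinner 0 x = 0" for x :: "'z::chilbert_space" using cinner_add_left[of 0 0 x] by simp
  have "op_adjoint (off_diagonal S T) = off_diagonal S T"
  proof (intro set_eqI iffI)
    fix p
    assume p: "p \<in> op_adjoint (off_diagonal S T)"
    obtain y1 y2 z1 z2 where pe: "p = ((y1, y2), (z1, z2))" by (metis surj_pair)
    have eq: "cinner u1 y1 + cinner u2 y2 = cinner x1 z1 + cinner x2 z2"
      if "(x2, u1) \<in> S" "(x1, u2) \<in> T" for x1 x2 u1 u2
      using p that by (auto simp: pe op_adjoint_def off_diagonal_def cinner_prod_def)
    have "(y1, z2) \<in> T"
      unfolding T' using eq[OF _ linear_operatorD(2)[OF lT]] by (auto simp: z)
    moreover have "(y2, z1) \<in> S"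
      unfolding S' using eq[OF linear_operatorD(2)[OF lS]] by (auto simp: z)
    ultimately show "p \<in> off_diagonal S T" by (simp add: pe off_diagonal_def)
  next
    fix p
    assume "p \<in> off_diagonal S T"
    then obtain y1 y2 z1 z2 where pe: "p = ((y1, y2), (z1, z2))" "(y2, z1) \<in> S" "(y1, z2) \<in> T"
      by (auto simp: off_diagonal_def)
    have "cinner u1 y1 + cinner u2 y2 = cinner x1 z1 + cinner x2 z2"
      if "(x2, u1) \<in> S" "(x1, u2) \<in> T" for x1 x2 u1 u2
    proof -
      have "cinner u1 y1 = cinner x2 z2" using pe(3) that(1) unfolding T' by auto
      moreover have "cinner u2 y2 = cinner x1 z1" using pe(2) that(2) unfolding S' by auto
      ultimately show ?thesis by simp
    qed
    then show "p \<in> op_adjoint (off_diagonal S T)"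
      by (auto simp: pe(1) op_adjoint_def off_diagonal_def cinner_prod_def)
  qed
  then show ?thesis
    unfolding selfadjoint_operator_def densely_defined_def using lin dense by simp
qed

text \<open>The operators \<open>D \<otimes> 1 + c \<otimes> M\<close> for \<open>c = \<plusminus>\<i>\<close> are mutually adjoint corners of the Dirac operator.\<close>

definition dirac_corner :: "complex \<Rightarrow> ('h::chilbert_space \<times> 'h) set \<Rightarrow> ('h l2Z \<times> 'h l2Z) set"
  where "dirac_corner c D = op_add (tensor_one D) (op_scaleC c (one_tensor_mult id))"

lemma crossed_dirac_eq: "crossed_dirac D = off_diagonal (dirac_corner (- \<i>) D) (dirac_corner \<i> D)"
  by (simp add: crossed_dirac_def dirac_corner_def)

locale selfadjoint_operator_on =
  fixes D :: "('h::chilbert_space \<times> 'h) set"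
  assumes selfadjoint: "selfadjoint_operator D"
begin

lemma D_linear: "linear_operator D" and D_dense: "closure (Domain D) = UNIV"
  using selfadjoint by (simp_all add: selfadjoint_operator_def densely_defined_def)

lemma D_iff: "(y, z) \<in> D \<longleftrightarrow> (\<forall>(x, w)\<in>D. cinner w y = cinner x z)"
proof -
  have "(y, z) \<in> D \<longleftrightarrow> (y, z) \<in> op_adjoint D"
    using selfadjoint by (simp add: selfadjoint_operator_def)
  then show ?thesis by (simp add: op_adjoint_def)
qed

lemma D_symmetric: "(x, w) \<in> D \<Longrightarrow> (y, z) \<in> D \<Longrightarrow> cinner w y = cinner x z"
  using D_iff[of y z] by blast

text \<open>As \<open>D\<close> is symmetric, \<open>D x\<close> is orthogonal to imaginary multiples of \<open>x\<close> for the real inner product.\<close>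

lemma norm_corner:
  assumes "(x, w) \<in> D" and c: "Re c = 0"
  shows "(norm (w + c *\<^sub>C x))\<^sup>2 = (norm w)\<^sup>2 + (norm (c *\<^sub>C x))\<^sup>2"
proof -
  have "cnj (cinner w x) = cinner w x"
    using D_symmetric[OF assms(1,1)] cinner_commute[of x w] by simp
  then have "Im (cinner w x) = 0" by (simp add: complex_eq_iff)
  then have "inner w (c *\<^sub>C x) = 0"
    using c by (simp add: inner_eq_Re_cinner cinner_scaleC_right)
  then show ?thesis
    by (simp add: power2_norm_eq_inner inner_add_left inner_add_right inner_commute)
qed

text \<open>
  Membership can be checked in each coordinate: by orthogonality, square-summability of the vectors
  \<open>(D + c n) u\<^sub>n\<close> forces that of \<open>D u\<^sub>n\<close> and of \<open>n u\<^sub>n\<close>, so that \<open>u\<close> is in the domains of both summands.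
\<close>

lemma dirac_corner_iff:
  assumes c: "c \<in> {\<i>, - \<i>}"
  shows "(u, v) \<in> dirac_corner c D \<longleftrightarrow>
    (\<forall>n. (coord u n, coord v n - (c * of_int n) *\<^sub>C coord u n) \<in> D)" (is "_ \<longleftrightarrow> ?R")
proof
  assume "(u, v) \<in> dirac_corner c D"
  then obtain y z where "v = y + c *\<^sub>C z" "\<forall>n. (coord u n, coord y n) \<in> D"
    "\<forall>n. coord z n = of_int n *\<^sub>C coord u n"
    by (auto simp: dirac_corner_def op_add_def op_scaleC_def tensor_one_def one_tensor_mult_def)
  then show ?R by (simp add: scaleC_scaleC)
next
  assume R: ?R
  define w where "w n = coord v n - (c * of_int n) *\<^sub>C coord u n" for n
  have D: "(coord u n, w n) \<in> D" for n using R by (simp add: w_def)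
  have v: "coord v n = w n + (c * of_int n) *\<^sub>C coord u n" for n by (simp add: w_def)
  have sq: "(norm (coord v n))\<^sup>2 = (norm (w n))\<^sup>2 + (norm ((c * of_int n) *\<^sub>C coord u n))\<^sup>2" for n
    unfolding v by (rule norm_corner[OF D]) (use c in auto)
  have sumv: "(\<Sum>n\<in>F. (norm (coord v n))\<^sup>2) \<le> (norm v)\<^sup>2" if "finite F" for F
    using sum_coord_le_norm[OF that] .
  have cw: "coord (l2Z w) = w"
  proof (rule l2Z_boundI(1)[where b="norm v"])
    fix F :: "int set"
    assume F: "finite F"
    have "(\<Sum>n\<in>F. (norm (w n))\<^sup>2) \<le> (\<Sum>n\<in>F. (norm (coord v n))\<^sup>2)"
      by (rule sum_mono) (simp add: sq)
    then show "(\<Sum>n\<in>F. (norm (w n))\<^sup>2) \<le> (norm v)\<^sup>2" using sumv[OF F] by linarith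
  qed simp
  show "(u, v) \<in> dirac_corner c D"
  proof -
    have "c \<noteq> 0" using c by auto
    define z where "z n = of_int n *\<^sub>C coord u n" for n
    have cz: "coord (l2Z z) = z"
    proof (rule l2Z_boundI(1)[where b="norm v / cmod c"])
      fix F :: "int set"
      assume F: "finite F"
      have "(cmod c)\<^sup>2 * (\<Sum>n\<in>F. (norm (z n))\<^sup>2) = (\<Sum>n\<in>F. (norm ((c * of_int n) *\<^sub>C coord u n))\<^sup>2)"
        unfolding sum_distrib_left z_def
        by (simp add: norm_scaleC_hilbert power_mult_distrib norm_mult mult.assoc)
      also have "\<dots> \<le> (\<Sum>n\<in>F. (norm (coord v n))\<^sup>2)" by (rule sum_mono) (simp add: sq)
      finally have "(cmod c)\<^sup>2 * (\<Sum>n\<in>F. (norm (z n))\<^sup>2) \<le> (norm v)\<^sup>2" using sumv[OF F] by linarith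
      then show "(\<Sum>n\<in>F. (norm (z n))\<^sup>2) \<le> (norm v / cmod c)\<^sup>2"
        using \<open>c \<noteq> 0\<close> by (simp add: power_divide field_simps)
    qed simp
    have "v = l2Z w + c *\<^sub>C l2Z z"
      by (rule l2Z_eqI) (simp add: cw cz v z_def scaleC_scaleC)
    moreover have "(u, l2Z w) \<in> tensor_one D" by (simp add: tensor_one_def cw D)
    moreover have "(u, l2Z z) \<in> one_tensor_mult id" by (simp add: one_tensor_mult_def cz z_def)
    ultimately show ?thesis
      unfolding dirac_corner_def op_add_def op_scaleC_def by blast
  qed
qed

lemma tensor_delta_in_dirac_corner:
  assumes c: "c \<in> {\<i>, - \<i>}" and "(\<xi>, \<eta>) \<in> D"
  shows "(\<xi> \<otimes>\<delta> n, (\<eta> + (c * of_int n) *\<^sub>C \<xi>) \<otimes>\<delta> n) \<in> dirac_corner c D"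
  unfolding dirac_corner_iff[OF c] using assms(2) linear_operatorD(2)[OF D_linear]
  by (simp add: coord_tensor_delta)

lemma densely_defined_dirac_corner:
  assumes c: "c \<in> {\<i>, - \<i>}"
  shows "densely_defined (dirac_corner c D)"
proof -
  have neg: "(c * n) *\<^sub>C (x + y) = (c * n) *\<^sub>C x + (c * n) *\<^sub>C y" for n and x y :: 'h
    by (rule scaleC_add_right)
  have add: "(u + x, v + y) \<in> dirac_corner c D"
    if "(u, v) \<in> dirac_corner c D" "(x, y) \<in> dirac_corner c D" for u v x y
    using that linear_operatorD(3)[OF D_linear] unfolding dirac_corner_iff[OF c]
    by (simp add: neg) (metis (no_types, lifting) add_diff_add)
  have sc: "(k *\<^sub>C u, k *\<^sub>C v) \<in> dirac_corner c D" if "(u, v) \<in> dirac_corner c D" for u v k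
    unfolding dirac_corner_iff[OF c]
  proof
    fix n
    have "(k *\<^sub>C coord u n, k *\<^sub>C (coord v n - (c * of_int n) *\<^sub>C coord u n)) \<in> D"
      using that linear_operatorD(4)[OF D_linear] unfolding dirac_corner_iff[OF c] by blast
    then show "(coord (k *\<^sub>C u) n, coord (k *\<^sub>C v) n - (c * of_int n) *\<^sub>C coord (k *\<^sub>C u) n) \<in> D"
      by (simp add: scaleC_diff_right scaleC_scaleC mult.commute mult.left_commute)
  qed
  have zero: "(0, 0) \<in> dirac_corner c D"
    unfolding dirac_corner_iff[OF c] using linear_operatorD(2)[OF D_linear] by simp
  have sv: "single_valued (dirac_corner c D)"
  proof (rule single_valuedI)
    fix u v w
    assume "(u, v) \<in> dirac_corner c D" "(u, w) \<in> dirac_corner c D"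
    then have "coord v n - (c * of_int n) *\<^sub>C coord u n = coord w n - (c * of_int n) *\<^sub>C coord u n" for n
      using linear_operatorD(1)[OF D_linear] unfolding dirac_corner_iff[OF c] single_valued_def by blast
    then show "v = w" by (intro l2Z_eqI) simp
  qed
  have "linear_operator (dirac_corner c D)"
    unfolding linear_operator_def
  proof (intro conjI ballI allI)
    show "u + v \<in> dirac_corner c D" if "u \<in> dirac_corner c D" "v \<in> dirac_corner c D" for u v
      using add[of "fst u" "snd u" "fst v" "snd v"] that by (cases u, cases v) simp
    show "k *\<^sub>C u \<in> dirac_corner c D" if "u \<in> dirac_corner c D" for u k
      using sc[of "fst u" "snd u" k] that by (cases u) (simp add: scaleC_prod_def)
  qed (use sv zero in simp_all)
  moreover have "closure (Domain (dirac_corner c D)) = UNIV"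
  proof (rule dense_l2Z)
    show "x + y \<in> Domain (dirac_corner c D)"
      if "x \<in> Domain (dirac_corner c D)" "y \<in> Domain (dirac_corner c D)" for x y
      using that add unfolding Domain_iff by blast
    show "0 \<in> Domain (dirac_corner c D)" using zero by blast
    show "\<xi> \<otimes>\<delta> n \<in> closure (Domain (dirac_corner c D))" for \<xi> n
    proof (rule closure_bounded_linear_image[OF bounded_linear_tensor_delta, of "Domain D"])
      show "\<zeta> \<otimes>\<delta> n \<in> closure (Domain (dirac_corner c D))" if "\<zeta> \<in> Domain D" for \<zeta>
        using that tensor_delta_in_dirac_corner[OF c] closure_subset by blast
    qed (simp add: D_dense)
  qed
  ultimately show ?thesis by (simp add: densely_defined_def)
qed

text \<open>
  Vectors supported at a single coordinate reduce the inclusion from left to right to the selfadjointness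
  of \<open>D\<close>; the other inclusion is the symmetry of \<open>D\<close> in every coordinate.
\<close>

lemma adjoint_dirac_corner:
  assumes c: "c \<in> {\<i>, - \<i>}"
  shows "op_adjoint (dirac_corner c D) = dirac_corner (- c) D"
proof (intro set_eqI iffI; clarify)
  fix y z
  assume adj: "(y, z) \<in> op_adjoint (dirac_corner c D)"
  have c': "- c \<in> {\<i>, - \<i>}" using c by auto
  have cc: "cnj c = - c" using c by auto
  have coord_cinner: "cinner (\<xi> \<otimes>\<delta> n) u = cinner \<xi> (coord u n)" for \<xi> :: 'h and n u
  proof -
    have zl: "cinner 0 x = 0" for x :: 'h using cinner_add_left[of 0 0 x] by simp
    have "((\<lambda>k. cinner (coord (\<xi> \<otimes>\<delta> n) k) (coord u k)) has_sum cinner \<xi> (coord u n)) UNIV"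
      by (rule has_sum_finite_neutralI[of "{n}"]) (auto simp: coord_tensor_delta zl)
    then show ?thesis by (simp add: cinner_l2Z_def infsumI)
  qed
  show "(y, z) \<in> dirac_corner (- c) D"
    unfolding dirac_corner_iff[OF c']
  proof
    fix n
    have "cinner w (coord y n) = cinner x (coord z n - (- c * of_int n) *\<^sub>C coord y n)"
      if "(x, w) \<in> D" for x w
    proof -
      have "cinner ((w + (c * of_int n) *\<^sub>C x) \<otimes>\<delta> n) y = cinner (x \<otimes>\<delta> n) z"
        using adj tensor_delta_in_dirac_corner[OF c that, of n] unfolding op_adjoint_def by blast
      then have "cinner w (coord y n) + c * of_int n * cinner x (coord y n) = cinner x (coord z n)"
        by (simp add: coord_cinner cinner_add_left cinner_scaleC_left)
      moreover have "cinner x (coord z n) = cinner x (coord z n - (- c * of_int n) *\<^sub>C coord y n)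
          + cinner x ((- c * of_int n) *\<^sub>C coord y n)"
        unfolding cinner_add_right[symmetric] by simp
      ultimately show ?thesis by (simp add: cinner_scaleC_right cc)
    qed
    then have "\<forall>(x, w)\<in>D. cinner w (coord y n) = cinner x (coord z n - (- c * of_int n) *\<^sub>C coord y n)"
      by blast
    then show "(coord y n, coord z n - (- c * of_int n) *\<^sub>C coord y n) \<in> D" unfolding D_iff .
  qed
next
  fix y z
  assume yz: "(y, z) \<in> dirac_corner (- c) D"
  have c': "- c \<in> {\<i>, - \<i>}" using c by auto
  have cc: "cnj c = - c" using c by auto
  have "cinner w y = cinner x z" if xw: "(x, w) \<in> dirac_corner c D" for x w
    unfolding cinner_l2Z_def
  proof (rule infsum_cong)
    fix n :: int
    let ?w = "coord w n - (c * of_int n) *\<^sub>C coord x n"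
    let ?z = "coord z n - (- c * of_int n) *\<^sub>C coord y n"
    have "cinner ?w (coord y n) = cinner (coord x n) ?z"
      using xw yz unfolding dirac_corner_iff[OF c] dirac_corner_iff[OF c'] by (intro D_symmetric) auto
    moreover have "cinner (coord w n) (coord y n) =
        cinner ?w (coord y n) + cinner ((c * of_int n) *\<^sub>C coord x n) (coord y n)"
      unfolding cinner_add_left[symmetric] by simp
    moreover have "cinner (coord x n) (coord z n) =
        cinner (coord x n) ?z + cinner (coord x n) ((- c * of_int n) *\<^sub>C coord y n)"
      unfolding cinner_add_right[symmetric] by simp
    ultimately show "cinner (coord w n) (coord y n) = cinner (coord x n) (coord z n)"
      by (simp add: cinner_scaleC_left cinner_scaleC_right cc)
  qed
  then show "(y, z) \<in> op_adjoint (dirac_corner c D)" unfolding op_adjoint_def by blast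
qed

lemma selfadjoint_crossed_dirac: "selfadjoint_operator (crossed_dirac D)"
  unfolding crossed_dirac_eq
  by (intro selfadjoint_off_diagonal densely_defined_dirac_corner) (simp_all add: adjoint_dirac_corner)

end

section \<open>Compact operators\<close>

lemma compact_bop_iff: "compact_bop T \<longleftrightarrow> totally_bounded ((\<lambda>x. T \<bullet>\<^sub>o x) ` cball 0 1)"
proof -
  let ?X = "(\<lambda>x. T \<bullet>\<^sub>o x) ` cball 0 1"
  have tb: "(\<forall>e>0. \<exists>k. finite k \<and> S \<subseteq> (\<Union>x\<in>k. ball x e)) \<longleftrightarrow> totally_bounded S" for S :: "'a set"
    by (simp add: totally_bounded_metric ball_def)
  have "totally_bounded (closure ?X)" if X: "totally_bounded ?X"
    unfolding totally_bounded_iff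
  proof (intro allI impI)
    fix e :: real
    assume e: "0 < e"
    then have e2: "0 < e / 2" by simp
    obtain Z where Z: "finite Z" "\<And>x. x \<in> ?X \<Longrightarrow> \<exists>z\<in>Z. dist x z < e / 2"
      by (rule totally_boundedE[OF X e2]) (rule that)
    have "\<exists>z\<in>Z. dist y z < e" if y: "y \<in> closure ?X" for y
    proof -
      obtain x where x: "x \<in> ?X" "dist x y < e / 2" using y e2 closure_approachable by blast
      obtain z where z: "z \<in> Z" "dist x z < e / 2" using Z(2)[OF x(1)] by blast
      have "dist y z < e"
        by (rule dist_triangle_half_r[OF x(2) z(2)])
      then show ?thesis using z(1) by blast
    qed
    then show "\<exists>Z. finite Z \<and> (\<forall>x\<in>closure ?X. \<exists>z\<in>Z. dist x z < e)" using Z(1) by blast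
  qed
  moreover have "totally_bounded ?X" if "totally_bounded (closure ?X)"
    using that closure_subset by (rule totally_bounded_subset)
  moreover have "complete (closure ?X)" by (simp add: complete_eq_closed)
  ultimately show ?thesis unfolding compact_bop_def compact_eq_totally_bounded tb by blast
qed

lemma compact_bop_0: "compact_bop 0"
  unfolding compact_bop_iff totally_bounded_iff by (intro allI impI exI[of _ "{0}"]) simp

lemma compact_bop_add:
  assumes "compact_bop S" "compact_bop T"
  shows "compact_bop (S + T)"
proof -
  have "(\<lambda>x. (S + T) \<bullet>\<^sub>o x) ` cball 0 1 \<subseteq> {x + y |x y. x \<in> (\<lambda>x. S \<bullet>\<^sub>o x) ` cball 0 1 \<and>
      y \<in> (\<lambda>x. T \<bullet>\<^sub>o x) ` cball 0 1}" by auto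
  then show ?thesis
    using totally_bounded_add[OF assms[unfolded compact_bop_iff]] unfolding compact_bop_iff
    by (rule totally_bounded_subset[rotated])
qed

lemma compact_bop_sum:
  assumes "\<And>i. i \<in> I \<Longrightarrow> compact_bop (f i)"
  shows "compact_bop (\<Sum>i\<in>I. f i)"
  using assms by (induction I rule: infinite_finite_induct) (auto intro: compact_bop_0 compact_bop_add)

lemma lipschitz_bop: "dist (T \<bullet>\<^sub>o x) (T \<bullet>\<^sub>o y) \<le> norm T * dist x y"
  using norm_bop_app[of T "x - y"] by (simp add: dist_norm bop_app_linear)

lemma compact_bop_mult_left:
  assumes "compact_bop T"
  shows "compact_bop (B * T)"
  using totally_bounded_lipschitz_image[OF assms[unfolded compact_bop_iff] lipschitz_bop[of B]]
  unfolding compact_bop_iff by (simp add: image_image)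

lemma compact_bop_mult_right:
  assumes "compact_bop T"
  shows "compact_bop (T * B)"
proof -
  define k where "k = norm B + 1"
  have k: "0 < k" by (simp add: k_def add_nonneg_pos)
  have "totally_bounded ((\<lambda>y. k *\<^sub>R y) ` (\<lambda>x. T \<bullet>\<^sub>o x) ` cball 0 1)"
    using k by (intro totally_bounded_lipschitz_image[OF assms[unfolded compact_bop_iff], where k=k])
      (simp add: dist_norm flip: scaleR_diff_right)
  moreover have "(\<lambda>x. (T * B) \<bullet>\<^sub>o x) ` cball 0 1 \<subseteq> (\<lambda>y. k *\<^sub>R y) ` (\<lambda>x. T \<bullet>\<^sub>o x) ` cball 0 1"
  proof
    fix y
    assume "y \<in> (\<lambda>x. (T * B) \<bullet>\<^sub>o x) ` cball 0 1"
    then obtain x where x: "norm x \<le> 1" "y = T \<bullet>\<^sub>o (B \<bullet>\<^sub>o x)" by auto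
    have "norm (B \<bullet>\<^sub>o x) \<le> norm B * 1"
      using norm_bop_app[of B x] mult_left_mono[OF x(1), of "norm B"] by simp
    then have "norm ((1 / k) *\<^sub>R (B \<bullet>\<^sub>o x)) \<le> 1" using k by (simp add: k_def)
    moreover have "y = k *\<^sub>R (T \<bullet>\<^sub>o ((1 / k) *\<^sub>R (B \<bullet>\<^sub>o x)))"
      using k by (simp add: x(2) bop_app_linear)
    ultimately show "y \<in> (\<lambda>y. k *\<^sub>R y) ` (\<lambda>x. T \<bullet>\<^sub>o x) ` cball 0 1"
      by (intro image_eqI[of y _ "T \<bullet>\<^sub>o ((1 / k) *\<^sub>R (B \<bullet>\<^sub>o x))"] imageI) simp_all
  qed
  ultimately show ?thesis unfolding compact_bop_iff by (rule totally_bounded_subset)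
qed

lemma scaleR_bop_app: "(r *\<^sub>R T) \<bullet>\<^sub>o x = r *\<^sub>R (T \<bullet>\<^sub>o x)"
  by (simp add: scaleR_scaleC bop_app_scaleC_left)

lemma compact_bop_scaleR:
  assumes "compact_bop T"
  shows "compact_bop (r *\<^sub>R T)"
proof -
  show ?thesis using compact_bop_mult_left[OF assms, of "r *\<^sub>R 1"] by simp
qed

lemma compact_bop_limit:
  assumes "\<And>e. 0 < e \<Longrightarrow> \<exists>K. compact_bop K \<and> norm (T - K) \<le> e"
  shows "compact_bop T"
  unfolding compact_bop_iff totally_bounded_iff
proof (intro allI impI)
  fix e :: real
  assume "0 < e"
  then have e2: "0 < e / 2" by simp
  obtain K where K: "compact_bop K" "norm (T - K) \<le> e / 2" using assms[OF e2] by blast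
  obtain Z where Z: "finite Z" "\<And>x. x \<in> (\<lambda>x. K \<bullet>\<^sub>o x) ` cball 0 1 \<Longrightarrow> \<exists>z\<in>Z. dist x z < e / 2"
    by (rule totally_boundedE[OF K(1)[unfolded compact_bop_iff] e2]) (rule that)
  have "\<exists>z\<in>Z. dist (T \<bullet>\<^sub>o x) z < e" if x: "norm x \<le> 1" for x
  proof -
    obtain z where z: "z \<in> Z" "dist (K \<bullet>\<^sub>o x) z < e / 2" using Z(2)[of "K \<bullet>\<^sub>o x"] x by auto
    have "norm ((T - K) \<bullet>\<^sub>o x) \<le> norm (T - K) * 1"
      using norm_bop_app[of "T - K" x] mult_left_mono[OF x, of "norm (T - K)"] by simp
    then have "dist (T \<bullet>\<^sub>o x) (K \<bullet>\<^sub>o x) \<le> e / 2" using K(2) by (simp add: dist_norm)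
    then have "dist (T \<bullet>\<^sub>o x) z < e" using z(2) dist_triangle[of "T \<bullet>\<^sub>o x" z "K \<bullet>\<^sub>o x"] by linarith
    then show ?thesis using z(1) by blast
  qed
  then have "\<forall>y\<in>(\<lambda>x. T \<bullet>\<^sub>o x) ` cball 0 1. \<exists>z\<in>Z. dist y z < e" by simp
  then show "\<exists>Z. finite Z \<and> (\<forall>y\<in>(\<lambda>x. T \<bullet>\<^sub>o x) ` cball 0 1. \<exists>z\<in>Z. dist y z < e)"
    using Z(1) by blast
qed

lemma dist_tensor_delta: "dist (\<xi> \<otimes>\<delta> n) (\<eta> \<otimes>\<delta> n) = dist \<xi> (\<eta> :: 'h::chilbert_space)"
  unfolding dist_norm
  by (simp add: linear_diff[OF bounded_linear.linear[OF bounded_linear_tensor_delta], symmetric])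

text \<open>
  The operator is the limit in norm of its truncations to finitely many coordinates.
\<close>

lemma compact_band:
  assumes K: "\<And>n. compact_bop (K n)" and small: "\<And>e. 0 < e \<Longrightarrow> finite {n. \<not> norm (K n) \<le> e}"
    and b: "\<And>n. norm (K n) \<le> b"
  shows "compact_bop (band K 0)"
proof (rule compact_bop_limit)
  fix e :: real
  assume e: "0 < e"
  have b0: "0 \<le> b" using b[of 0] norm_ge_zero order_trans by blast
  define F where "F = {n. \<not> norm (K n) \<le> e}"
  define E where "E j = band (\<lambda>n. if n = j then K n else 0) 0" for j
  have cE: "coord (E j \<bullet>\<^sub>o u) n = (if n = j then K n \<bullet>\<^sub>o coord u n else 0)" for j u n
    unfolding E_def by (subst coord_band[where b=b]) (use b b0 in auto)
  have "compact_bop (E j)" for j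
  proof -
    have "(\<lambda>x. E j \<bullet>\<^sub>o x) ` cball 0 1 \<subseteq> (\<lambda>\<xi>. \<xi> \<otimes>\<delta> j) ` (\<lambda>x. K j \<bullet>\<^sub>o x) ` cball 0 1"
    proof
      fix v
      assume "v \<in> (\<lambda>x. E j \<bullet>\<^sub>o x) ` cball 0 1"
      then obtain u where u: "norm u \<le> 1" "v = E j \<bullet>\<^sub>o u" by auto
      have "v = (K j \<bullet>\<^sub>o coord u j) \<otimes>\<delta> j"
        unfolding u(2) by (rule l2Z_eqI) (simp add: cE coord_tensor_delta)
      moreover have "norm (coord u j) \<le> 1" using norm_coord_le[of u j] u(1) by linarith
      ultimately show "v \<in> (\<lambda>\<xi>. \<xi> \<otimes>\<delta> j) ` (\<lambda>x. K j \<bullet>\<^sub>o x) ` cball 0 1" by simp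
    qed
    moreover have "totally_bounded ((\<lambda>\<xi>. \<xi> \<otimes>\<delta> j) ` (\<lambda>x. K j \<bullet>\<^sub>o x) ` cball 0 1)"
      by (rule totally_bounded_lipschitz_image[OF K[unfolded compact_bop_iff], where k=1])
        (simp add: dist_tensor_delta)
    ultimately show ?thesis unfolding compact_bop_iff by (rule totally_bounded_subset[rotated])
  qed
  then have "compact_bop (\<Sum>j\<in>F. E j)" by (rule compact_bop_sum)
  moreover have "norm (band K 0 - (\<Sum>j\<in>F. E j)) \<le> e"
  proof -
    have F: "finite F" unfolding F_def by (rule small[OF e])
    have le: "norm (if n \<in> F then 0 else K n) \<le> e" for n using e by (auto simp: F_def)
    have "band K 0 - (\<Sum>j\<in>F. E j) = band (\<lambda>n. if n \<in> F then 0 else K n) 0"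
    proof (intro bop_eqI l2Z_eqI)
      fix u n
      have "coord ((\<Sum>j\<in>F. E j) \<bullet>\<^sub>o u) n = (\<Sum>j\<in>F. if n = j then K n \<bullet>\<^sub>o coord u n else 0)"
        by (simp add: bop_app_sum coord_sum cE)
      also have "\<dots> = (if n \<in> F then K n \<bullet>\<^sub>o coord u n else 0)" using F by simp
      finally show "coord ((band K 0 - (\<Sum>j\<in>F. E j)) \<bullet>\<^sub>o u) n =
          coord (band (\<lambda>n. if n \<in> F then 0 else K n) 0 \<bullet>\<^sub>o u) n"
        by (simp add: coord_band[OF b] coord_band[of "\<lambda>n. if n \<in> F then 0 else K n", OF le])
    qed
    then show ?thesis using norm_band_le[of "\<lambda>n. if n \<in> F then 0 else K n", OF le] by simp
  qed
  ultimately show "\<exists>K'. compact_bop K' \<and> norm (band K 0 - K') \<le> e" by blast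
qed

lemma compact_direct_sum:
  fixes S :: "'h::chilbert_space bop" and T :: "'k::chilbert_space bop"
  assumes "compact_bop S" "compact_bop T"
  shows "compact_bop (S \<oplus>\<^sub>o T)"
proof -
  let ?X = "(\<lambda>y. (y, 0::'k)) ` (\<lambda>x. S \<bullet>\<^sub>o x) ` cball 0 1"
  let ?Y = "(\<lambda>y. (0::'h, y)) ` (\<lambda>x. T \<bullet>\<^sub>o x) ` cball 0 1"
  have "totally_bounded (?X)"
    by (rule totally_bounded_lipschitz_image[OF assms(1)[unfolded compact_bop_iff], where k=1])
      (simp add: dist_Pair_Pair)
  moreover have "totally_bounded (?Y)"
    by (rule totally_bounded_lipschitz_image[OF assms(2)[unfolded compact_bop_iff], where k=1])
      (simp add: dist_Pair_Pair)
  ultimately have tb: "totally_bounded {x + y |x y. x \<in> ?X \<and>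
      y \<in> ?Y}"
    by (rule totally_bounded_add)
  show ?thesis
    unfolding compact_bop_iff
  proof (rule totally_bounded_subset[OF tb], rule subsetI)
    fix w
    assume "w \<in> (\<lambda>x. (S \<oplus>\<^sub>o T) \<bullet>\<^sub>o x) ` cball 0 1"
    then obtain z where z: "norm z \<le> 1" "w = (S \<bullet>\<^sub>o fst z, T \<bullet>\<^sub>o snd z)"
      by (auto simp: direct_sum_bop_app)
    have "norm (fst z) \<le> 1" "norm (snd z) \<le> 1"
      using z(1) norm_fst_le[of "fst z" "snd z"] norm_snd_le[of "snd z" "fst z"]
      unfolding prod.collapse by linarith+
    then have "(S \<bullet>\<^sub>o fst z, 0) \<in> ?X"
      "(0, T \<bullet>\<^sub>o snd z) \<in> ?Y" by simp_all
    moreover have "w = (S \<bullet>\<^sub>o fst z, 0) + (0, T \<bullet>\<^sub>o snd z)" by (simp add: z(2))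
    ultimately show "w \<in> {x + y |x y. x \<in> ?X \<and>
      y \<in> ?Y}" by blast
  qed
qed

section \<open>The resolvent of the Dirac operator\<close>

context selfadjoint_operator_on
begin

text \<open>
  \<open>R = (1 + m + D\<^sup>2)\<^sup>-\<^sup>1\<close>: the first conjunct says that \<open>R\<close> is a right inverse, the second that it is a
  left inverse.
\<close>

definition resolvent :: "real \<Rightarrow> 'h bop \<Rightarrow> bool"
  where "resolvent m R \<longleftrightarrow>
    (\<forall>z. \<exists>w. (R \<bullet>\<^sub>o z, w) \<in> D \<and> (w, z - (1 + m) *\<^sub>R (R \<bullet>\<^sub>o z)) \<in> D) \<and>
    (\<forall>x w v. (x, w) \<in> D \<and> (w, v) \<in> D \<longrightarrow> R \<bullet>\<^sub>o (v + (1 + m) *\<^sub>R x) = x)"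

lemma inner_square:
  assumes "(x, w) \<in> D" "(w, v) \<in> D"
  shows "inner v x = (norm w)\<^sup>2"
  using D_symmetric[OF assms(2,1)] by (simp add: inner_eq_Re_cinner cinner_self)

lemma resolvent_0:
  assumes S: "is_inverse_sqrt_one_plus_square S D"
  shows "resolvent 0 (S * S)"
proof -
  have g: "bop_graph (S * S) = (op_add Id (D O D))\<inverse>"
    using S by (simp add: is_inverse_sqrt_one_plus_square_def)
  have "\<exists>w. ((S * S) \<bullet>\<^sub>o z, w) \<in> D \<and> (w, z - (S * S) \<bullet>\<^sub>o z) \<in> D" for z
  proof -
    have "(z, (S * S) \<bullet>\<^sub>o z) \<in> bop_graph (S * S)" by (auto simp: bop_graph_def)
    then have "((S * S) \<bullet>\<^sub>o z, z) \<in> op_add Id (D O D)" unfolding g by (rule converseD)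
    then obtain v where "((S * S) \<bullet>\<^sub>o z, v) \<in> D O D" "z = (S * S) \<bullet>\<^sub>o z + v"
      unfolding op_add_def by blast
    then show ?thesis by (metis add_diff_cancel_left' relcompE prod.inject)
  qed
  moreover have "(S * S) \<bullet>\<^sub>o (v + x) = x" if "(x, w) \<in> D" "(w, v) \<in> D" for x w v
  proof -
    have "(x, x + v) \<in> op_add Id (D O D)" using that by (auto simp: op_add_def)
    then have "(x + v, x) \<in> bop_graph (S * S)" unfolding g by simp
    then show ?thesis by (auto simp: bop_graph_def add.commute)
  qed
  ultimately show ?thesis unfolding resolvent_def add_0_right scaleR_one by blast
qed

text \<open>
  \<open>(1 + m + D\<^sup>2)\<^sup>-\<^sup>1 = R\<^sub>0 (1 + m R\<^sub>0)\<^sup>-\<^sup>1\<close> for \<open>R\<^sub>0 = (1 + D\<^sup>2)\<^sup>-\<^sup>1\<close>.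
\<close>

lemma resolvent_shift:
  assumes R0: "resolvent 0 R0" and "(1 + m *\<^sub>R R0) * R = R0" "R * (1 + m *\<^sub>R R0) = R0"
  shows "resolvent m R"
  unfolding resolvent_def
proof (intro conjI allI impI)
  fix z
  have 1: "R0 \<bullet>\<^sub>o z = R \<bullet>\<^sub>o z + m *\<^sub>R (R0 \<bullet>\<^sub>o R \<bullet>\<^sub>o z)"
    using arg_cong[OF assms(2), of "\<lambda>T. T \<bullet>\<^sub>o z"] by (simp add: scaleR_bop_app)
  have "R0 \<bullet>\<^sub>o (z - m *\<^sub>R (R \<bullet>\<^sub>o z)) = R \<bullet>\<^sub>o z" by (simp add: bop_app_linear 1)
  moreover obtain w where "(R0 \<bullet>\<^sub>o (z - m *\<^sub>R (R \<bullet>\<^sub>o z)), w) \<in> D"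
    "(w, (z - m *\<^sub>R (R \<bullet>\<^sub>o z)) - (1 + 0) *\<^sub>R (R0 \<bullet>\<^sub>o (z - m *\<^sub>R (R \<bullet>\<^sub>o z)))) \<in> D"
    using R0 unfolding resolvent_def by blast
  ultimately have "(R \<bullet>\<^sub>o z, w) \<in> D \<and> (w, z - (1 + m) *\<^sub>R (R \<bullet>\<^sub>o z)) \<in> D"
    by (simp add: scaleR_add_left diff_diff_eq add.commute)
  then show "\<exists>w. (R \<bullet>\<^sub>o z, w) \<in> D \<and> (w, z - (1 + m) *\<^sub>R (R \<bullet>\<^sub>o z)) \<in> D" by blast
next
  fix x w v
  assume "(x, w) \<in> D \<and> (w, v) \<in> D"
  then have x: "R0 \<bullet>\<^sub>o (v + x) = x" using R0 unfolding resolvent_def by fastforce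
  have "v + (1 + m) *\<^sub>R x = (1 + m *\<^sub>R R0) \<bullet>\<^sub>o (v + x)"
    by (simp add: scaleR_bop_app x scaleR_add_left add.assoc)
  then have "R \<bullet>\<^sub>o (v + (1 + m) *\<^sub>R x) = (R * (1 + m *\<^sub>R R0)) \<bullet>\<^sub>o (v + x)"
    by (simp add: add.assoc)
  then show "R \<bullet>\<^sub>o (v + (1 + m) *\<^sub>R x) = x" unfolding assms(3) x .
qed

text \<open>
  \<open>(1 + m) \<parallel>R z\<parallel>\<^sup>2 \<le> \<langle>z, R z\<rangle>\<close>, because \<open>D\<^sup>2\<close> is positive.
\<close>

lemma norm_resolvent_le:
  assumes R: "resolvent m R" and m: "0 \<le> m"
  shows "norm R \<le> 1 / (1 + m)"
proof (rule norm_bop_bound)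
  fix z
  obtain w where w: "(R \<bullet>\<^sub>o z, w) \<in> D" "(w, z - (1 + m) *\<^sub>R (R \<bullet>\<^sub>o z)) \<in> D"
    using R unfolding resolvent_def by blast
  have "inner z (R \<bullet>\<^sub>o z) - (1 + m) * (norm (R \<bullet>\<^sub>o z))\<^sup>2 = (norm w)\<^sup>2"
    using inner_square[OF w] by (simp add: inner_diff_left power2_norm_eq_inner)
  then have "(1 + m) * (norm (R \<bullet>\<^sub>o z))\<^sup>2 \<le> inner z (R \<bullet>\<^sub>o z)"
    using zero_le_power2[of "norm w"] by linarith
  also have "\<dots> \<le> norm z * norm (R \<bullet>\<^sub>o z)" by (rule norm_cauchy_schwarz)
  finally have "norm (R \<bullet>\<^sub>o z) * ((1 + m) * norm (R \<bullet>\<^sub>o z)) \<le> norm (R \<bullet>\<^sub>o z) * norm z"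
    by (simp add: power2_eq_square ac_simps)
  then have "(1 + m) * norm (R \<bullet>\<^sub>o z) \<le> norm z"
    using m by (cases "R \<bullet>\<^sub>o z = 0") (simp_all add: mult_le_cancel_left)
  then show "norm (R \<bullet>\<^sub>o z) \<le> 1 / (1 + m) * norm z" using m by (simp add: field_simps)
qed (use m in simp)

lemma norm_one_minus_resolvent_0_le:
  assumes R: "resolvent 0 R"
  shows "norm (1 - R) \<le> 1"
proof (rule norm_bop_bound)
  fix z
  obtain w where w: "(R \<bullet>\<^sub>o z, w) \<in> D" "(w, z - R \<bullet>\<^sub>o z) \<in> D"
    using R unfolding resolvent_def by fastforce
  have "(norm z)\<^sup>2 = (norm (z - R \<bullet>\<^sub>o z))\<^sup>2 + 2 * inner (z - R \<bullet>\<^sub>o z) (R \<bullet>\<^sub>o z) + (norm (R \<bullet>\<^sub>o z))\<^sup>2"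
    by (simp add: power2_norm_eq_inner inner_diff_left inner_diff_right inner_commute)
  then have "(norm (z - R \<bullet>\<^sub>o z))\<^sup>2 \<le> (norm z)\<^sup>2" unfolding inner_square[OF w] by simp
  then have "norm (z - R \<bullet>\<^sub>o z) \<le> norm z" by (rule power2_le_imp_le) simp
  then show "norm ((1 - R) \<bullet>\<^sub>o z) \<le> 1 * norm z" by simp
qed simp

text \<open>
  Up to the factor \<open>1 + m\<close>, the operator \<open>1 + m S\<^sup>2\<close> is at distance less than \<open>1\<close> from the unit, so its power
  with exponent \<open>-1/4\<close> is given by a binomial series \<open>B\<close>, which commutes with \<open>S\<close>.  The product \<open>B S B\<close> is
  positive and compact because \<open>S\<close> is, and its square is \<open>B\<^sup>4 S\<^sup>2\<close>.
\<close>

lemma positive_sqrt_resolvent: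
  assumes S: "is_inverse_sqrt_one_plus_square S D" and compact: "compact_bop S" and m: "0 \<le> m"
  shows "\<exists>P. positive_bop P \<and> compact_bop P \<and> resolvent m (P * P) \<and> norm P \<le> 1 / sqrt (1 + m)"
proof -
  define R0 where "R0 = S * S"
  have R0: "resolvent 0 R0" unfolding R0_def by (rule resolvent_0[OF S])
  have pos: "positive_bop S" using S by (simp add: is_inverse_sqrt_one_plus_square_def)
  then have sS: "star S = S" by (rule star_eq_if_positive)
  \<comment> \<open>The binomial series is taken at \<open>x\<close>, for which \<open>1 + m R\<^sub>0 = (1 + m)(1 + x)\<close>.\<close>
  define x where "x = - (m / (1 + m)) *\<^sub>R (1 - R0)"
  have "norm x \<le> m / (1 + m) * 1"
    unfolding x_def norm_scaleR using m norm_one_minus_resolvent_0_le[OF R0]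
    by (intro mult_mono) simp_all
  also have "\<dots> < 1" using m by simp
  finally have x1: "norm x < 1" .
  have sx: "star x = x"
    by (simp add: x_def R0_def scaleR_scaleC star_scaleC star_add star_mult sS
        linear_diff[OF bounded_linear.linear[OF bounded_linear_star]]
        linear_neg[OF bounded_linear.linear[OF bounded_linear_star]])
  have Sx: "S * x = x * S" by (simp add: x_def R0_def right_diff_distrib left_diff_distrib mult.assoc)
  have x2: "(1 + m) *\<^sub>R (1 + x) = 1 + m *\<^sub>R R0"
  proof -
    have "(1 + m) *\<^sub>R x = - m *\<^sub>R (1 - R0)" using m by (simp add: x_def)
    then show ?thesis by (simp add: scaleR_add_right scaleR_add_left scaleR_diff_right)
  qed
  define B where "B = binomial_power (- 1 / 4) x"
  define C where "C = binomial_power (- 1) x"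
  have sB: "star B = B" unfolding B_def by (rule star_binomial_power[OF x1 sx])
  have SB: "S * B = B * S" unfolding B_def by (rule binomial_power_commute[OF x1 Sx])
  have SC: "S * C = C * S" unfolding C_def by (rule binomial_power_commute[OF x1 Sx])
  have SB': "S * (B * y) = B * (S * y)" and SC': "S * (C * y) = C * (S * y)" for y
    by (simp_all only: mult.assoc[symmetric] SB SC)
  have BB: "(B * B) * (B * B) = C"
    unfolding B_def C_def by (simp add: binomial_power_add[OF x1])
  have "binomial_power (- 1) x * binomial_power 1 x = 1" "binomial_power 1 x * binomial_power (- 1) x = 1"
    by (simp_all add: binomial_power_add[OF x1] binomial_power_0)
  then have Cx: "C * (1 + x) = 1" "(1 + x) * C = 1" by (simp_all add: C_def binomial_power_1)
  define P where "P = (1 / sqrt (1 + m)) *\<^sub>R (B * S * B)"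
  have "(1 / sqrt (1 + m)) * (1 / sqrt (1 + m)) = 1 / (1 + m)"
    using m by (simp add: real_sqrt_mult_self)
  then have PP: "P * P = (1 / (1 + m)) *\<^sub>R (C * R0)"
  proof -
    have "(B * S * B) * (B * S * B) = C * R0"
      unfolding BB[symmetric] R0_def by (simp add: mult.assoc SB SB')
    then show ?thesis
      using \<open>(1 / sqrt (1 + m)) * (1 / sqrt (1 + m)) = 1 / (1 + m)\<close> by (simp add: P_def)
  qed
  have RC: "R0 * C = C * R0" by (simp add: R0_def mult.assoc SC SC')
  have "resolvent m (P * P)"
  proof (rule resolvent_shift[OF R0])
    show "(1 + m *\<^sub>R R0) * (P * P) = R0"
      unfolding x2[symmetric] PP using m by (simp add: mult.assoc[symmetric] Cx)
    show "(P * P) * (1 + m *\<^sub>R R0) = R0"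
      unfolding x2[symmetric] PP RC[symmetric] using m by (simp add: mult.assoc Cx)
  qed
  moreover have "positive_bop P"
    unfolding positive_bop_def
  proof
    fix z
    have "cinner (P \<bullet>\<^sub>o z) z = complex_of_real (1 / sqrt (1 + m)) * cinner (S \<bullet>\<^sub>o (B \<bullet>\<^sub>o z)) (B \<bullet>\<^sub>o z)"
      using cinner_star_left[of B "S \<bullet>\<^sub>o (B \<bullet>\<^sub>o z)" z]
      by (simp add: P_def scaleR_scaleC bop_app_scaleC_left cinner_scaleC_left sB)
    also have "\<dots> \<in> \<real>\<^sub>\<ge>\<^sub>0"
      using pos m by (intro nonneg_Reals_mult_I) (simp_all add: positive_bop_def)
    finally show "cinner (P \<bullet>\<^sub>o z) z \<in> \<real>\<^sub>\<ge>\<^sub>0" .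
  qed
  moreover have "compact_bop P"
    unfolding P_def by (intro compact_bop_scaleR compact_bop_mult_right compact_bop_mult_left compact)
  moreover have "norm P \<le> 1 / sqrt (1 + m)"
  proof (rule power2_le_imp_le)
    have "(norm P)\<^sup>2 = norm (P * P)"
      using norm_star_mult[of P] star_eq_if_positive[OF \<open>positive_bop P\<close>] by simp
    also have "\<dots> \<le> 1 / (1 + m)" by (rule norm_resolvent_le[OF \<open>resolvent m (P * P)\<close> m])
    finally show "(norm P)\<^sup>2 \<le> (1 / sqrt (1 + m))\<^sup>2" using m by (simp add: power_divide)
  qed (use m in simp)
  ultimately show ?thesis by blast
qed

text \<open>
  The square of the Dirac operator acts on both summands as \<open>D\<^sup>2 + n\<^sup>2\<close> in coordinate \<open>n\<close>.  Its resolvent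
  therefore has a diagonal square root, whose entries are compact and have norm at most
  \<open>(1 + n\<^sup>2)\<^sup>-\<^sup>1\<^sup>/\<^sup>2\<close>.
\<close>

lemma compact_resolvent_crossed_dirac:
  assumes S: "is_inverse_sqrt_one_plus_square S D" and compact: "compact_bop S"
  shows "\<exists>Q. is_inverse_sqrt_one_plus_square Q (crossed_dirac D) \<and> compact_bop Q"
proof -
  have "\<forall>n. \<exists>P. positive_bop P \<and> compact_bop P \<and> resolvent ((real_of_int n)\<^sup>2) (P * P) \<and>
      norm P \<le> 1 / sqrt (1 + (real_of_int n)\<^sup>2)"
  proof
    show "\<exists>P. positive_bop P \<and> compact_bop P \<and> resolvent ((real_of_int n)\<^sup>2) (P * P) \<and>
        norm P \<le> 1 / sqrt (1 + (real_of_int n)\<^sup>2)" for n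
      by (rule positive_sqrt_resolvent[OF S compact]) simp
  qed
  from choice[OF this] obtain P where P': "\<forall>n. positive_bop (P n) \<and> compact_bop (P n) \<and>
      resolvent ((real_of_int n)\<^sup>2) (P n * P n) \<and> norm (P n) \<le> 1 / sqrt (1 + (real_of_int n)\<^sup>2)"
    by (elim exE)
  have P: "positive_bop (P n)" "compact_bop (P n)" "resolvent ((real_of_int n)\<^sup>2) (P n * P n)"
    "norm (P n) \<le> 1 / sqrt (1 + (real_of_int n)\<^sup>2)" for n
    using P'[rule_format, of n] by simp_all
  have le1: "norm (P n) \<le> 1" for n
  proof -
    have "1 / sqrt (1 + (real_of_int n)\<^sup>2) \<le> 1 / 1"
      by (rule divide_left_mono) (simp_all add: add_pos_nonneg)
    then show ?thesis using P(4)[of n] by linarith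
  qed
  define T where "T = band P 0"
  have cT: "coord (T \<bullet>\<^sub>o u) n = P n \<bullet>\<^sub>o coord u n" for u n
    unfolding T_def by (simp add: coord_band[OF le1])
  have compT: "compact_bop T"
    unfolding T_def
  proof (rule compact_band[OF P(2) _ le1])
    fix e :: real
    assume e: "0 < e"
    have "{n. \<not> norm (P n) \<le> e} \<subseteq> {- \<lceil>1 / e\<rceil>..\<lceil>1 / e\<rceil>}"
    proof
      fix n
      assume "n \<in> {n. \<not> norm (P n) \<le> e}"
      then have "e < 1 / sqrt (1 + (real_of_int n)\<^sup>2)" using P(4)[of n] by simp
      moreover have "0 < sqrt (1 + (real_of_int n)\<^sup>2)" by (simp add: add_pos_nonneg)
      ultimately have "sqrt (1 + (real_of_int n)\<^sup>2) < 1 / e" using e by (simp add: field_simps)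
      moreover have "\<bar>real_of_int n\<bar> \<le> sqrt (1 + (real_of_int n)\<^sup>2)"
        by (rule real_le_rsqrt) simp
      ultimately have "\<bar>real_of_int n\<bar> \<le> of_int \<lceil>1 / e\<rceil>" using le_of_int_ceiling[of "1 / e"] by linarith
      then have "\<bar>n\<bar> \<le> \<lceil>1 / e\<rceil>" by linarith
      then show "n \<in> {- \<lceil>1 / e\<rceil>..\<lceil>1 / e\<rceil>}" by (simp add: abs_le_iff)
    qed
    then show "finite {n. \<not> norm (P n) \<le> e}" by (rule finite_subset) simp
  qed
  have posT: "cinner (T \<bullet>\<^sub>o u) u \<in> \<real>\<^sub>\<ge>\<^sub>0" for u
  proof -
    have "cinner (P n \<bullet>\<^sub>o coord u n) (coord u n) \<in> \<real>\<^sub>\<ge>\<^sub>0" for n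
      using P(1) by (simp add: positive_bop_def)
    then have re: "0 \<le> Re (cinner (P n \<bullet>\<^sub>o coord u n) (coord u n))"
      and im: "Im (cinner (P n \<bullet>\<^sub>o coord u n) (coord u n)) = 0" for n
      by (simp_all add: complex_nonneg_Reals_iff)
    have sm: "(\<lambda>n. cinner (P n \<bullet>\<^sub>o coord u n) (coord u n)) summable_on UNIV"
      using summable_cinner_coord[of "T \<bullet>\<^sub>o u" u] by (simp add: cT)
    have "0 \<le> Re (cinner (T \<bullet>\<^sub>o u) u)"
      unfolding cinner_l2Z_def cT infsum_Re[OF sm, symmetric] by (rule infsum_nonneg) (rule re)
    moreover have "Im (cinner (T \<bullet>\<^sub>o u) u) = 0"
      unfolding cinner_l2Z_def cT infsum_Im[OF sm, symmetric] by (simp add: im)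
    ultimately show ?thesis by (simp add: complex_nonneg_Reals_iff)
  qed
  let ?R = "T * T"
  have c2: "(c * of_int n) *\<^sub>C ((c * of_int n) *\<^sub>C x) = - ((real_of_int n)\<^sup>2 *\<^sub>R x)"
    if c: "c \<in> {\<i>, - \<i>}" for c n and x :: 'h
  proof -
    have "(c * of_int n) * (c * of_int n) = complex_of_real (- ((real_of_int n)\<^sup>2))"
      using c by (auto simp: power2_eq_square complex_eq_iff)
    then have "(c * of_int n) *\<^sub>C ((c * of_int n) *\<^sub>C x) = (- ((real_of_int n)\<^sup>2)) *\<^sub>R x"
      unfolding scaleC_scaleC scaleR_scaleC by (rule arg_cong)
    then show ?thesis by simp
  qed
  have sub: "u - (- c * of_int n) *\<^sub>C x = u + (c * of_int n) *\<^sub>C x" for u x :: 'h and c and n :: int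
  proof -
    have "(- c * of_int n) *\<^sub>C x + (c * of_int n) *\<^sub>C x = 0"
      unfolding scaleC_add_left[symmetric] by simp
    then show ?thesis by (simp add: diff_eq_eq add.assoc add.commute)
  qed
  have left_inv: "?R \<bullet>\<^sub>o (u + v) = u"
    if c: "c \<in> {\<i>, - \<i>}" and up: "(u, p) \<in> dirac_corner c D" and pv: "(p, v) \<in> dirac_corner (- c) D"
    for c u p v
  proof (rule l2Z_eqI)
    fix n
    let ?x = "coord u n" and ?w = "coord p n - (c * of_int n) *\<^sub>C coord u n"
    have c': "- c \<in> {\<i>, - \<i>}" using c by auto
    have xw: "(?x, ?w) \<in> D" using up unfolding dirac_corner_iff[OF c] by blast
    have "(coord p n, coord v n + (c * of_int n) *\<^sub>C coord p n) \<in> D"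
      using pv unfolding dirac_corner_iff[OF c'] sub by blast
    from linear_operator_diff[OF D_linear this linear_operatorD(4)[OF D_linear xw, of "c * of_int n"]]
    have "(?w, coord v n + (c * of_int n) *\<^sub>C coord p n - (c * of_int n) *\<^sub>C ?w) \<in> D" .
    moreover have "coord v n + (c * of_int n) *\<^sub>C coord p n - (c * of_int n) *\<^sub>C ?w
        = coord v n - (real_of_int n)\<^sup>2 *\<^sub>R ?x"
      by (simp add: scaleC_diff_right c2[OF c])
    ultimately have "(?w, coord v n - (real_of_int n)\<^sup>2 *\<^sub>R ?x) \<in> D" by simp
    with xw have "(P n * P n) \<bullet>\<^sub>o (coord v n - (real_of_int n)\<^sup>2 *\<^sub>R ?x + (1 + (real_of_int n)\<^sup>2) *\<^sub>R ?x) = ?x"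
      using P(3)[of n] unfolding resolvent_def by blast
    then show "coord (?R \<bullet>\<^sub>o (u + v)) n = coord u n"
      by (simp add: cT scaleR_add_left add.commute)
  qed
  have right_inv: "\<exists>p. (?R \<bullet>\<^sub>o z, p) \<in> dirac_corner c D \<and>
      (p, z - ?R \<bullet>\<^sub>o z) \<in> dirac_corner (- c) D" if c: "c \<in> {\<i>, - \<i>}" for c z
  proof -
    have c': "- c \<in> {\<i>, - \<i>}" and rc: "Re c = 0" using c by auto
    define x where "x n = (P n * P n) \<bullet>\<^sub>o coord z n" for n
    have "\<forall>n. \<exists>w. (x n, w) \<in> D \<and> (w, coord z n - (1 + (real_of_int n)\<^sup>2) *\<^sub>R x n) \<in> D"
      using P(3) unfolding resolvent_def x_def by blast
    then obtain w where w: "\<And>n. (x n, w n) \<in> D"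
      "\<And>n. (w n, coord z n - (1 + (real_of_int n)\<^sup>2) *\<^sub>R x n) \<in> D" by metis
    \<comment> \<open>The vector \<open>p\<close> has to be \<open>(D + c n) x\<^sub>n\<close> in coordinate \<open>n\<close>; it is square-summable because \<open>z\<close> is.\<close>
    define p where "p n = w n + (c * of_int n) *\<^sub>C x n" for n
    have "norm (p n) \<le> norm (coord z n)" for n
    proof (rule power2_le_imp_le)
      have "(norm (p n))\<^sup>2 = (norm (w n))\<^sup>2 + (norm ((c * of_int n) *\<^sub>C x n))\<^sup>2"
        unfolding p_def by (rule norm_corner[OF w(1)]) (simp add: rc)
      also have "\<dots> = (norm (w n))\<^sup>2 + (real_of_int n)\<^sup>2 * (norm (x n))\<^sup>2"
        using c by (auto simp: norm_scaleC_hilbert norm_mult power_mult_distrib)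
      also have "\<dots> = inner (coord z n) (x n) - (norm (x n))\<^sup>2"
        unfolding inner_square[OF w, symmetric]
        by (simp add: inner_diff_left power2_norm_eq_inner distrib_right)
      also have "\<dots> \<le> norm (coord z n) * norm (x n)"
        using norm_cauchy_schwarz[of "coord z n" "x n"] zero_le_power2[of "norm (x n)"] by linarith
      also have "\<dots> \<le> norm (coord z n) * norm (coord z n)"
      proof -
        have "norm (P n * P n) \<le> 1"
          using norm_mult_ineq[of "P n" "P n"] mult_mono[OF le1[of n] le1[of n]] by simp
        then have "norm (x n) \<le> 1 * norm (coord z n)"
          unfolding x_def by (intro order_trans[OF norm_bop_app mult_right_mono]) simp_all
        then show ?thesis by (simp add: mult_left_mono)
      qed
      finally show "(norm (p n))\<^sup>2 \<le> (norm (coord z n))\<^sup>2" by (simp add: power2_eq_square)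
    qed simp
    then have "(\<Sum>n\<in>F. (norm (p n))\<^sup>2) \<le> (norm z)\<^sup>2" if "finite F" for F
      using sum_coord_le_norm[OF that, of z] sum_mono[of F "\<lambda>n. (norm (p n))\<^sup>2" "\<lambda>n. (norm (coord z n))\<^sup>2"]
      by (simp add: power_mono)
    then have cp: "coord (l2Z p) = p" by (intro l2Z_boundI(1)[where b="norm z"]) simp_all
    have cx: "coord (?R \<bullet>\<^sub>o z) n = x n" for n by (simp add: cT x_def)
    have "(?R \<bullet>\<^sub>o z, l2Z p) \<in> dirac_corner c D"
      unfolding dirac_corner_iff[OF c] cx cp p_def using w(1) by simp
    moreover have "(l2Z p, z - ?R \<bullet>\<^sub>o z) \<in> dirac_corner (- c) D"
      unfolding dirac_corner_iff[OF c'] sub minus_l2Z.rep_eq cx cp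
    proof
      fix n
      have "(p n, coord z n - (1 + (real_of_int n)\<^sup>2) *\<^sub>R x n + (c * of_int n) *\<^sub>C w n) \<in> D"
        unfolding p_def by (rule linear_operatorD(3)[OF D_linear w(2) linear_operatorD(4)[OF D_linear w(1)]])
      moreover have "coord z n - (1 + (real_of_int n)\<^sup>2) *\<^sub>R x n + (c * of_int n) *\<^sub>C w n =
          coord z n - x n + (c * of_int n) *\<^sub>C p n"
        by (simp add: p_def scaleC_add_right c2[OF c] scaleR_add_left)
      ultimately show "(p n, coord z n - x n + (c * of_int n) *\<^sub>C p n) \<in> D" by simp
    qed
    ultimately show ?thesis by blast
  qed
  define Q where "Q = T \<oplus>\<^sub>o T"
  have QQ: "(Q * Q) \<bullet>\<^sub>o (y, z) = (?R \<bullet>\<^sub>o y, ?R \<bullet>\<^sub>o z)" for y z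
    by (simp add: Q_def direct_sum_bop_app)
  have "bop_graph (Q * Q) = (op_add Id (crossed_dirac D O crossed_dirac D))\<inverse>"
  proof (intro set_eqI iffI)
    fix a
    assume "a \<in> bop_graph (Q * Q)"
    then obtain b where b: "a = (b, (Q * Q) \<bullet>\<^sub>o b)" unfolding bop_graph_def by blast
    obtain y z where yz: "b = (y, z)" by (cases b)
    have a: "a = ((y, z), ?R \<bullet>\<^sub>o y, ?R \<bullet>\<^sub>o z)" unfolding b yz QQ ..
    obtain p where p: "(?R \<bullet>\<^sub>o y, p) \<in> dirac_corner \<i> D" "(p, y - ?R \<bullet>\<^sub>o y) \<in> dirac_corner (- \<i>) D"
      using right_inv[of \<i> y] by auto
    obtain q where q: "(?R \<bullet>\<^sub>o z, q) \<in> dirac_corner (- \<i>) D" "(q, z - ?R \<bullet>\<^sub>o z) \<in> dirac_corner \<i> D"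
      using right_inv[of "- \<i>" z] by auto
    have "((?R \<bullet>\<^sub>o y, ?R \<bullet>\<^sub>o z), (q, p)) \<in> crossed_dirac D"
      "((q, p), (y - ?R \<bullet>\<^sub>o y, z - ?R \<bullet>\<^sub>o z)) \<in> crossed_dirac D"
      using p q by (simp_all add: crossed_dirac_eq off_diagonal_def)
    then have "((?R \<bullet>\<^sub>o y, ?R \<bullet>\<^sub>o z), (y - ?R \<bullet>\<^sub>o y, z - ?R \<bullet>\<^sub>o z))
        \<in> crossed_dirac D O crossed_dirac D" by (rule relcompI)
    then have "((?R \<bullet>\<^sub>o y, ?R \<bullet>\<^sub>o z),
        (?R \<bullet>\<^sub>o y, ?R \<bullet>\<^sub>o z) + (y - ?R \<bullet>\<^sub>o y, z - ?R \<bullet>\<^sub>o z))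
        \<in> op_add Id (crossed_dirac D O crossed_dirac D)"
      unfolding op_add_def by blast
    then show "a \<in> (op_add Id (crossed_dirac D O crossed_dirac D))\<inverse>" by (simp add: a)
  next
    fix a
    assume "a \<in> (op_add Id (crossed_dirac D O crossed_dirac D))\<inverse>"
    then obtain r v t where a: "a = (r + v, r)" "(r, t) \<in> crossed_dirac D" "(t, v) \<in> crossed_dirac D"
      by (auto simp: op_add_def)
    obtain r1 r2 where r: "r = (r1, r2)" by (cases r)
    obtain t1 t2 where t: "t = (t1, t2)" by (cases t)
    obtain v1 v2 where v: "v = (v1, v2)" by (cases v)
    have "(r2, t1) \<in> dirac_corner (- \<i>) D" "(r1, t2) \<in> dirac_corner \<i> D"
      "(t2, v1) \<in> dirac_corner (- \<i>) D" "(t1, v2) \<in> dirac_corner \<i> D"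
      using a(2,3) by (simp_all add: r t v crossed_dirac_eq off_diagonal_def)
    then have "?R \<bullet>\<^sub>o (r1 + v1) = r1" "?R \<bullet>\<^sub>o (r2 + v2) = r2"
      using left_inv[of \<i> r1 t2 v1] left_inv[of "- \<i>" r2 t1 v2] by simp_all
    then have eq: "(Q * Q) \<bullet>\<^sub>o (r + v) = r" unfolding r v add_Pair QQ by simp
    have "(r + v, (Q * Q) \<bullet>\<^sub>o (r + v)) \<in> bop_graph (Q * Q)" unfolding bop_graph_def by blast
    then show "a \<in> bop_graph (Q * Q)" unfolding a(1) eq .
  qed
  moreover have "positive_bop Q"
    unfolding positive_bop_def
    by (simp add: Q_def direct_sum_bop_app cinner_prod_def nonneg_Reals_add_I posT)
  moreover have "compact_bop Q" unfolding Q_def by (rule compact_direct_sum[OF compT compT])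
  ultimately show ?thesis unfolding is_inverse_sqrt_one_plus_square_def by blast
qed

end

section \<open>Commutators with the Dirac operator\<close>

text \<open>
  \<open>X\<close> preserves the domain of \<open>D\<close>, and \<open>E\<close> extends \<open>[D, X]\<close>.  For linear \<open>D\<close> this form of the statement is
  linear in the pair \<open>(X, E)\<close>.
\<close>

definition commutator_on :: "('h::chilbert_space \<times> 'h) set \<Rightarrow> 'h bop \<Rightarrow> 'h bop \<Rightarrow> bool"
  where "commutator_on D X E \<longleftrightarrow> (\<forall>u v. (u, v) \<in> D \<longrightarrow> (X \<bullet>\<^sub>o u, X \<bullet>\<^sub>o v + E \<bullet>\<^sub>o u) \<in> D)"

lemma commutator_onD:
  "commutator_on D X E \<Longrightarrow> (u, v) \<in> D \<Longrightarrow> (X \<bullet>\<^sub>o u, X \<bullet>\<^sub>o v + E \<bullet>\<^sub>o u) \<in> D"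
  by (simp add: commutator_on_def)

lemma commutator_on_imp_domain:
  assumes "commutator_on D X E"
  shows "\<forall>x\<in>Domain D. X \<bullet>\<^sub>o x \<in> Domain D"
  using assms unfolding commutator_on_def Domain_iff by blast

lemma commutator_on_imp_extends:
  assumes sv: "single_valued D" and c: "commutator_on D X E"
  shows "extends_commutator E D X"
  unfolding extends_commutator_def
proof (intro allI impI)
  fix x y z
  assume a: "(x, y) \<in> D \<and> (X \<bullet>\<^sub>o x, z) \<in> D"
  have "z = X \<bullet>\<^sub>o y + E \<bullet>\<^sub>o x"
    using a commutator_onD[OF c] single_valuedD[OF sv] by blast
  then show "E \<bullet>\<^sub>o x = z - X \<bullet>\<^sub>o y" by simp
qed

lemma extends_imp_commutator_on:
  assumes dom: "\<forall>x\<in>Domain D. X \<bullet>\<^sub>o x \<in> Domain D" and C: "extends_commutator C D X"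
  shows "commutator_on D X C"
  unfolding commutator_on_def
proof (intro allI impI)
  fix u v
  assume uv: "(u, v) \<in> D"
  then have "X \<bullet>\<^sub>o u \<in> Domain D" using dom by blast
  then obtain z where z: "(X \<bullet>\<^sub>o u, z) \<in> D" by blast
  then have "C \<bullet>\<^sub>o u = z - X \<bullet>\<^sub>o v" using C uv unfolding extends_commutator_def by blast
  then show "(X \<bullet>\<^sub>o u, X \<bullet>\<^sub>o v + C \<bullet>\<^sub>o u) \<in> D" using z by simp
qed

lemma commutator_on_sum:
  assumes D: "linear_operator D" and "\<And>i. i \<in> I \<Longrightarrow> commutator_on D (X i) (E i)"
  shows "commutator_on D (\<Sum>i\<in>I. X i) (\<Sum>i\<in>I. E i)"
  using assms(2)
proof (induction I rule: infinite_finite_induct)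
  case (insert i I)
  show ?case
    unfolding commutator_on_def
  proof (intro allI impI)
    fix u v
    assume uv: "(u, v) \<in> D"
    have "commutator_on D (X i) (E i)" "commutator_on D (\<Sum>i\<in>I. X i) (\<Sum>i\<in>I. E i)"
      using insert by simp_all
    then have "(X i \<bullet>\<^sub>o u + (\<Sum>i\<in>I. X i) \<bullet>\<^sub>o u,
        (X i \<bullet>\<^sub>o v + E i \<bullet>\<^sub>o u) + ((\<Sum>i\<in>I. X i) \<bullet>\<^sub>o v + (\<Sum>i\<in>I. E i) \<bullet>\<^sub>o u)) \<in> D"
      using uv by (intro linear_operatorD(3)[OF D] commutator_onD)
    then show "((\<Sum>i\<in>insert i I. X i) \<bullet>\<^sub>o u, (\<Sum>i\<in>insert i I. X i) \<bullet>\<^sub>o v +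
        (\<Sum>i\<in>insert i I. E i) \<bullet>\<^sub>o u) \<in> D"
      using insert(1,2) by (simp add: ac_simps)
  qed
qed (simp_all add: commutator_on_def linear_operatorD(2)[OF D])

lemma commutator_on_scaleR:
  assumes D: "linear_operator D" and c: "commutator_on D X E"
  shows "commutator_on D (r *\<^sub>R X) (r *\<^sub>R E)"
  unfolding commutator_on_def
proof (intro allI impI)
  fix u v
  assume "(u, v) \<in> D"
  then have "(complex_of_real r *\<^sub>C (X \<bullet>\<^sub>o u), complex_of_real r *\<^sub>C (X \<bullet>\<^sub>o v + E \<bullet>\<^sub>o u)) \<in> D"
    by (intro linear_operatorD(4)[OF D] commutator_onD[OF c])
  then show "((r *\<^sub>R X) \<bullet>\<^sub>o u, (r *\<^sub>R X) \<bullet>\<^sub>o v + (r *\<^sub>R E) \<bullet>\<^sub>o u) \<in> D"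
    by (simp add: scaleR_scaleC bop_app_scaleC_left scaleC_add_right)
qed

definition off_diagonal_bop ::
    "'h::chilbert_space bop \<Rightarrow> 'h bop \<Rightarrow> ('h \<times> 'h) bop"
  where "off_diagonal_bop S T = Bop (\<lambda>z. (S \<bullet>\<^sub>o snd z, T \<bullet>\<^sub>o fst z))"

lemma off_diagonal_bop_app: "off_diagonal_bop S T \<bullet>\<^sub>o z = (S \<bullet>\<^sub>o snd z, T \<bullet>\<^sub>o fst z)"
  unfolding off_diagonal_bop_def
proof (rule Bop_app)
  show "bounded_linear (\<lambda>z. (S \<bullet>\<^sub>o snd z, T \<bullet>\<^sub>o fst z))"
    by (rule bounded_linear_Pair[OF
          bounded_linear_compose[OF bounded_linear_bop_app bounded_linear_snd]
          bounded_linear_compose[OF bounded_linear_bop_app bounded_linear_fst]])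
qed (simp add: scaleC_prod_def bop_app_scaleC)

lemma norm_off_diagonal_bop_ge:
  "norm S \<le> norm (off_diagonal_bop S T)" "norm T \<le> norm (off_diagonal_bop S T)"
proof -
  have "norm (S \<bullet>\<^sub>o x) \<le> norm (off_diagonal_bop S T) * norm x" for x
    using norm_bop_app[of "off_diagonal_bop S T" "(0, x)"] norm_fst_le[of "S \<bullet>\<^sub>o x" "T \<bullet>\<^sub>o 0"]
    by (simp add: off_diagonal_bop_app)
  then show "norm S \<le> norm (off_diagonal_bop S T)" by (intro norm_bop_bound) simp_all
  have "norm (T \<bullet>\<^sub>o x) \<le> norm (off_diagonal_bop S T) * norm x" for x
    using norm_bop_app[of "off_diagonal_bop S T" "(x, 0)"] norm_snd_le[of "T \<bullet>\<^sub>o x" "S \<bullet>\<^sub>o 0"]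
    by (simp add: off_diagonal_bop_app)
  then show "norm T \<le> norm (off_diagonal_bop S T)" by (intro norm_bop_bound) simp_all
qed

lemma commutator_on_off_diagonal:
  assumes "commutator_on S X E" "commutator_on T X F"
  shows "commutator_on (off_diagonal S T) (X \<oplus>\<^sub>o X) (off_diagonal_bop E F)"
  using assms
  by (auto simp: commutator_on_def off_diagonal_def direct_sum_bop_app off_diagonal_bop_app)

section \<open>Finite sums of band operators\<close>

lemma coord_band_sum_tensor_delta:
  assumes F: "finite F" and b: "\<And>n. \<exists>b. \<forall>k. norm (K n k) \<le> b"
  shows "coord ((\<Sum>n\<in>F. band (K n) n) \<bullet>\<^sub>o (\<xi> \<otimes>\<delta> j)) k = (if k - j \<in> F then K (k - j) k \<bullet>\<^sub>o \<xi> else 0)"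
proof -
  have c: "coord (band (K n) n \<bullet>\<^sub>o u) k = K n k \<bullet>\<^sub>o coord u (k - n)" for n u k
    using b[of n] coord_band by blast
  have "coord ((\<Sum>n\<in>F. band (K n) n) \<bullet>\<^sub>o (\<xi> \<otimes>\<delta> j)) k =
      (\<Sum>n\<in>F. if n = k - j then K (k - j) k \<bullet>\<^sub>o \<xi> else 0)"
    unfolding bop_app_sum coord_sum c coord_tensor_delta
    by (intro sum.cong) (auto simp: bop_app_linear)
  then show ?thesis using F by simp
qed

text \<open>Every diagonal of an operator matrix is dominated by the operator.\<close>

lemma norm_band_entry_le:
  assumes F: "finite F" and b: "\<And>n. \<exists>b. \<forall>k. norm (K n k) \<le> b" and n: "n \<in> F"
  shows "norm (K n k) \<le> norm (\<Sum>n\<in>F. band (K n) n)"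
proof (rule norm_bop_bound)
  fix \<xi>
  let ?X = "\<Sum>n\<in>F. band (K n) n"
  have "norm (K n k \<bullet>\<^sub>o \<xi>) = norm (coord (?X \<bullet>\<^sub>o (\<xi> \<otimes>\<delta> (k - n))) k)"
    using n by (simp add: coord_band_sum_tensor_delta[OF F b])
  also have "\<dots> \<le> norm (?X \<bullet>\<^sub>o (\<xi> \<otimes>\<delta> (k - n)))" by (rule norm_coord_le)
  also have "\<dots> \<le> norm ?X * norm \<xi>" using norm_bop_app[of ?X "\<xi> \<otimes>\<delta> (k - n)"] by simp
  finally show "norm (K n k \<bullet>\<^sub>o \<xi>) \<le> norm ?X * norm \<xi>" .
qed simp

text \<open>
  The \<open>j\<close>-th column of the sum \<open>X\<close>, applied to \<open>u\<^sub>j\<close>, is \<open>X (u\<^sub>j \<otimes> \<delta>\<^sub>j)\<close>, with norm at most \<open>\<parallel>X\<parallel> \<parallel>u\<^sub>j\<parallel>\<close>.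
  Summing the squares of all columns and collecting the terms by diagonals gives the estimate.
\<close>

lemma sum_norm_band_le:
  fixes u :: "'h::chilbert_space l2Z"
  assumes F: "finite F" and b: "\<And>n. \<exists>b. \<forall>k. norm (K n k) \<le> b" and G: "G \<subseteq> F"
  shows "(\<Sum>n\<in>G. (norm (band (K n) n \<bullet>\<^sub>o u))\<^sup>2) \<le> (norm (\<Sum>n\<in>F. band (K n) n) * norm u)\<^sup>2"
proof -
  let ?X = "\<Sum>n\<in>F. band (K n) n"
  define f where "f n j = (norm (K n (j + n) \<bullet>\<^sub>o coord u j))\<^sup>2" for n j
  have c: "coord (band (K n) n \<bullet>\<^sub>o u) k = K n k \<bullet>\<^sub>o coord u (k - n)" for n k
    using b[of n] coord_band by blast
  have bij: "bij_betw (\<lambda>j. j + n) UNIV UNIV" for n :: int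
    by (rule bij_betwI[where g="\<lambda>k. k - n"]) auto
  have sm: "f n summable_on UNIV" for n
    using summable_coord[of "band (K n) n \<bullet>\<^sub>o u"] summable_on_reindex_bij_betw[OF bij[of n],
        of "\<lambda>k. (norm (coord (band (K n) n \<bullet>\<^sub>o u) k))\<^sup>2"]
    by (simp add: c f_def[abs_def])
  have nm: "(norm (band (K n) n \<bullet>\<^sub>o u))\<^sup>2 = infsum (f n) UNIV" for n
    unfolding norm_l2Z_square f_def[abs_def]
    by (subst infsum_reindex_bij_betw[OF bij[of n], symmetric]) (simp add: c)
  have finG: "finite G" using F G finite_subset by blast
  have hs: "((\<lambda>j. \<Sum>n\<in>G. f n j) has_sum (\<Sum>n\<in>G. infsum (f n) UNIV)) UNIV"
    using finG by (induction G rule: finite_induct) (simp_all add: has_sum_add has_sum_infsum sm)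
  then have "(\<Sum>n\<in>G. (norm (band (K n) n \<bullet>\<^sub>o u))\<^sup>2) = (\<Sum>\<^sub>\<infinity>j. \<Sum>n\<in>G. f n j)"
    by (simp add: nm infsumI)
  also have "\<dots> \<le> (\<Sum>\<^sub>\<infinity>j. (norm ?X)\<^sup>2 * (norm (coord u j))\<^sup>2)"
  proof (rule infsum_mono)
    show "(\<lambda>j. \<Sum>n\<in>G. f n j) summable_on UNIV" using hs by (rule has_sum_imp_summable)
    show "(\<lambda>j. (norm ?X)\<^sup>2 * (norm (coord u j))\<^sup>2) summable_on UNIV"
      by (intro summable_on_cmult_right summable_coord)
    fix j
    let ?v = "?X \<bullet>\<^sub>o (coord u j \<otimes>\<delta> j)"
    have "(\<Sum>n\<in>G. f n j) = (\<Sum>n\<in>G. (norm (coord ?v (j + n)))\<^sup>2)"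
      using G by (intro sum.cong) (auto simp: f_def coord_band_sum_tensor_delta[OF F b])
    also have "\<dots> = (\<Sum>k\<in>(\<lambda>n. j + n) ` G. (norm (coord ?v k))\<^sup>2)"
      by (subst sum.reindex) (auto simp: inj_on_def)
    also have "\<dots> \<le> (norm ?v)\<^sup>2" using finG by (intro sum_coord_le_norm) simp
    also have "\<dots> \<le> (norm ?X * norm (coord u j))\<^sup>2"
      using norm_bop_app[of ?X "coord u j \<otimes>\<delta> j"] by (intro power_mono) simp_all
    finally show "(\<Sum>n\<in>G. f n j) \<le> (norm ?X)\<^sup>2 * (norm (coord u j))\<^sup>2" by (simp add: power_mult_distrib)
  qed
  also have "\<dots> = (norm ?X * norm u)\<^sup>2"
    by (simp add: infsum_cmult_right' power_mult_distrib norm_l2Z_square)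
  finally show ?thesis .
qed

lemma summable_inverse_squares: "(\<lambda>n::int. 1 / (real_of_int n)\<^sup>2) summable_on UNIV"
proof -
  have "summable (\<lambda>n. inverse (real n ^ 2))" by (rule inverse_power_summable) simp
  then have nat: "(\<lambda>n. 1 / (real n)\<^sup>2) summable_on UNIV"
    by (intro norm_summable_imp_summable_on) (simp add: inverse_eq_divide)
  have "(\<lambda>n::int. 1 / (real_of_int n)\<^sup>2) summable_on range int"
    by (subst summable_on_reindex) (simp_all add: o_def nat)
  moreover have "(\<lambda>n::int. 1 / (real_of_int n)\<^sup>2) summable_on range (\<lambda>n. - int n)"
    by (subst summable_on_reindex) (simp_all add: o_def nat inj_on_def)
  ultimately have "(\<lambda>n::int. 1 / (real_of_int n)\<^sup>2) summable_on (range int \<union> range (\<lambda>n. - int n))"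
    by (rule summable_on_union)
  moreover have "range int \<union> range (\<lambda>n. - int n) = UNIV"
  proof -
    have "n \<in> range int \<union> range (\<lambda>n. - int n)" for n by (cases n rule: int_cases2) auto
    then show ?thesis by blast
  qed
  ultimately show ?thesis by simp
qed

text \<open>
  The index \<open>0\<close> is put into \<open>F\<close> because the coefficient of \<open>\<lambda>\<^sub>0\<close> never belongs to the tail.
\<close>

lemma inverse_squares_tail:
  assumes e: "0 < e"
  shows "\<exists>F. finite F \<and> (0::int) \<in> F \<and>
    (\<forall>G. finite G \<longrightarrow> G \<inter> F = {} \<longrightarrow> (\<Sum>n\<in>G. 1 / (real_of_int n)\<^sup>2) \<le> e)"
proof -
  let ?f = "\<lambda>n::int. 1 / (real_of_int n)\<^sup>2"
  obtain F where F: "finite F" "dist (sum ?f F) (infsum ?f UNIV) \<le> e"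
    using infsum_finite_approximation[OF summable_inverse_squares e] by blast
  have "sum ?f G \<le> e" if G: "finite G" "G \<inter> insert 0 F = {}" for G
  proof -
    have "sum ?f F + sum ?f G = sum ?f (F \<union> G)"
      using F(1) G by (subst sum.union_disjoint) auto
    also have "\<dots> \<le> infsum ?f UNIV"
      using F(1) G(1) by (intro finite_sum_le_infsum summable_inverse_squares) auto
    finally show ?thesis using F(2) unfolding dist_real_def by linarith
  qed
  then show ?thesis using F(1) by (intro exI[of _ "insert 0 F"]) simp
qed

section \<open>The spectral triple of the crossed product\<close>

lemma scaleC_diff_left: "(b - c) *\<^sub>C x = b *\<^sub>C x - c *\<^sub>C (x :: 'v::complex_vector)"
  using scaleC_add_left[of "b - c" c x] by simp

lemma star_direct_sum: "star (S \<oplus>\<^sub>o T) = star S \<oplus>\<^sub>o star T"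
  by (rule star_bop_unique) (simp add: direct_sum_bop_app cinner_prod_def cinner_star_right)

lemma representation_direct_sum: "representation A (\<lambda>x. x \<oplus>\<^sub>o x)"
proof -
  have "(x + y) \<oplus>\<^sub>o (x + y) = (x \<oplus>\<^sub>o x) + (y \<oplus>\<^sub>o y)"
    "(x * y) \<oplus>\<^sub>o (x * y) = (x \<oplus>\<^sub>o x) * (y \<oplus>\<^sub>o y)"
    "(c *\<^sub>C x) \<oplus>\<^sub>o (c *\<^sub>C x) = c *\<^sub>C (x \<oplus>\<^sub>o x)"
    "(1 :: 'a bop) \<oplus>\<^sub>o 1 = 1" for x y :: "'a bop" and c
    by (rule bop_eqI; simp add: direct_sum_bop_app bop_app_scaleC_left scaleC_prod_def)+
  then show ?thesis by (simp add: representation_def star_direct_sum)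
qed

locale equicontinuous_system =
  fixes \<pi> :: "'a::cstar_algebra \<Rightarrow> 'h::chilbert_space bop" and \<alpha> :: "int \<Rightarrow> 'a \<Rightarrow> 'a"
    and \<A> :: "'a set" and D :: "('h \<times> 'h) set"
  assumes triple: "odd_spectral_triple UNIV \<A> \<pi> D"
    and lip: "lip_metric UNIV \<A> (lip_seminorm \<pi> D)"
    and action: "group_action \<alpha>"
    and equicontinuous: "metrically_equicontinuous \<A> (lip_seminorm \<pi> D) \<alpha>"

sublocale equicontinuous_system \<subseteq> covariant_system \<pi> \<alpha>
  using triple action by unfold_locales (simp_all add: odd_spectral_triple_def)

sublocale equicontinuous_system \<subseteq> selfadjoint_operator_on D
  using triple by unfold_locales (simp add: odd_spectral_triple_def)

context equicontinuous_system
begin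

lemma \<A>_subalgebra: "star_subalgebra \<A>" and \<A>_dense: "closure \<A> = UNIV"
  using equicontinuous by (simp_all add: metrically_equicontinuous_def)

lemma \<alpha>_in_\<A>: "a \<in> \<A> \<Longrightarrow> \<alpha> n a \<in> \<A>"
  using equicontinuous unfolding metrically_equicontinuous_def by blast

text \<open>
  For \<open>a \<in> \<A>\<close>, the bounded extension of \<open>[D, \<pi>(a)]\<close>.
\<close>

definition deriv_bop :: "'a \<Rightarrow> 'h bop"
  where "deriv_bop a = (THE C. extends_commutator C D (\<pi> a))"

lemma norm_deriv_bop: "norm (deriv_bop a) = lip_seminorm \<pi> D a"
  by (simp add: deriv_bop_def lip_seminorm_def)

lemma commutator_deriv_bop:
  assumes a: "a \<in> \<A>"
  shows "commutator_on D (\<pi> a) (deriv_bop a)"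
proof -
  have dom: "\<forall>x\<in>Domain D. \<pi> a \<bullet>\<^sub>o x \<in> Domain D" and "\<exists>C. extends_commutator C D (\<pi> a)"
    using triple a by (simp_all add: odd_spectral_triple_def)
  then obtain C where C: "extends_commutator C D (\<pi> a)" by blast
  have "densely_defined D" using D_linear D_dense by (simp add: densely_defined_def)
  then have "deriv_bop a = C"
    unfolding deriv_bop_def using C extends_commutator_unique[OF _ dom C] by (intro the_equality)
  then show ?thesis using extends_imp_commutator_on[OF dom C] by simp
qed

text \<open>
  Metric equicontinuity enters through this bound and through the invariance of \<open>\<A>\<close>.
\<close>

lemma deriv_bop_bounded:
  assumes "a \<in> \<A>"
  shows "\<exists>b. \<forall>k. norm (deriv_bop (\<alpha> (- k) a)) \<le> b"
proof -
  have "bdd_above (range (\<lambda>g. lip_seminorm \<pi> D (\<alpha> g a)))"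
    using equicontinuous assms by (simp add: metrically_equicontinuous_def)
  then obtain b where "\<forall>g. lip_seminorm \<pi> D (\<alpha> g a) \<le> b" by (auto simp: bdd_above_def)
  then show ?thesis unfolding norm_deriv_bop by blast
qed

definition deriv_band :: "'a \<Rightarrow> int \<Rightarrow> 'h l2Z bop"
  where "deriv_band a n = band (\<lambda>k. deriv_bop (\<alpha> (- k) a)) n"

lemma coord_deriv_band:
  assumes "a \<in> \<A>"
  shows "coord (deriv_band a n \<bullet>\<^sub>o u) k = deriv_bop (\<alpha> (- k) a) \<bullet>\<^sub>o coord u (k - n)"
proof -
  obtain b where "\<forall>k. norm (deriv_bop (\<alpha> (- k) a)) \<le> b" using deriv_bop_bounded[OF assms] by blast
  then show ?thesis unfolding deriv_band_def by (intro coord_band) blast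
qed

text \<open>
  In row \<open>k\<close>, the operator \<open>a \<lambda>\<^sub>m\<close> has the entry \<open>\<pi>(\<alpha>\<^sub>-\<^sub>k(a))\<close>; its commutator with \<open>D \<otimes> 1\<close> has the entry
  \<open>[D, \<pi>(\<alpha>\<^sub>-\<^sub>k(a))]\<close>, and its commutator with \<open>1 \<otimes> M\<close> is \<open>m a \<lambda>\<^sub>m\<close>.
\<close>

lemma commutator_monomial:
  assumes c: "c \<in> {\<i>, - \<i>}" and a: "a \<in> \<A>"
  shows "commutator_on (dirac_corner c D) (monomial a m)
    (deriv_band a m + (c * of_int m) *\<^sub>C monomial a m)"
  unfolding commutator_on_def
proof (intro allI impI)
  fix u v
  assume uv: "(u, v) \<in> dirac_corner c D"
  show "(monomial a m \<bullet>\<^sub>o u, monomial a m \<bullet>\<^sub>o v +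
      (deriv_band a m + (c * of_int m) *\<^sub>C monomial a m) \<bullet>\<^sub>o u) \<in> dirac_corner c D"
    unfolding dirac_corner_iff[OF c]
  proof
    fix k
    let ?x = "coord u (k - m)" and ?P = "\<pi> (\<alpha> (- k) a)"
    have "(?x, coord v (k - m) - (c * of_int (k - m)) *\<^sub>C ?x) \<in> D"
      using uv unfolding dirac_corner_iff[OF c] by blast
    then have mem: "(?P \<bullet>\<^sub>o ?x, ?P \<bullet>\<^sub>o (coord v (k - m) - (c * of_int (k - m)) *\<^sub>C ?x)
        + deriv_bop (\<alpha> (- k) a) \<bullet>\<^sub>o ?x) \<in> D"
      by (intro commutator_onD[OF commutator_deriv_bop[OF \<alpha>_in_\<A>[OF a]]])
    have fst: "coord (monomial a m \<bullet>\<^sub>o u) k = ?P \<bullet>\<^sub>o ?x" by (rule coord_monomial)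
    have snd: "coord (monomial a m \<bullet>\<^sub>o v + (deriv_band a m + (c * of_int m) *\<^sub>C monomial a m) \<bullet>\<^sub>o u) k
          - (c * of_int k) *\<^sub>C (?P \<bullet>\<^sub>o ?x) =
        ?P \<bullet>\<^sub>o (coord v (k - m) - (c * of_int (k - m)) *\<^sub>C ?x) + deriv_bop (\<alpha> (- k) a) \<bullet>\<^sub>o ?x"
      by (simp add: coord_monomial coord_deriv_band[OF a] bop_app_scaleC_left bop_app_linear
          bop_app_scaleC right_diff_distrib scaleC_diff_left)
    show "(coord (monomial a m \<bullet>\<^sub>o u) k,
        coord (monomial a m \<bullet>\<^sub>o v + (deriv_band a m + (c * of_int m) *\<^sub>C monomial a m) \<bullet>\<^sub>o u) k
          - (c * of_int k) *\<^sub>C coord (monomial a m \<bullet>\<^sub>o u) k) \<in> D"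
      unfolding fst snd by (rule mem)
  qed
qed

text \<open>The parts of the commutator coming from \<open>D \<otimes> 1\<close> and from \<open>1 \<otimes> M\<close>.\<close>

definition horizontal :: "int set \<Rightarrow> (int \<Rightarrow> 'a) \<Rightarrow> 'h l2Z bop"
  where "horizontal F f = (\<Sum>n\<in>F. deriv_band (f n) n)"

definition vertical :: "int set \<Rightarrow> (int \<Rightarrow> 'a) \<Rightarrow> 'h l2Z bop"
  where "vertical F f = (\<Sum>n\<in>F. of_int n *\<^sub>C monomial (f n) n)"

lemma linear_dirac_corner: "c \<in> {\<i>, - \<i>} \<Longrightarrow> linear_operator (dirac_corner c D)"
  using densely_defined_dirac_corner by (simp add: densely_defined_def)

lemma commutator_crossed:
  assumes f: "\<And>n. n \<in> F \<Longrightarrow> f n \<in> \<A>"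
  shows "commutator_on (crossed_dirac D)
    ((\<Sum>n\<in>F. monomial (f n) n) \<oplus>\<^sub>o (\<Sum>n\<in>F. monomial (f n) n))
    (off_diagonal_bop (horizontal F f + (- \<i>) *\<^sub>C vertical F f) (horizontal F f + \<i> *\<^sub>C vertical F f))"
proof -
  have "commutator_on (dirac_corner c D) (\<Sum>n\<in>F. monomial (f n) n) (horizontal F f + c *\<^sub>C vertical F f)"
    if c: "c \<in> {\<i>, - \<i>}" for c
  proof -
    have "horizontal F f + c *\<^sub>C vertical F f =
        (\<Sum>n\<in>F. deriv_band (f n) n + (c * of_int n) *\<^sub>C monomial (f n) n)"
      unfolding horizontal_def vertical_def
      by (simp add: linear_sum[OF bounded_linear.linear[OF bounded_linear_scaleC]] sum.distrib
          scaleC_scaleC)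
    then show ?thesis
      using commutator_on_sum[OF linear_dirac_corner[OF c] commutator_monomial[OF c f]] by simp
  qed
  then show ?thesis unfolding crossed_dirac_eq by (intro commutator_on_off_diagonal) auto
qed

lemma densely_defined_crossed_dirac: "densely_defined (crossed_dirac D)"
  using selfadjoint_crossed_dirac by (simp add: selfadjoint_operator_def)

lemma commutator_crossed_Cc:
  assumes "x \<in> crossed_Cc \<pi> \<alpha> \<A>"
  shows "\<exists>E. commutator_on (crossed_dirac D) (x \<oplus>\<^sub>o x) E"
proof -
  obtain F f where "finite F" "\<forall>n\<in>F. f n \<in> \<A>" "x = (\<Sum>n\<in>F. monomial (f n) n)"
    using assms unfolding crossed_Cc_eq by blast
  then show ?thesis using commutator_crossed[of F f] by blast
qed

lemma lip_seminorm_crossed: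
  assumes "commutator_on (crossed_dirac D) (x \<oplus>\<^sub>o x) E"
  shows "lip_seminorm (\<lambda>x. x \<oplus>\<^sub>o x) (crossed_dirac D) x = norm E"
proof (rule lip_seminorm_eq[where \<pi>="\<lambda>x. x \<oplus>\<^sub>o x", OF densely_defined_crossed_dirac])
  show "\<forall>z\<in>Domain (crossed_dirac D). (x \<oplus>\<^sub>o x) \<bullet>\<^sub>o z \<in> Domain (crossed_dirac D)"
    by (rule commutator_on_imp_domain[OF assms])
  show "extends_commutator E (crossed_dirac D) (x \<oplus>\<^sub>o x)"
    using densely_defined_crossed_dirac
    by (intro commutator_on_imp_extends assms) (simp add: densely_defined_def linear_operator_def)
qed

lemma even_spectral_triple_crossed:
  "even_spectral_triple (crossed_product \<pi> \<alpha>) (crossed_Cc \<pi> \<alpha> \<A>) (\<lambda>x. x \<oplus>\<^sub>o x) (crossed_dirac D)"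
proof -
  have sep: "separable_space (euclidean :: 'a topology)" "separable_space (euclidean :: 'h topology)"
    using triple by (simp_all add: odd_spectral_triple_def)
  obtain S where S: "is_inverse_sqrt_one_plus_square S D" "compact_bop S"
    using triple unfolding odd_spectral_triple_def by blast
  have "(\<forall>z\<in>Domain (crossed_dirac D). (x \<oplus>\<^sub>o x) \<bullet>\<^sub>o z \<in> Domain (crossed_dirac D)) \<and>
      (\<exists>C. extends_commutator C (crossed_dirac D) (x \<oplus>\<^sub>o x))" if x: "x \<in> crossed_Cc \<pi> \<alpha> \<A>" for x
  proof -
    obtain E where E: "commutator_on (crossed_dirac D) (x \<oplus>\<^sub>o x) E"
      using commutator_crossed_Cc[OF x] by blast
    have "single_valued (crossed_dirac D)"
      using densely_defined_crossed_dirac by (simp add: densely_defined_def linear_operator_def)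
    then show ?thesis
      using commutator_on_imp_domain[OF E] commutator_on_imp_extends[OF _ E] by blast
  qed
  then have "odd_spectral_triple (crossed_product \<pi> \<alpha>) (crossed_Cc \<pi> \<alpha> \<A>) (\<lambda>x. x \<oplus>\<^sub>o x) (crossed_dirac D)"
    unfolding odd_spectral_triple_def
    using unital_crossed_product separable_crossed_product[OF sep(1)]
      separable_prod[OF separable_l2Z[OF sep(2)] separable_l2Z[OF sep(2)]]
      representation_direct_sum star_subalgebra_crossed_Cc[OF \<A>_subalgebra] \<alpha>_in_\<A>
      crossed_Cc_subset crossed_Cc_dense[OF \<A>_subalgebra \<A>_dense] selfadjoint_crossed_dirac
      compact_resolvent_crossed_dirac[OF S]
    by (intro conjI ballI) (simp_all add: image_subset_iff)
  moreover have "\<exists>D0. densely_defined D0 \<and> crossed_dirac D = off_diagonal D0 (op_adjoint D0)"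
    unfolding crossed_dirac_eq
    using densely_defined_dirac_corner[of "- \<i>"] adjoint_dirac_corner[of "- \<i>"]
    by (intro exI[of _ "dirac_corner (- \<i>) D"]) simp
  moreover have "\<exists>\<pi>0 \<pi>1. \<forall>x\<in>crossed_product \<pi> \<alpha>. x \<oplus>\<^sub>o x = \<pi>0 x \<oplus>\<^sub>o \<pi>1 x"
    by (intro exI[of _ "\<lambda>x. x"]) simp
  ultimately show ?thesis unfolding even_spectral_triple_def by simp
qed

section \<open>The Lip-metric on the crossed product\<close>

text \<open>
  For \<open>Z\<close> horizontal and \<open>Y\<close> vertical, the corners of the commutator are \<open>Z \<plusminus> \<i> Y\<close>, so that \<open>Z\<close> and \<open>\<i> Y\<close>
  are half of their sum and half of their difference.
\<close>

lemma norm_horizontal_vertical_le: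
  assumes f: "\<And>n. n \<in> F \<Longrightarrow> f n \<in> \<A>"
    and L: "lip_seminorm (\<lambda>x. x \<oplus>\<^sub>o x) (crossed_dirac D) (\<Sum>n\<in>F. monomial (f n) n) \<le> 1"
  shows "norm (horizontal F f) \<le> 1" "norm (vertical F f) \<le> 1"
proof -
  let ?Z = "horizontal F f" and ?Y = "vertical F f"
  let ?E = "off_diagonal_bop (?Z + (- \<i>) *\<^sub>C ?Y) (?Z + \<i> *\<^sub>C ?Y)"
  have "norm ?E \<le> 1" using L lip_seminorm_crossed[OF commutator_crossed[OF f]] by simp
  then have E: "norm (?Z + (- \<i>) *\<^sub>C ?Y) \<le> 1" "norm (?Z + \<i> *\<^sub>C ?Y) \<le> 1"
    by (rule order_trans[OF norm_off_diagonal_bop_ge(1)], rule order_trans[OF norm_off_diagonal_bop_ge(2)])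
  have z: "\<i> *\<^sub>C ?Y + (- \<i>) *\<^sub>C ?Y = 0" unfolding scaleC_add_left[symmetric] by simp
  have "2 *\<^sub>R ?Z = (?Z + \<i> *\<^sub>C ?Y) + (?Z + (- \<i>) *\<^sub>C ?Y)"
    using z by (simp add: scaleR_2 algebra_simps)
  then have "norm (2 *\<^sub>R ?Z) \<le> 2" using norm_triangle_mono[OF E(2,1)] by simp
  then show "norm ?Z \<le> 1" by simp
  have "2 *\<^sub>R (\<i> *\<^sub>C ?Y) = (?Z + \<i> *\<^sub>C ?Y) - (?Z + (- \<i>) *\<^sub>C ?Y)"
    using z by (simp add: scaleR_2 algebra_simps eq_neg_iff_add_eq_0)
  then have "norm (2 *\<^sub>R (\<i> *\<^sub>C ?Y)) \<le> 2"
    using norm_triangle_ineq4[of "?Z + \<i> *\<^sub>C ?Y" "?Z + (- \<i>) *\<^sub>C ?Y"] E by simp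
  then show "norm ?Y \<le> 1" by (simp add: norm_scaleC)
qed

lemma bounded_vertical: "\<exists>b. \<forall>k. norm (of_int n *\<^sub>C \<pi> (\<alpha> (- k) a)) \<le> b"
  and band_vertical: "band (\<lambda>k. of_int n *\<^sub>C \<pi> (\<alpha> (- k) a)) n = of_int n *\<^sub>C monomial a n"
proof -
  have le: "norm (of_int n *\<^sub>C \<pi> (\<alpha> (- k) a)) \<le> \<bar>real_of_int n\<bar> * norm a" for k
    by (simp add: norm_scaleC mult_left_mono norm_\<pi>\<alpha>_le)
  then show "\<exists>b. \<forall>k. norm (of_int n *\<^sub>C \<pi> (\<alpha> (- k) a)) \<le> b" by blast
  show "band (\<lambda>k. of_int n *\<^sub>C \<pi> (\<alpha> (- k) a)) n = of_int n *\<^sub>C monomial a n"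
    by (intro bop_eqI l2Z_eqI) (simp add: coord_band[OF le] coord_monomial bop_app_scaleC_left)
qed

lemma vertical_eq: "vertical F f = (\<Sum>n\<in>F. band (\<lambda>k. of_int n *\<^sub>C \<pi> (\<alpha> (- k) (f n))) n)"
  by (simp add: vertical_def band_vertical)

text \<open>
  The entry in row \<open>0\<close> on the \<open>n\<close>-th diagonal of the horizontal part is \<open>[D, \<pi>(f n)]\<close>.
\<close>

lemma lip_seminorm_coefficient_le:
  assumes F: "finite F" and f: "\<And>n. f n \<in> \<A>" and n: "n \<in> F"
  shows "lip_seminorm \<pi> D (f n) \<le> norm (horizontal F f)"
proof -
  have "norm (deriv_bop (\<alpha> (- 0) (f n))) \<le> norm (\<Sum>n\<in>F. band (\<lambda>k. deriv_bop (\<alpha> (- k) (f n))) n)"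
    using F n deriv_bop_bounded[OF f]
    by (intro norm_band_entry_le[where K="\<lambda>n k. deriv_bop (\<alpha> (- k) (f n))"]) auto
  then show ?thesis by (simp add: horizontal_def deriv_band_def norm_deriv_bop)
qed

lemma norm_coefficient_le:
  assumes F: "finite F" and n: "n \<in> F" "n \<noteq> 0"
  shows "norm (monomial (f n) 0) \<le> norm (vertical F f)"
  unfolding monomial_eq_band
proof (rule norm_band_le)
  fix k
  have "norm (of_int n *\<^sub>C \<pi> (\<alpha> (- k) (f n))) \<le> norm (vertical F f)"
    unfolding vertical_eq
    by (rule norm_band_entry_le[where K="\<lambda>n k. of_int n *\<^sub>C \<pi> (\<alpha> (- k) (f n))", OF F _ n(1)])
      (rule bounded_vertical)
  moreover have "norm (\<pi> (\<alpha> (- k) (f n))) \<le> \<bar>real_of_int n\<bar> * norm (\<pi> (\<alpha> (- k) (f n)))"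
    using n(2) mult_right_mono[of 1 "\<bar>real_of_int n\<bar>" "norm (\<pi> (\<alpha> (- k) (f n)))"] by simp
  ultimately show "norm (\<pi> (\<alpha> (- k) (f n))) \<le> norm (vertical F f)" by (simp add: norm_scaleC)
qed

text \<open>
  This estimate makes Fourier expansions converge uniformly on the unit ball of the seminorm.  The vectors
  \<open>f\<^sub>n \<lambda>\<^sub>n u\<close> are the products of \<open>1 / n\<close> and of \<open>n f\<^sub>n \<lambda>\<^sub>n u\<close>; the squares of the norms of the latter have
  a sum bounded by the vertical part, and the Cauchy-Schwarz inequality applies.
\<close>

lemma norm_tail_le:
  assumes F: "finite F" and G: "G \<subseteq> F" "0 \<notin> G"
  shows "norm (\<Sum>n\<in>G. monomial (f n) n) \<le> sqrt (\<Sum>n\<in>G. 1 / (real_of_int n)\<^sup>2) * norm (vertical F f)"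
proof (rule norm_bop_bound)
  let ?s = "\<Sum>n\<in>G. 1 / (real_of_int n)\<^sup>2"
  have s: "0 \<le> ?s" by (intro sum_nonneg) simp
  then show "0 \<le> sqrt ?s * norm (vertical F f)" by simp
  fix u
  let ?v = "\<lambda>n. norm ((of_int n *\<^sub>C monomial (f n) n) \<bullet>\<^sub>o u)"
  have "norm ((\<Sum>n\<in>G. monomial (f n) n) \<bullet>\<^sub>o u) \<le> (\<Sum>n\<in>G. norm (monomial (f n) n \<bullet>\<^sub>o u))"
    unfolding bop_app_sum by (rule norm_sum)
  also have "\<dots> = (\<Sum>n\<in>G. (1 / \<bar>real_of_int n\<bar>) * ?v n)"
    using G(2) by (intro sum.cong refl) (auto simp: bop_app_scaleC_left norm_scaleC_hilbert)
  finally have le: "norm ((\<Sum>n\<in>G. monomial (f n) n) \<bullet>\<^sub>o u) \<le> (\<Sum>n\<in>G. (1 / \<bar>real_of_int n\<bar>) * ?v n)" .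
  have sq: "(\<Sum>n\<in>G. (?v n)\<^sup>2) \<le> (norm (vertical F f) * norm u)\<^sup>2"
    unfolding vertical_eq band_vertical[symmetric] using F bounded_vertical G(1)
    by (rule sum_norm_band_le[where K="\<lambda>n k. of_int n *\<^sub>C \<pi> (\<alpha> (- k) (f n))"])
  have "(\<Sum>n\<in>G. (1 / \<bar>real_of_int n\<bar>) * ?v n)\<^sup>2 \<le> (\<Sum>n\<in>G. (1 / \<bar>real_of_int n\<bar>)\<^sup>2) * (\<Sum>n\<in>G. (?v n)\<^sup>2)"
    by (rule Cauchy_Schwarz_ineq_sum)
  also have "\<dots> = ?s * (\<Sum>n\<in>G. (?v n)\<^sup>2)" by (simp add: power_divide)
  also have "\<dots> \<le> ?s * (norm (vertical F f) * norm u)\<^sup>2" by (rule mult_left_mono[OF sq s])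
  also have "\<dots> = (sqrt ?s * norm (vertical F f) * norm u)\<^sup>2"
    using s by (simp add: power_mult_distrib)
  finally have "(\<Sum>n\<in>G. (1 / \<bar>real_of_int n\<bar>) * ?v n) \<le> sqrt ?s * norm (vertical F f) * norm u"
    by (rule power2_le_imp_le) (use s in simp)
  then show "norm ((\<Sum>n\<in>G. monomial (f n) n) \<bullet>\<^sub>o u) \<le> sqrt ?s * norm (vertical F f) * norm u"
    using le by linarith
qed

text \<open>
  The vector states of the representations \<open>\<pi> \<circ> \<alpha>\<^sub>n\<close> determine the norm of \<open>\<pi>~(a)\<close> up to a factor \<open>2\<close>.
\<close>

definition vector_state :: "int \<Rightarrow> 'h \<Rightarrow> 'a \<Rightarrow> complex"
  where "vector_state n \<xi> a = cinner (\<pi> (\<alpha> n a) \<bullet>\<^sub>o \<xi>) \<xi>"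

lemma vector_state_in_state_space:
  assumes "norm \<xi> = 1"
  shows "vector_state n \<xi> \<in> state_space UNIV"
proof -
  have "vector_state n \<xi> (star a * a) \<in> \<real>\<^sub>\<ge>\<^sub>0" for a
  proof -
    have "vector_state n \<xi> (star a * a) = complex_of_real ((norm (\<pi> (\<alpha> n a) \<bullet>\<^sub>o \<xi>))\<^sup>2)"
      by (simp add: vector_state_def \<alpha>_simps \<pi>_simps cinner_star_left cinner_self)
    then show ?thesis by (simp add: complex_nonneg_Reals_iff)
  qed
  then show ?thesis
    using assms by (simp add: state_space_def vector_state_def \<alpha>_simps \<pi>_simps cinner_add_left
        bop_app_scaleC_left cinner_scaleC_left cinner_self)
qed

text \<open>An arbitrary unit vector, whose vector state \<open>\<omega>\<close> selects the scalar by which elements are normalized.\<close>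

definition unit_vector :: 'h
  where "unit_vector = (SOME \<xi>. norm \<xi> = 1)"

lemma norm_unit_vector: "norm unit_vector = 1"
proof -
  obtain u :: 'h where "u \<noteq> 0" using ex_nonzero by blast
  then have "norm (u /\<^sub>R norm u) = 1" by simp
  then show ?thesis unfolding unit_vector_def by (rule someI)
qed

definition \<omega> :: "'a \<Rightarrow> complex"
  where "\<omega> = vector_state 0 unit_vector"

abbreviation lip_ball :: "'a set"
  where "lip_ball \<equiv> {a \<in> \<A>. lip_seminorm \<pi> D a \<le> 1}"

text \<open>
  In each coordinate the difference has a numerical radius of at most \<open>e\<close>, which is tested on vector states.
\<close>

lemma norm_monomial_le_states:
  assumes e: "0 \<le> e"
    and le: "\<And>\<phi>. \<phi> \<in> state_space UNIV \<Longrightarrow> cmod (\<phi> a - \<omega> a - (\<phi> b - \<omega> b)) \<le> e"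
  shows "norm ((monomial a 0 - \<omega> a *\<^sub>C 1) - (monomial b 0 - \<omega> b *\<^sub>C 1)) \<le> 2 * e"
proof -
  let ?K = "\<lambda>k. (\<pi> (\<alpha> (- k) a) - \<omega> a *\<^sub>C 1) - (\<pi> (\<alpha> (- k) b) - \<omega> b *\<^sub>C 1)"
  have K: "norm (?K k) \<le> 2 * e" for k
  proof (rule norm_le_numerical_radius)
    fix x :: 'h
    have dl: "cinner (y - y') z = cinner y z - cinner y' z" for y y' z :: 'h
      using cinner_add_left[of "y - y'" y' z] by simp
    have unit: "cmod (cinner (?K k \<bullet>\<^sub>o \<xi>) \<xi>) \<le> e" if \<xi>: "norm \<xi> = 1" for \<xi>
    proof -
      have "cinner (?K k \<bullet>\<^sub>o \<xi>) \<xi> = vector_state (- k) \<xi> a - \<omega> a - (vector_state (- k) \<xi> b - \<omega> b)"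
        using \<xi> by (simp add: dl vector_state_def bop_app_scaleC_left cinner_scaleC_left cinner_self)
      then show ?thesis using le[OF vector_state_in_state_space[OF \<xi>]] by simp
    qed
    show "cmod (cinner (?K k \<bullet>\<^sub>o x) x) \<le> e * (norm x)\<^sup>2"
    proof (cases "x = 0")
      case True
      then show ?thesis using e cinner_self[of 0] by (simp only: bop_app_linear) simp
    next
      case False
      define \<xi> where "\<xi> = x /\<^sub>R norm x"
      have "norm \<xi> = 1" using False by (simp add: \<xi>_def)
      have x: "x = complex_of_real (norm x) *\<^sub>C \<xi>"
        using False by (simp add: \<xi>_def scaleR_scaleC[symmetric])
      have "cinner (?K k \<bullet>\<^sub>o x) x = complex_of_real ((norm x)\<^sup>2) * cinner (?K k \<bullet>\<^sub>o \<xi>) \<xi>"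
        by (subst (1 2) x) (simp only: bop_app_scaleC cinner_scaleC_left cinner_scaleC_right
            complex_cnj_complex_of_real power2_eq_square of_real_mult mult.assoc)
      then have "cmod (cinner (?K k \<bullet>\<^sub>o x) x) = (norm x)\<^sup>2 * cmod (cinner (?K k \<bullet>\<^sub>o \<xi>) \<xi>)"
        by (simp only: norm_mult norm_of_real) simp
      then show ?thesis
        using mult_left_mono[OF unit[OF \<open>norm \<xi> = 1\<close>], of "(norm x)\<^sup>2"] by (simp add: mult.commute)
    qed
  qed
  have "(monomial a 0 - \<omega> a *\<^sub>C 1) - (monomial b 0 - \<omega> b *\<^sub>C 1) = band ?K 0"
    by (intro bop_eqI l2Z_eqI) (simp add: coord_band[where K="?K", OF K] coord_monomial bop_app_scaleC_left)
  then show ?thesis using norm_band_le[of ?K, OF K] by simp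
qed

lemma totally_bounded_lip_ball_mod_state:
  "totally_bounded ((\<lambda>a. monomial a 0 - \<omega> a *\<^sub>C 1) ` lip_ball)"
  unfolding totally_bounded_iff
proof (intro allI impI)
  fix e :: real
  assume e: "0 < e"
  have A: "unital_cstar_subalgebra (UNIV :: 'a set)"
    using triple by (simp add: odd_spectral_triple_def)
  have \<omega>: "\<omega> \<in> state_space UNIV" unfolding \<omega>_def by (rule vector_state_in_state_space[OF norm_unit_vector])
  have "0 < e / 3" using e by simp
  from lip_metric_imp_net[OF A lip \<omega> this]
  obtain N where N: "finite N" "N \<subseteq> lip_ball" "\<forall>a\<in>lip_ball. \<exists>b\<in>N. \<forall>\<phi>\<in>state_space UNIV.
      cmod (\<phi> a - \<omega> a - (\<phi> b - \<omega> b)) < e / 3"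
    by (elim exE conjE)
  let ?g = "\<lambda>a. monomial a 0 - \<omega> a *\<^sub>C 1"
  have "\<exists>z\<in>?g ` N. dist (?g a) z < e" if a: "a \<in> lip_ball" for a
  proof -
    obtain b where b: "b \<in> N" "\<forall>\<phi>\<in>state_space UNIV. cmod (\<phi> a - \<omega> a - (\<phi> b - \<omega> b)) < e / 3"
      using N(3) a by blast
    have "norm (?g a - ?g b) \<le> 2 * (e / 3)"
      using b(2) e by (intro norm_monomial_le_states) (auto intro: less_imp_le)
    also have "\<dots> < e" using e by simp
    finally show ?thesis using b(1) by (auto simp: dist_norm)
  qed
  then have "\<forall>x\<in>?g ` lip_ball. \<exists>z\<in>?g ` N. dist x z < e" by blast
  moreover have "finite (?g ` N)" using N(1) by simp
  ultimately show "\<exists>Z. finite Z \<and> (\<forall>x\<in>?g ` lip_ball. \<exists>z\<in>Z. dist x z < e)" by blast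
qed

text \<open>
  If \<open>\<pi>~(a)\<close> has norm at most \<open>1\<close>, then the scalar \<open>\<omega>(a)\<close> lies in a fixed disc.  The set is thus contained in
  the sum of a totally bounded set and of a disc of scalars.
\<close>

lemma totally_bounded_lip_ball_bounded:
  "totally_bounded ((\<lambda>a. monomial a 0) ` {a \<in> lip_ball. norm (monomial a 0) \<le> 1})"
proof -
  have tb: "totally_bounded ((\<lambda>c. c *\<^sub>C (1 :: 'h l2Z bop)) ` cball 0 2)"
  proof (rule totally_bounded_lipschitz_image[where k=1])
    show "totally_bounded (cball (0::complex) 2)" by (rule totally_bounded_if_bounded) simp
    show "dist (c *\<^sub>C 1) (c' *\<^sub>C (1 :: 'h l2Z bop)) \<le> 1 * dist c c'" for c c'
    proof -
      have "c *\<^sub>C 1 - c' *\<^sub>C 1 = (c - c') *\<^sub>C (1 :: 'h l2Z bop)"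
        using scaleC_add_left[of "c - c'" c' "1 :: 'h l2Z bop"] by simp
      then show ?thesis by (simp add: dist_norm norm_scaleC)
    qed
  qed
  have "cmod (\<omega> a) \<le> 2" if "norm (monomial a 0) \<le> 1" for a
  proof -
    have "norm (\<pi> a \<bullet>\<^sub>o unit_vector) = norm (coord (monomial a 0 \<bullet>\<^sub>o (unit_vector \<otimes>\<delta> 0)) 0)"
      by (simp add: coord_monomial coord_tensor_delta)
    also have "\<dots> \<le> norm (monomial a 0) * norm (unit_vector \<otimes>\<delta> 0)"
      using norm_coord_le norm_bop_app by (rule order_trans)
    also have "\<dots> \<le> 1" using that by (simp add: norm_unit_vector)
    finally have "norm (\<pi> a \<bullet>\<^sub>o unit_vector) \<le> 1" .
    then show ?thesis
      using cinner_Cauchy_Schwarz[of "\<pi> a \<bullet>\<^sub>o unit_vector" unit_vector] by (simp add: \<omega>_def vector_state_def norm_unit_vector)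
  qed
  then have "(\<lambda>a. monomial a 0) ` {a \<in> lip_ball. norm (monomial a 0) \<le> 1} \<subseteq>
      {x + y |x y. x \<in> (\<lambda>a. monomial a 0 - \<omega> a *\<^sub>C 1) ` lip_ball \<and> y \<in> (\<lambda>c. c *\<^sub>C 1) ` cball 0 2}"
  proof (intro subsetI, elim imageE)
    fix x a
    assume le: "\<And>a. norm (monomial a 0) \<le> 1 \<Longrightarrow> cmod (\<omega> a) \<le> 2"
      and a: "x = monomial a 0" "a \<in> {a \<in> lip_ball. norm (monomial a 0) \<le> 1}"
    have "x = (monomial a 0 - \<omega> a *\<^sub>C 1) + \<omega> a *\<^sub>C 1" by (simp add: a(1))
    moreover have "monomial a 0 - \<omega> a *\<^sub>C 1 \<in> (\<lambda>a. monomial a 0 - \<omega> a *\<^sub>C 1) ` lip_ball"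
      using a(2) by (intro imageI) simp
    moreover have "\<omega> a *\<^sub>C 1 \<in> (\<lambda>c. c *\<^sub>C (1 :: 'h l2Z bop)) ` cball 0 2"
      using a(2) le[of a] by (intro imageI) simp
    ultimately show "x \<in> {x + y |x y. x \<in> (\<lambda>a. monomial a 0 - \<omega> a *\<^sub>C 1) ` lip_ball \<and>
        y \<in> (\<lambda>c. c *\<^sub>C 1) ` cball 0 2}" by blast
  qed
  from totally_bounded_subset[OF totally_bounded_add[OF totally_bounded_lip_ball_mod_state tb] this]
  show ?thesis .
qed

abbreviation crossed_lip :: "'h l2Z bop \<Rightarrow> real"
  where "crossed_lip \<equiv> lip_seminorm (\<lambda>x. x \<oplus>\<^sub>o x) (crossed_dirac D)"

abbreviation crossed_lip_ball :: "'h l2Z bop set"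
  where "crossed_lip_ball \<equiv> {x \<in> crossed_Cc \<pi> \<alpha> \<A>. crossed_lip x \<le> 1}"

text \<open>
  The elements of \<open>C\<^sub>c(\<int>, \<A>)\<close> are operators; this choice turns them into finitely supported functions.
\<close>

definition coefficients :: "'h l2Z bop \<Rightarrow> (int set \<times> (int \<Rightarrow> 'a))"
  where "coefficients x = (SOME (F, f). finite F \<and> (\<forall>n. f n \<in> \<A>) \<and> (\<forall>n. n \<notin> F \<longrightarrow> f n = 0) \<and>
    x = (\<Sum>n\<in>F. monomial (f n) n))"

definition support :: "'h l2Z bop \<Rightarrow> int set"
  where "support x = fst (coefficients x)"

definition coefficient :: "'h l2Z bop \<Rightarrow> int \<Rightarrow> 'a"
  where "coefficient x = snd (coefficients x)"

text \<open>
  The sum may run over any finite set containing the support, so a single index can be adjoined to it.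
\<close>

lemma crossed_Cc_expansion:
  assumes "x \<in> crossed_Cc \<pi> \<alpha> \<A>"
  shows "finite (support x)" "coefficient x n \<in> \<A>"
    "finite F \<Longrightarrow> support x \<subseteq> F \<Longrightarrow> x = (\<Sum>n\<in>F. monomial (coefficient x n) n)"
proof -
  obtain G g where G: "finite G" "\<forall>n\<in>G. g n \<in> \<A>" "x = (\<Sum>n\<in>G. monomial (g n) n)"
    using assms unfolding crossed_Cc_eq by blast
  define h where "h n = (if n \<in> G then g n else 0)" for n
  have "0 \<in> \<A>" using \<A>_subalgebra by (simp add: star_subalgebra_def)
  then have "\<forall>n. h n \<in> \<A>" using G(2) by (simp add: h_def)
  moreover have "x = (\<Sum>n\<in>G. monomial (h n) n)"
    unfolding G(3) by (intro sum.cong) (simp_all add: h_def)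
  ultimately have "case (G, h) of (F, f) \<Rightarrow> finite F \<and> (\<forall>n. f n \<in> \<A>) \<and> (\<forall>n. n \<notin> F \<longrightarrow> f n = 0) \<and>
      x = (\<Sum>n\<in>F. monomial (f n) n)"
    using G(1) by (simp add: h_def)
  then have "case coefficients x of (F, f) \<Rightarrow> finite F \<and> (\<forall>n. f n \<in> \<A>) \<and>
      (\<forall>n. n \<notin> F \<longrightarrow> f n = 0) \<and> x = (\<Sum>n\<in>F. monomial (f n) n)"
    unfolding coefficients_def by (rule someI)
  then have p: "finite (support x) \<and> (\<forall>n. coefficient x n \<in> \<A>) \<and>
      (\<forall>n. n \<notin> support x \<longrightarrow> coefficient x n = 0) \<and>
      x = (\<Sum>n\<in>support x. monomial (coefficient x n) n)"
    unfolding support_def coefficient_def case_prod_beta .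
  then show "finite (support x)" "coefficient x n \<in> \<A>" by blast+
  show "x = (\<Sum>n\<in>F. monomial (coefficient x n) n)" if "finite F" "support x \<subseteq> F"
  proof -
    have "(\<Sum>n\<in>F. monomial (coefficient x n) n) = (\<Sum>n\<in>support x. monomial (coefficient x n) n)"
      using p that by (intro sum.mono_neutral_right) auto
    then show ?thesis using p by simp
  qed
qed

lemma coefficient_bounds:
  assumes x: "x \<in> crossed_lip_ball"
  shows "coefficient x n \<in> lip_ball" "n \<noteq> 0 \<Longrightarrow> norm (monomial (coefficient x n) 0) \<le> 1"
    "norm (vertical (support x) (coefficient x)) \<le> 1"
proof -
  have Cc: "x \<in> crossed_Cc \<pi> \<alpha> \<A>" and L: "crossed_lip x \<le> 1" using x by simp_all
  note ex = crossed_Cc_expansion[OF Cc]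
  have hv: "norm (horizontal F (coefficient x)) \<le> 1" "norm (vertical F (coefficient x)) \<le> 1"
    if "finite F" "support x \<subseteq> F" for F
    using norm_horizontal_vertical_le[of F "coefficient x", OF ex(2)] L ex(3)[OF that] by simp_all
  show "norm (vertical (support x) (coefficient x)) \<le> 1" by (rule hv(2)[OF ex(1) order_refl])
  have fin: "finite (insert n (support x))" using ex(1) by simp
  have sub: "support x \<subseteq> insert n (support x)" by blast
  have "lip_seminorm \<pi> D (coefficient x n) \<le> 1"
    using lip_seminorm_coefficient_le[of "insert n (support x)" "coefficient x" n, OF fin ex(2)]
      hv(1)[OF fin sub] by simp
  then show "coefficient x n \<in> lip_ball" using ex(2) by simp
  show "norm (monomial (coefficient x n) 0) \<le> 1" if "n \<noteq> 0"
    using norm_coefficient_le[of "insert n (support x)" n "coefficient x", OF fin _ that]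
      hv(2)[OF fin sub] by simp
qed

text \<open>
  The coefficient of \<open>\<lambda>\<^sub>0\<close> is controlled modulo scalars only, and its scalar part is removed by \<open>\<omega>\<close>.
\<close>

definition reduced_coefficient :: "int \<Rightarrow> 'h l2Z bop \<Rightarrow> 'h l2Z bop"
  where "reduced_coefficient n x = monomial (coefficient x n) 0 -
    (if n = 0 then \<omega> (coefficient x 0) *\<^sub>C 1 else 0)"

lemma totally_bounded_reduced_coefficient: "totally_bounded (reduced_coefficient n ` crossed_lip_ball)"
proof (cases "n = 0")
  case True
  have "reduced_coefficient n ` crossed_lip_ball \<subseteq> (\<lambda>a. monomial a 0 - \<omega> a *\<^sub>C 1) ` lip_ball"
    using coefficient_bounds(1) by (auto simp: reduced_coefficient_def True)
  with totally_bounded_lip_ball_mod_state show ?thesis by (rule totally_bounded_subset)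
next
  case False
  have "reduced_coefficient n ` crossed_lip_ball \<subseteq>
      (\<lambda>a. monomial a 0) ` {a \<in> lip_ball. norm (monomial a 0) \<le> 1}"
    using coefficient_bounds(1,2) False by (auto simp: reduced_coefficient_def)
  with totally_bounded_lip_ball_bounded show ?thesis by (rule totally_bounded_subset)
qed

text \<open>
  The remainder consists of the terms outside \<open>F\<close>, which are bounded uniformly on the unit ball.
\<close>

lemma truncated_expansion:
  assumes x: "x \<in> crossed_lip_ball" and F: "finite F" "0 \<in> F"
    and tail: "\<And>G. finite G \<Longrightarrow> G \<inter> F = {} \<Longrightarrow> (\<Sum>n\<in>G. 1 / (real_of_int n)\<^sup>2) \<le> e\<^sup>2"
    and e: "0 \<le> e"
  shows "norm (x - \<omega> (coefficient x 0) *\<^sub>C 1 - (\<Sum>n\<in>F. reduced_coefficient n x * monomial 1 n)) \<le> e"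
proof -
  let ?c = "coefficient x" and ?S = "support x"
  have Cc: "x \<in> crossed_Cc \<pi> \<alpha> \<A>" using x by simp
  note ex = crossed_Cc_expansion[OF Cc]
  have S: "finite ?S" by (rule ex(1))
  have "x = (\<Sum>n\<in>F \<union> (?S - F). monomial (?c n) n)"
    using F(1) S by (intro ex(3)) auto
  also have "\<dots> = (\<Sum>n\<in>F. monomial (?c n) n) + (\<Sum>n\<in>?S - F. monomial (?c n) n)"
    using F(1) S by (intro sum.union_disjoint) auto
  also have "(\<Sum>n\<in>F. monomial (?c n) n) =
      (\<Sum>n\<in>F. reduced_coefficient n x * monomial 1 n + (if n = 0 then \<omega> (?c 0) *\<^sub>C 1 else 0))"
    by (intro sum.cong refl)
      (simp add: reduced_coefficient_def left_diff_distrib monomial_mult monomial_1_0)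
  also have "\<dots> = (\<Sum>n\<in>F. reduced_coefficient n x * monomial 1 n) + \<omega> (?c 0) *\<^sub>C 1"
    using F by (simp add: sum.distrib)
  finally have "x - \<omega> (?c 0) *\<^sub>C 1 - (\<Sum>n\<in>F. reduced_coefficient n x * monomial 1 n) =
      (\<Sum>n\<in>?S - F. monomial (?c n) n)"
    by (simp add: algebra_simps)
  moreover have "norm (\<Sum>n\<in>?S - F. monomial (?c n) n) \<le> e"
  proof -
    let ?s = "\<Sum>n\<in>?S - F. 1 / (real_of_int n)\<^sup>2"
    have "norm (\<Sum>n\<in>?S - F. monomial (?c n) n) \<le> sqrt ?s * norm (vertical ?S ?c)"
      using S F(2) by (intro norm_tail_le) auto
    also have "\<dots> \<le> e * 1"
    proof (rule mult_mono)
      have "?s \<le> e\<^sup>2" using S by (intro tail) auto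
      then show "sqrt ?s \<le> e" using e by (intro real_le_lsqrt) (simp_all add: sum_nonneg)
      show "norm (vertical ?S ?c) \<le> 1" by (rule coefficient_bounds(3)[OF x])
    qed (use e in simp_all)
    finally show ?thesis by simp
  qed
  ultimately show ?thesis by simp
qed

lemma totally_bounded_crossed: "totally_bounded_mod_scalars crossed_lip_ball"
  unfolding totally_bounded_mod_scalars_def
proof (intro allI impI)
  fix e :: real
  assume e: "0 < e"
  then have "0 < (e / 8)\<^sup>2" by simp
  from inverse_squares_tail[OF this] obtain F where F: "finite F" "0 \<in> F"
    "\<forall>G. finite G \<longrightarrow> G \<inter> F = {} \<longrightarrow> (\<Sum>n\<in>G. 1 / (real_of_int n)\<^sup>2) \<le> (e / 8)\<^sup>2"
    by (elim exE conjE)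
  \<comment> \<open>The errors of the coefficients with index in \<open>F\<close> add up to at most \<open>e / 4\<close>, and each of the two
    remainders contributes at most \<open>e / 8\<close>.\<close>
  define \<delta> where "\<delta> = e / (4 * real (card F + 1))"
  have \<delta>: "0 < \<delta>" using e by (simp add: \<delta>_def)
  have "\<exists>N. finite N \<and> N \<subseteq> crossed_lip_ball \<and> (\<forall>x\<in>crossed_lip_ball. \<exists>y\<in>N. \<forall>n\<in>F.
      dist (reduced_coefficient n x) (reduced_coefficient n y) < \<delta>)"
    by (rule simultaneous_finite_net[OF F(1) totally_bounded_reduced_coefficient \<delta>])
  then obtain N where N: "finite N" "N \<subseteq> crossed_lip_ball" "\<forall>x\<in>crossed_lip_ball. \<exists>y\<in>N. \<forall>n\<in>F.
      dist (reduced_coefficient n x) (reduced_coefficient n y) < \<delta>"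
    by (elim exE conjE)
  have "\<exists>y\<in>N. \<exists>c. norm (x - y - c *\<^sub>C 1) < e" if x: "x \<in> crossed_lip_ball" for x
  proof -
    obtain y where y: "y \<in> N"
      "\<forall>n\<in>F. dist (reduced_coefficient n x) (reduced_coefficient n y) < \<delta>"
      using N(3) x by blast
    have yB: "y \<in> crossed_lip_ball" using y(1) N(2) by blast
    let ?T = "\<lambda>x. x - \<omega> (coefficient x 0) *\<^sub>C 1 - (\<Sum>n\<in>F. reduced_coefficient n x * monomial 1 n)"
    have T: "norm (?T z) \<le> e / 8" if z: "z \<in> crossed_lip_ball" for z
      using z F(1,2) by (rule truncated_expansion) (use F(3) e in auto)
    let ?S = "\<Sum>n\<in>F. (reduced_coefficient n x - reduced_coefficient n y) * monomial 1 n"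
    have "norm ?S \<le> (\<Sum>n\<in>F. \<delta>)"
    proof (rule sum_norm_le)
      fix n
      assume n: "n \<in> F"
      have "norm ((reduced_coefficient n x - reduced_coefficient n y) * monomial 1 n) \<le>
          norm (reduced_coefficient n x - reduced_coefficient n y) * norm (monomial 1 n)"
        by (rule norm_mult_ineq)
      also have "\<dots> \<le> \<delta> * 1"
        using y(2) n norm_monomial_le[of 1 n] \<delta>
        by (intro mult_mono) (auto simp: dist_norm intro: less_imp_le)
      finally show "norm ((reduced_coefficient n x - reduced_coefficient n y) * monomial 1 n) \<le> \<delta>"
        by simp
    qed
    also have "\<dots> \<le> e / 4"
    proof -
      have "real (card F) * \<delta> \<le> real (card F + 1) * \<delta>" using \<delta> by (intro mult_right_mono) simp_all
      also have "\<dots> = e / 4" by (simp add: \<delta>_def field_simps)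
      finally show ?thesis by simp
    qed
    finally have S: "norm ?S \<le> e / 4" .
    have eq: "x - y - (\<omega> (coefficient x 0) - \<omega> (coefficient y 0)) *\<^sub>C 1 = ?S + (?T x - ?T y)"
      by (simp add: scaleC_diff_left left_diff_distrib sum_subtractf)
    have "norm (x - y - (\<omega> (coefficient x 0) - \<omega> (coefficient y 0)) *\<^sub>C 1) \<le>
        norm ?S + (norm (?T x) + norm (?T y))"
      unfolding eq by (intro order_trans[OF norm_triangle_ineq] add_left_mono norm_triangle_ineq4)
    also have "\<dots> \<le> e / 4 + (e / 8 + e / 8)" by (intro add_mono S T x yB)
    also have "\<dots> < e" using e by simp
    finally have "norm (x - y - (\<omega> (coefficient x 0) - \<omega> (coefficient y 0)) *\<^sub>C 1) < e" .
    then show ?thesis by (intro bexI[OF _ y(1)] exI)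
  qed
  then show "\<exists>N. finite N \<and> N \<subseteq> crossed_lip_ball \<and>
      (\<forall>x\<in>crossed_lip_ball. \<exists>y\<in>N. \<exists>c. norm (x - y - c *\<^sub>C 1) < e)"
    using N(1,2) by (intro exI[of _ N]) simp
qed

text \<open>
  Every element has a bounded commutator, and a multiple of it has the multiple of that commutator.
\<close>

lemma crossed_lip_absorbing:
  assumes x: "x \<in> crossed_Cc \<pi> \<alpha> \<A>"
  shows "\<exists>k>0. k *\<^sub>R x \<in> crossed_Cc \<pi> \<alpha> \<A> \<and> crossed_lip (k *\<^sub>R x) \<le> 1"
proof -
  obtain E where E: "commutator_on (crossed_dirac D) (x \<oplus>\<^sub>o x) E"
    using commutator_crossed_Cc[OF x] by blast
  define k where "k = 1 / (norm E + 1)"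
  have k: "0 < k" by (simp add: k_def add_nonneg_pos)
  have "linear_operator (crossed_dirac D)"
    using densely_defined_crossed_dirac by (simp add: densely_defined_def)
  then have "commutator_on (crossed_dirac D) (k *\<^sub>R (x \<oplus>\<^sub>o x)) (k *\<^sub>R E)"
    using E by (rule commutator_on_scaleR)
  moreover have "k *\<^sub>R (x \<oplus>\<^sub>o x) = (k *\<^sub>R x) \<oplus>\<^sub>o (k *\<^sub>R x)"
    by (rule bop_eqI) (simp add: direct_sum_bop_app scaleR_bop_app)
  ultimately have "crossed_lip (k *\<^sub>R x) = norm (k *\<^sub>R E)" by (intro lip_seminorm_crossed) simp
  also have "\<dots> = norm E / (norm E + 1)" using k by (simp add: k_def)
  also have "\<dots> \<le> 1" by (simp add: divide_le_eq_1 add_nonneg_pos)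
  finally have "crossed_lip (k *\<^sub>R x) \<le> 1" .
  moreover have "k *\<^sub>R x \<in> crossed_Cc \<pi> \<alpha> \<A>"
    using \<alpha>_in_\<A> x by (intro star_subalgebra_scaleR star_subalgebra_crossed_Cc \<A>_subalgebra) auto
  ultimately show ?thesis using k by blast
qed

lemma lip_metric_crossed:
  "lip_metric (crossed_product \<pi> \<alpha>) (crossed_Cc \<pi> \<alpha> \<A>) crossed_lip"
  by (rule lip_metricI[OF unital_crossed_product crossed_Cc_subset
        crossed_Cc_dense[OF \<A>_subalgebra \<A>_dense] crossed_lip_absorbing totally_bounded_crossed])

end

theorem theorem2p11:
  fixes \<pi> :: "'a::cstar_algebra \<Rightarrow> 'h::chilbert_space bop"
    and \<A> :: "'a set"
    and D\<^sub>A :: "('h \<times> 'h) set"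
    and \<alpha> :: "int \<Rightarrow> 'a \<Rightarrow> 'a"
  assumes "odd_spectral_triple UNIV \<A> \<pi> D\<^sub>A"
    and "lip_metric UNIV \<A> (lip_seminorm \<pi> D\<^sub>A)"
    and "group_action \<alpha>"
    and "metrically_equicontinuous \<A> (lip_seminorm \<pi> D\<^sub>A) \<alpha>"
  shows "even_spectral_triple (crossed_product \<pi> \<alpha>) (crossed_Cc \<pi> \<alpha> \<A>)
      (\<lambda>x. x \<oplus>\<^sub>o x) (crossed_dirac D\<^sub>A) \<and>
    lip_metric (crossed_product \<pi> \<alpha>) (crossed_Cc \<pi> \<alpha> \<A>)
      (lip_seminorm (\<lambda>x. x \<oplus>\<^sub>o x) (crossed_dirac D\<^sub>A))"
proof -
  interpret equicontinuous_system \<pi> \<alpha> \<A> D\<^sub>A using assms by unfold_locales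
  show ?thesis using even_spectral_triple_crossed lip_metric_crossed by blast
qed

end
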